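(* There exist a field $k$ and a local $k$-algebra $R$ for which the $R$-module $\operatorname{Der}_k(R)$ is finitely generated, such that: (a) $\operatorname{Gdim}_R(\operatorname{Der}_k(R))<\infty$; (b) $\operatorname{CI-dim}_R(\operatorname{Der}_k(R))<\infty$; (c) $R$ is not Gorenstein, and so $R$ is not a complete intersection ring.
   Context: All rings are commutative and noetherian. $\operatorname{Der}_k(R)$ is the $R$-module of derivations $D:R\to R$ (additive maps with $D(ab)=aD(b)+bD(a)$) vanishing on $k$. Write $(-)^*=\operatorname{Hom}_R(-,R)$. An $R$-module $M$ is totally reflexive if the natural map $M\to M^{**}$ is an isomorphism and $\operatorname{Ext}^i_R(M,R)=\operatorname{Ext}^i_R(M^*,R)=0$ for all $i\ge1$. $\operatorname{Gdim}_R(M)$ is the infimum of all $n\ge0$ for which there is an exact sequence $0\to G_n\to\cdots\to G_0\to M\to0$ with every $G_i$ totally reflexive. $\operatorname{CI-dim}_R(M)$ is the complete intersection dimension (in the sense of Avramov–Gasharov–Peeva): for a finitely generated nonzero module $M$ over a local ring $R$, it is the infimum of $\operatorname{pd}_Q(M\otimes_R R')-\operatorname{pd}_Q(R')$ over all quasi-deformations $R\to R'\leftarrow Q$, i.e. diagrams of local homomorphisms of local rings with $R\to R'$ flat and $Q\to R'$ surjective with kernel generated by a $Q$-regular sequence; the zero module has complete intersection dimension $0$. *)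

theory Defs
  imports "HOL-Algebra.Module" "HOL-Algebra.Ring_Divisibility" "HOL-Algebra.Ideal_Product"
    "HOL-Library.Extended_Real"
begin

text \<open>
  Quantification over "all modules" or "all rings" has to fix a carrier type. Below, the auxiliary
  modules and rings range over types built from the carrier types \<open>'m\<close> and \<open>'r\<close> of the
  given data, such as \<open>('m + 'r) list \<Rightarrow> 'r\<close>. A carrier type only bounds cardinalities, and each
  choice is large enough; the reason is given where it is not obvious.
\<close>

subsection \<open>Modules\<close>

text \<open>The fields \<open>mult\<close> and \<open>one\<close> of a module record play no role in \<^locale>\<open>module\<close>.\<close>

definition mk_mod :: "'m set \<Rightarrow> 'm \<Rightarrow> ('m \<Rightarrow> 'm \<Rightarrow> 'm) \<Rightarrow> ('r \<Rightarrow> 'm \<Rightarrow> 'm) \<Rightarrow> ('r, 'm) module"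
  where "mk_mod C z a s =
    \<lparr>carrier = C, mult = (\<lambda>_ _. z), one = z, zero = z, add = a, smult = s\<rparr>"

definition self_mod :: "('r, 'x) ring_scheme \<Rightarrow> ('r, 'r) module"
  where "self_mod R = mk_mod (carrier R) \<zero>\<^bsub>R\<^esub> (add R) (mult R)"

definition trivial_mod :: "('r, 'm) module \<Rightarrow> bool"
  where "trivial_mod M \<longleftrightarrow> carrier M = {\<zero>\<^bsub>M\<^esub>}"

definition finitely_generated :: "('r, 'x) ring_scheme \<Rightarrow> ('r, 'm) module \<Rightarrow> bool"
  where "finitely_generated R M \<longleftrightarrow>
    (\<exists>A. finite A \<and> A \<subseteq> carrier M \<and> (\<forall>N. submodule N R M \<and> A \<subseteq> N \<longrightarrow> N = carrier M))"

definition mod_span :: "('r, 'x) ring_scheme \<Rightarrow> ('r, 'm) module \<Rightarrow> 'm set \<Rightarrow> 'm set"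
  where "mod_span R M A = \<Inter>{N. submodule N R M \<and> A \<subseteq> N}"

definition quot_mod :: "('r, 'm) module \<Rightarrow> 'm set \<Rightarrow> ('r, 'm set) module"
  where "quot_mod M H =
    mk_mod (a_rcosets\<^bsub>M\<^esub> H) H (set_add M) (\<lambda>r X. \<Union>x\<in>X. H +>\<^bsub>M\<^esub> (r \<odot>\<^bsub>M\<^esub> x))"

definition restrict_scalars :: "('q \<Rightarrow> 'r) \<Rightarrow> ('r, 'm) module \<Rightarrow> ('q, 'm) module"
  where "restrict_scalars \<psi> M =
    mk_mod (carrier M) \<zero>\<^bsub>M\<^esub> (add M) (\<lambda>q x. \<psi> q \<odot>\<^bsub>M\<^esub> x)"

definition lin_maps ::
    "('r, 'x) ring_scheme \<Rightarrow> ('r, 'm) module \<Rightarrow> ('r, 'n) module \<Rightarrow> ('m \<Rightarrow> 'n) set"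
  where "lin_maps R M N = {f \<in> carrier M \<rightarrow> carrier N.
    (\<forall>x\<in>carrier M. \<forall>y\<in>carrier M. f (x \<oplus>\<^bsub>M\<^esub> y) = f x \<oplus>\<^bsub>N\<^esub> f y) \<and>
    (\<forall>r\<in>carrier R. \<forall>x\<in>carrier M. f (r \<odot>\<^bsub>M\<^esub> x) = r \<odot>\<^bsub>N\<^esub> f x)}"

definition Hom_mod ::
    "('r, 'x) ring_scheme \<Rightarrow> ('r, 'm) module \<Rightarrow> ('r, 'n) module \<Rightarrow> ('r, 'm \<Rightarrow> 'n) module"
  where "Hom_mod R M N = mk_mod
    (lin_maps R M N \<inter> extensional (carrier M))
    (\<lambda>x\<in>carrier M. \<zero>\<^bsub>N\<^esub>)
    (\<lambda>f g. \<lambda>x\<in>carrier M. f x \<oplus>\<^bsub>N\<^esub> g x)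
    (\<lambda>r f. \<lambda>x\<in>carrier M. r \<odot>\<^bsub>N\<^esub> f x)"

definition dual_mod :: "('r, 'x) ring_scheme \<Rightarrow> ('r, 'm) module \<Rightarrow> ('r, 'm \<Rightarrow> 'r) module"
  where "dual_mod R M = Hom_mod R M (self_mod R)"

definition bidual_map ::
    "('r, 'x) ring_scheme \<Rightarrow> ('r, 'm) module \<Rightarrow> 'm \<Rightarrow> ('m \<Rightarrow> 'r) \<Rightarrow> 'r"
  where "bidual_map R M = (\<lambda>x\<in>carrier M. \<lambda>f\<in>carrier (dual_mod R M). f x)"

definition free_mod :: "('r, 'x) ring_scheme \<Rightarrow> 'i set \<Rightarrow> ('r, 'i \<Rightarrow> 'r) module"
  where "free_mod R S = mk_mod
    {f. (\<forall>i. f i \<in> carrier R) \<and> (\<forall>i. i \<notin> S \<longrightarrow> f i = \<zero>\<^bsub>R\<^esub>) \<and> finite {i. f i \<noteq> \<zero>\<^bsub>R\<^esub>}}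
    (\<lambda>_. \<zero>\<^bsub>R\<^esub>)
    (\<lambda>f g i. f i \<oplus>\<^bsub>R\<^esub> g i)
    (\<lambda>r f i. r \<otimes>\<^bsub>R\<^esub> f i)"

definition free_gen :: "('r, 'x) ring_scheme \<Rightarrow> 'i \<Rightarrow> 'i \<Rightarrow> 'r"
  where "free_gen R i = (\<lambda>j. if j = i then \<one>\<^bsub>R\<^esub> else \<zero>\<^bsub>R\<^esub>)"


subsection \<open>Resolutions and Ext\<close>

text \<open>Exactness of \<open>\<dots> \<rightarrow> G 1 \<rightarrow> G 0 \<rightarrow> M \<rightarrow> 0\<close>, where \<open>d i\<close> maps \<open>G (Suc i)\<close> to \<open>G i\<close>.\<close>

definition resolution :: "('r, 'x) ring_scheme \<Rightarrow> ('r, 'm) module \<Rightarrow>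
    (nat \<Rightarrow> ('r, 'g) module) \<Rightarrow> (nat \<Rightarrow> 'g \<Rightarrow> 'g) \<Rightarrow> ('g \<Rightarrow> 'm) \<Rightarrow> bool"
  where "resolution R M G d \<epsilon> \<longleftrightarrow>
    (\<forall>i. module R (G i)) \<and>
    \<epsilon> \<in> lin_maps R (G 0) M \<and> (\<forall>i. d i \<in> lin_maps R (G (Suc i)) (G i)) \<and>
    \<epsilon> ` carrier (G 0) = carrier M \<and>
    a_kernel (G 0) M \<epsilon> = d 0 ` carrier (G 1) \<and>
    (\<forall>i. a_kernel (G (Suc i)) (G i) (d i) = d (Suc i) ` carrier (G (Suc (Suc i))))"

text \<open>Exactness of \<open>0 \<rightarrow> M \<rightarrow> E 0 \<rightarrow> E 1 \<rightarrow> \<dots>\<close>, where \<open>d i\<close> maps \<open>E i\<close> to \<open>E (Suc i)\<close>.\<close>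

definition coresolution :: "('r, 'x) ring_scheme \<Rightarrow> ('r, 'm) module \<Rightarrow>
    (nat \<Rightarrow> ('r, 'g) module) \<Rightarrow> (nat \<Rightarrow> 'g \<Rightarrow> 'g) \<Rightarrow> ('m \<Rightarrow> 'g) \<Rightarrow> bool"
  where "coresolution R M E d \<eta> \<longleftrightarrow>
    (\<forall>i. module R (E i)) \<and>
    \<eta> \<in> lin_maps R M (E 0) \<and> (\<forall>i. d i \<in> lin_maps R (E i) (E (Suc i))) \<and>
    inj_on \<eta> (carrier M) \<and>
    a_kernel (E 0) (E 1) (d 0) = \<eta> ` carrier M \<and>
    (\<forall>i. a_kernel (E (Suc i)) (E (Suc (Suc i))) (d (Suc i)) = d i ` carrier (E i))"

text \<open>
  Ext is the cohomology of the Hom complex of a free resolution. The index type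
  \<open>('m + 'r) list\<close> is infinite and at least as large as \<open>'m\<close> and \<open>'r\<close>, and so at least as large
  as the carrier of any free module over it: every module over \<open>R\<close> with carrier in \<open>'m\<close> has a
  free resolution with bases in this type. Up to isomorphism Ext does not depend on which
  resolution is chosen.
\<close>

definition chosen_free_resolution :: "('r, 'x) ring_scheme \<Rightarrow> ('r, 'm) module \<Rightarrow>
    (nat \<Rightarrow> ('m + 'r) list set) \<times> (nat \<Rightarrow> (('m + 'r) list \<Rightarrow> 'r) \<Rightarrow> ('m + 'r) list \<Rightarrow> 'r)"
  where "chosen_free_resolution R M =
    (SOME (S, d). \<exists>\<epsilon>. resolution R M (\<lambda>n. free_mod R (S n)) d \<epsilon>)"

definition Ext_mod :: "('r, 'x) ring_scheme \<Rightarrow> nat \<Rightarrow> ('r, 'm) module \<Rightarrow> ('r, 'n) module \<Rightarrow>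
    ('r, ((('m + 'r) list \<Rightarrow> 'r) \<Rightarrow> 'n) set) module"
  where "Ext_mod R i M N =
    (let (S, d) = chosen_free_resolution R M;
         F = (\<lambda>n. free_mod R (S n));
         C = (\<lambda>n. Hom_mod R (F n) N);
         Z = {f \<in> carrier (C i). \<forall>x\<in>carrier (F (Suc i)). f (d i x) = \<zero>\<^bsub>N\<^esub>};
         B = (case i of 0 \<Rightarrow> {\<zero>\<^bsub>C 0\<^esub>}
              | Suc j \<Rightarrow> (\<lambda>g. \<lambda>x\<in>carrier (F i). g (d j x)) ` carrier (C j))
     in quot_mod (C i\<lparr>carrier := Z\<rparr>) B)"


subsection \<open>Homological dimensions\<close>

definition totally_reflexive :: "('r, 'x) ring_scheme \<Rightarrow> ('r, 'm) module \<Rightarrow> bool"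
  where "totally_reflexive R M \<longleftrightarrow> module R M \<and>
    bij_betw (bidual_map R M) (carrier M) (carrier (dual_mod R (dual_mod R M))) \<and>
    (\<forall>i\<ge>1. trivial_mod (Ext_mod R i M (self_mod R)) \<and>
            trivial_mod (Ext_mod R i (dual_mod R M) (self_mod R)))"

text \<open>
  For finitely generated \<open>M\<close> over a noetherian ring the carrier type of the \<open>G i\<close> is no
  restriction: if the G-dimension is at most \<open>n\<close>, then resolving \<open>M\<close> by finite free modules and
  stopping at the \<open>n\<close>-th syzygy gives a resolution by finitely generated totally reflexive modules.
\<close>

definition Gdim :: "('r, 'x) ring_scheme \<Rightarrow> ('r, 'm) module \<Rightarrow> enat"
  where "Gdim R M = Inf {enat n | n.
    \<exists>(G :: nat \<Rightarrow> ('r, ('m + 'r) list \<Rightarrow> 'r) module) d \<epsilon>.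
      resolution R M G d \<epsilon> \<and>
      (\<forall>i\<le>n. totally_reflexive R (G i)) \<and> (\<forall>i>n. trivial_mod (G i))}"

text \<open>
  Projective means: a direct summand of a free module. A basis in the carrier type suffices, since
  a projective \<open>P\<close> is a summand of the free module on the set \<open>P\<close>.
\<close>

definition projective :: "('r, 'x) ring_scheme \<Rightarrow> ('r, 'm) module \<Rightarrow> bool"
  where "projective R P \<longleftrightarrow> module R P \<and>
    (\<exists>(S :: 'm set). \<exists>f \<in> lin_maps R P (free_mod R S). \<exists>g \<in> lin_maps R (free_mod R S) P.
      \<forall>x\<in>carrier P. g (f x) = x)"

definition proj_dim :: "('r, 'x) ring_scheme \<Rightarrow> ('r, 'm) module \<Rightarrow> enat"
  where "proj_dim R M = Inf {enat n | n.
    \<exists>(P :: nat \<Rightarrow> ('r, ('m + 'r) list \<Rightarrow> 'r) module) d \<epsilon>.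
      resolution R M P d \<epsilon> \<and>
      (\<forall>i\<le>n. projective R (P i)) \<and> (\<forall>i>n. trivial_mod (P i))}"

text \<open>
  The carrier type of the test modules \<open>B\<close> accommodates copies of \<open>R\<close>, so by Baer's criterion
  restricting to it makes no difference.
\<close>

definition injective :: "('r, 'x) ring_scheme \<Rightarrow> ('r, 'm) module \<Rightarrow> bool"
  where "injective R E \<longleftrightarrow> module R E \<and>
    (\<forall>(B :: ('r, ('m + 'r) list \<Rightarrow> 'r) module) A. module R B \<and> submodule A R B \<longrightarrow>
      (\<forall>f \<in> lin_maps R (B\<lparr>carrier := A\<rparr>) E. \<exists>g \<in> lin_maps R B E. \<forall>x\<in>A. g x = f x))"

text \<open>
  Over a noetherian ring, the injective hull of a module \<open>M\<close> has cardinality at most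
  \<open>|M| + |R| + \<aleph>\<^sub>0\<close>, so minimal injective resolutions exist within the carrier type used here.
\<close>

definition inj_dim :: "('r, 'x) ring_scheme \<Rightarrow> ('r, 'm) module \<Rightarrow> enat"
  where "inj_dim R M = Inf {enat n | n.
    \<exists>(E :: nat \<Rightarrow> ('r, ('m + 'r) list \<Rightarrow> 'r) module) d \<eta>.
      coresolution R M E d \<eta> \<and>
      (\<forall>i\<le>n. injective R (E i)) \<and> (\<forall>i>n. trivial_mod (E i))}"


subsection \<open>Base change and flatness\<close>

text \<open>
  \<open>M \<otimes>\<^bsub>R\<^esub> S\<close> as an \<open>S\<close>-module, for a ring homomorphism \<open>\<phi>\<close> from \<open>R\<close> to \<open>S\<close>: the generator
  \<open>e x t\<close> stands for \<open>x \<otimes> t\<close>, and the last relation says that \<open>S\<close> acts on the second factor.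
\<close>

definition tensor_rels :: "('r, 'x) ring_scheme \<Rightarrow> ('r \<Rightarrow> 's) \<Rightarrow> ('s, 'y) ring_scheme \<Rightarrow>
    ('r, 'm) module \<Rightarrow> ('m \<times> 's \<Rightarrow> 's) set"
  where "tensor_rels R \<phi> S M =
    (let F = free_mod S (carrier M \<times> carrier S); e = (\<lambda>x t. free_gen S (x, t)) in
      {e (x \<oplus>\<^bsub>M\<^esub> y) t \<ominus>\<^bsub>F\<^esub> (e x t \<oplus>\<^bsub>F\<^esub> e y t) | x y t.
         x \<in> carrier M \<and> y \<in> carrier M \<and> t \<in> carrier S} \<union>
      {e x (t \<oplus>\<^bsub>S\<^esub> u) \<ominus>\<^bsub>F\<^esub> (e x t \<oplus>\<^bsub>F\<^esub> e x u) | x t u.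
         x \<in> carrier M \<and> t \<in> carrier S \<and> u \<in> carrier S} \<union>
      {e (r \<odot>\<^bsub>M\<^esub> x) t \<ominus>\<^bsub>F\<^esub> e x (\<phi> r \<otimes>\<^bsub>S\<^esub> t) | r x t.
         r \<in> carrier R \<and> x \<in> carrier M \<and> t \<in> carrier S} \<union>
      {e x (s \<otimes>\<^bsub>S\<^esub> t) \<ominus>\<^bsub>F\<^esub> s \<odot>\<^bsub>F\<^esub> e x t | x s t.
         x \<in> carrier M \<and> s \<in> carrier S \<and> t \<in> carrier S})"

definition tensor_ker :: "('r, 'x) ring_scheme \<Rightarrow> ('r \<Rightarrow> 's) \<Rightarrow> ('s, 'y) ring_scheme \<Rightarrow>
    ('r, 'm) module \<Rightarrow> ('m \<times> 's \<Rightarrow> 's) set"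
  where "tensor_ker R \<phi> S M =
    mod_span S (free_mod S (carrier M \<times> carrier S)) (tensor_rels R \<phi> S M)"

definition base_change :: "('r, 'x) ring_scheme \<Rightarrow> ('r \<Rightarrow> 's) \<Rightarrow> ('s, 'y) ring_scheme \<Rightarrow>
    ('r, 'm) module \<Rightarrow> ('s, ('m \<times> 's \<Rightarrow> 's) set) module"
  where "base_change R \<phi> S M =
    quot_mod (free_mod S (carrier M \<times> carrier S)) (tensor_ker R \<phi> S M)"

text \<open>The map \<open>f \<otimes> id\<close> on cosets, induced by \<open>e x t \<mapsto> e (f x) t\<close> on the free modules.\<close>

definition base_change_map :: "('r, 'x) ring_scheme \<Rightarrow> ('r \<Rightarrow> 's) \<Rightarrow> ('s, 'y) ring_scheme \<Rightarrow>
    ('r, 'm) module \<Rightarrow> ('r, 'n) module \<Rightarrow> ('m \<Rightarrow> 'n) \<Rightarrow>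
    ('m \<times> 's \<Rightarrow> 's) set \<Rightarrow> ('n \<times> 's \<Rightarrow> 's) set"
  where "base_change_map R \<phi> S M N f X =
    (\<Union>z\<in>X. tensor_ker R \<phi> S N +>\<^bsub>free_mod S (carrier N \<times> carrier S)\<^esub>
      (\<lambda>(y, t). finsum S (\<lambda>x. z (x, t)) {x \<in> carrier M. f x = y \<and> z (x, t) \<noteq> \<zero>\<^bsub>S\<^esub>}))"

text \<open>
  Flatness may be tested on the inclusions of ideals into \<open>R\<close>, so the carrier type of the test
  modules is no restriction.
\<close>

definition flat_hom :: "('r, 'x) ring_scheme \<Rightarrow> ('r \<Rightarrow> 's) \<Rightarrow> ('s, 'y) ring_scheme \<Rightarrow> bool"
  where "flat_hom R \<phi> S \<longleftrightarrow> \<phi> \<in> ring_hom R S \<and>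
    (\<forall>(M :: ('r, 'r list \<Rightarrow> 'r) module) (N :: ('r, 'r list \<Rightarrow> 'r) module) f.
      module R M \<and> module R N \<and> f \<in> lin_maps R M N \<and> inj_on f (carrier M) \<longrightarrow>
      inj_on (base_change_map R \<phi> S M N f) (carrier (base_change R \<phi> S M)))"


subsection \<open>Local rings\<close>

definition local_ring :: "('r, 'x) ring_scheme \<Rightarrow> bool"
  where "local_ring R \<longleftrightarrow> cring R \<and> noetherian_ring R \<and> (\<exists>!I. maximalideal I R)"

definition max_ideal :: "('r, 'x) ring_scheme \<Rightarrow> 'r set"
  where "max_ideal R = (THE I. maximalideal I R)"

definition local_hom :: "('r, 'x) ring_scheme \<Rightarrow> ('s, 'y) ring_scheme \<Rightarrow> ('r \<Rightarrow> 's) set"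
  where "local_hom R S = {\<phi> \<in> ring_hom R S. \<phi> ` max_ideal R \<subseteq> max_ideal S}"

definition regular_seq :: "('r, 'x) ring_scheme \<Rightarrow> 'r list \<Rightarrow> bool"
  where "regular_seq R xs \<longleftrightarrow> set xs \<subseteq> carrier R \<and>
    (\<forall>i<length xs. \<forall>a\<in>carrier R.
      xs ! i \<otimes>\<^bsub>R\<^esub> a \<in> Idl\<^bsub>R\<^esub> (set (take i xs)) \<longrightarrow> a \<in> Idl\<^bsub>R\<^esub> (set (take i xs))) \<and>
    Idl\<^bsub>R\<^esub> (set xs) \<noteq> carrier R"

definition krull_dim :: "('r, 'x) ring_scheme \<Rightarrow> enat"
  where "krull_dim R = Sup {enat n | n.
    \<exists>P. (\<forall>i\<le>n. primeideal (P i) R) \<and> (\<forall>i<n. P i \<subset> P (Suc i))}"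

definition regular_local_ring :: "('r, 'x) ring_scheme \<Rightarrow> bool"
  where "regular_local_ring R \<longleftrightarrow> local_ring R \<and>
    (\<exists>A. finite A \<and> A \<subseteq> carrier R \<and> max_ideal R = Idl\<^bsub>R\<^esub> A \<and> enat (card A) = krull_dim R)"

primrec ideal_pow :: "('r, 'x) ring_scheme \<Rightarrow> 'r set \<Rightarrow> nat \<Rightarrow> 'r set"
  where "ideal_pow R I 0 = carrier R"
  | "ideal_pow R I (Suc n) = I \<cdot>\<^bsub>R\<^esub> ideal_pow R I n"

text \<open>
  The completion of a local ring at its maximal ideal, as the inverse limit of the quotients by
  the powers of that ideal.
  The transition maps send a coset of a power to the coset of the preceding power containing it.
\<close>

definition completion :: "('r, 'x) ring_scheme \<Rightarrow> (nat \<Rightarrow> 'r set) ring"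
  where "completion R = (let A = (\<lambda>n. R Quot ideal_pow R (max_ideal R) n) in
    \<lparr>carrier = {a. \<forall>n. a n \<in> carrier (A n) \<and> a (Suc n) \<subseteq> a n},
     mult = (\<lambda>a b n. a n \<otimes>\<^bsub>A n\<^esub> b n),
     one = (\<lambda>n. \<one>\<^bsub>A n\<^esub>),
     zero = (\<lambda>n. \<zero>\<^bsub>A n\<^esub>),
     add = (\<lambda>a b n. a n \<oplus>\<^bsub>A n\<^esub> b n)\<rparr>)"

definition gorenstein :: "('r, 'x) ring_scheme \<Rightarrow> bool"
  where "gorenstein R \<longleftrightarrow> local_ring R \<and> inj_dim R (self_mod R) < \<infinity>"

text \<open>
  A regular \<open>Q\<close> as below may be replaced by its completion, which has the residue field of \<open>R\<close> and
  therefore at most \<open>|R|\<close> to the power \<open>\<aleph>\<^sub>0\<close> elements, so the carrier type is no restriction.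
\<close>

definition complete_intersection :: "('r, 'x) ring_scheme \<Rightarrow> bool"
  where "complete_intersection R \<longleftrightarrow> local_ring R \<and>
    (\<exists>(Q :: (nat \<Rightarrow> 'r) ring) xs. regular_local_ring Q \<and> regular_seq Q xs \<and>
      completion R \<simeq> Q Quot (Idl\<^bsub>Q\<^esub> (set xs)))"


subsection \<open>Complete intersection dimension\<close>

definition quasi_deformation :: "('r, 'x) ring_scheme \<Rightarrow> ('s, 'y) ring_scheme \<Rightarrow>
    ('q, 'z) ring_scheme \<Rightarrow> ('r \<Rightarrow> 's) \<Rightarrow> ('q \<Rightarrow> 's) \<Rightarrow> bool"
  where "quasi_deformation R R' Q \<phi> \<psi> \<longleftrightarrow>
    local_ring R \<and> local_ring R' \<and> local_ring Q \<and>
    \<phi> \<in> local_hom R R' \<and> flat_hom R \<phi> R' \<and>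
    \<psi> \<in> local_hom Q R' \<and> \<psi> ` carrier Q = carrier R' \<and>
    (\<exists>xs. regular_seq Q xs \<and> a_kernel Q R' \<psi> = Idl\<^bsub>Q\<^esub> (set xs))"

text \<open>
  Intended for finitely generated \<open>M\<close>. The rings \<open>R'\<close> and \<open>Q\<close> range over the type \<open>nat \<Rightarrow> 'r\<close>, which
  has the cardinality of the countable sequences in \<open>'r\<close> and accommodates localisations,
  completions and power series extensions of rings with carrier in \<open>'r\<close>. Restricting the rings can
  only enlarge the infimum, so finiteness of the value below implies finiteness for quasi-deformations of
  arbitrary size. The projective dimension of \<open>R'\<close> over \<open>Q\<close> is always finite.
\<close>

definition CIdim :: "('r, 'x) ring_scheme \<Rightarrow> ('r, 'm) module \<Rightarrow> ereal"
  where "CIdim R M = (if trivial_mod M then 0 else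
    Inf {ereal_of_enat (proj_dim Q (restrict_scalars \<psi> (base_change R \<phi> R' M))) -
         ereal_of_enat (proj_dim Q (restrict_scalars \<psi> (self_mod R'))) |
         (R' :: (nat \<Rightarrow> 'r) ring) (Q :: (nat \<Rightarrow> 'r) ring) \<phi> \<psi>. quasi_deformation R R' Q \<phi> \<psi>})"


subsection \<open>Derivations\<close>

text \<open>The \<open>R\<close>-module of derivations of a \<open>k\<close>-algebra \<open>R\<close> that vanish on the image of \<open>k\<close>.\<close>

definition Der :: "('k, 'y) ring_scheme \<Rightarrow> ('k, 'r) module \<Rightarrow> ('r, 'r \<Rightarrow> 'r) module"
  where "Der k R = mk_mod
    {D \<in> extensional (carrier R) \<inter> (carrier R \<rightarrow> carrier R).
      (\<forall>a\<in>carrier R. \<forall>b\<in>carrier R. D (a \<oplus>\<^bsub>R\<^esub> b) = D a \<oplus>\<^bsub>R\<^esub> D b) \<and>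
      (\<forall>a\<in>carrier R. \<forall>b\<in>carrier R. D (a \<otimes>\<^bsub>R\<^esub> b) = a \<otimes>\<^bsub>R\<^esub> D b \<oplus>\<^bsub>R\<^esub> b \<otimes>\<^bsub>R\<^esub> D a) \<and>
      (\<forall>c\<in>carrier k. D (c \<odot>\<^bsub>R\<^esub> \<one>\<^bsub>R\<^esub>) = \<zero>\<^bsub>R\<^esub>)}
    (\<lambda>x\<in>carrier R. \<zero>\<^bsub>R\<^esub>)
    (\<lambda>D E. \<lambda>x\<in>carrier R. D x \<oplus>\<^bsub>R\<^esub> E x)
    (\<lambda>r D. \<lambda>x\<in>carrier R. r \<otimes>\<^bsub>R\<^esub> D x)"

end

theory Submission
  imports Defs "HOL-Algebra.Algebraic_Closure_Type" "HOL-Library.Z2" "HOL-Library.Countable_Set"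
begin

text \<open>
  The example has \<open>Der\<^sub>k R = 0\<close>. Let \<open>F\<close> be the algebraic closure of \<open>\<bbbF>\<^sub>2(s, t)\<close> and
  \<open>R = F[a, b] / (a\<^sup>2, ab, b\<^sup>2)\<close>, a local ring with residue field \<open>F\<close> whose maximal ideal \<open>m\<close> has square
  zero and dimension \<open>2\<close>. The point is that \<open>R\<close> is not regarded as an algebra over a subfield of \<open>F\<close>:
  the field \<open>k\<close> is the copy of \<open>\<bbbF>\<^sub>2(s, t)\<close> in \<open>R\<close> that is generated by \<open>s + a\<close> and \<open>t + b\<close>. A derivation of
  \<open>R\<close> kills squares, because the characteristic is \<open>2\<close>, hence it kills the perfect field \<open>F\<close>. If it
  vanishes on \<open>k\<close>, then it kills \<open>s + a\<close> and \<open>t + b\<close>, hence also \<open>a\<close> and \<open>b\<close>, and so all of \<open>R\<close>. This is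
  \<open>Der_trivial\<close>.

  The complete intersection dimension of the zero module is \<open>0\<close> by definition. Its G-dimension is \<open>0\<close>
  because a free resolution of the zero module is contractible, so that all its Ext modules vanish
  (\<open>Ext_zero\<close>).

  \<open>R\<close> is not Gorenstein (\<open>not_gorenstein\<close>): the first syzygy of the residue field is \<open>m\<close>, two copies of the
  residue field, so if \<open>Ext\<^sup>i(F, R)\<close> vanishes for some \<open>i \<ge> 1\<close>, then it vanishes for \<open>i = 1\<close>. But then every
  linear map \<open>m \<rightarrow> R\<close> would be a multiplication, and \<open>a \<mapsto> a, b \<mapsto> 0\<close> is not. The proof walks down an
  injective coresolution with the elementary form \<open>lifts\<close> of the vanishing of \<open>Ext\<^sup>1(F, _)\<close>.

  \<open>R\<close> is its own completion. Were it a quotient of a regular local ring \<open>Q\<close> of dimension \<open>n\<close> by an ideal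
  \<open>I\<close> generated by a regular sequence, then \<open>I\<close> would have at most \<open>n\<close> generators, since a regular
  sequence gives a chain of primes of the same length (\<open>regular_seq_length\<close>). On the other hand
  \<open>M\<^sup>2 \<subseteq> I\<close> for the maximal ideal \<open>M\<close> of \<open>Q\<close>, and \<open>M / I\<close> has dimension \<open>2\<close>. So \<open>n - 2\<close> elements of
  \<open>I\<close> belong to a minimal generating set of \<open>M\<close>, and together with the three quadratic monomials in the
  other two generators they are \<open>n + 1\<close> elements of \<open>I\<close>, dependent modulo \<open>M I\<close>. The relation produces an
  ideal primary to \<open>M\<close> with \<open>n - 1\<close> generators (\<open>square_zero_quotient_generators\<close>), against Krull's
  height theorem (\<open>krull_height\<close>). The height theorem is proved with the help of symbolic powers;
  localisations are replaced by multiplying with elements outside a prime.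
\<close>

section \<open>Ideals in commutative rings\<close>

context cring
begin

lemma ideal_intro:
  assumes "I \<subseteq> carrier R" "\<zero> \<in> I" "\<And>x y. x \<in> I \<Longrightarrow> y \<in> I \<Longrightarrow> x \<oplus> y \<in> I"
    "\<And>r x. r \<in> carrier R \<Longrightarrow> x \<in> I \<Longrightarrow> r \<otimes> x \<in> I"
  shows "ideal I R"
proof (rule idealI)
  show "ring R" by (rule ring_axioms)
  show "subgroup I (add_monoid R)"
  proof (rule add.subgroupI)
    show "I \<subseteq> carrier R" by (rule assms)
    show "I \<noteq> {}" using assms by auto
    show "\<ominus> a \<in> I" if "a \<in> I" for a
    proof -
      have a: "a \<in> carrier R" using that assms by auto
      have "\<ominus> \<one> \<otimes> a = \<ominus> a" using a by (simp add: l_minus)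
      moreover have "\<ominus> \<one> \<otimes> a \<in> I" using that assms by simp
      ultimately show ?thesis by (simp add: a_inv_def)
    qed
    show "a \<oplus> b \<in> I" if "a \<in> I" "b \<in> I" for a b using that assms by auto
  qed
  show "x \<otimes> a \<in> I" if "a \<in> I" "x \<in> carrier R" for a x using that assms by auto
  show "a \<otimes> x \<in> I" if "a \<in> I" "x \<in> carrier R" for a x
    using that assms by (metis m_comm subsetD)
qed

lemma ideal_memD:
  assumes "ideal I R"
  shows ideal_carrier: "x \<in> I \<Longrightarrow> x \<in> carrier R"
    and ideal_zero: "\<zero> \<in> I"
    and ideal_add: "x \<in> I \<Longrightarrow> y \<in> I \<Longrightarrow> x \<oplus> y \<in> I"
    and ideal_lmult: "x \<in> I \<Longrightarrow> r \<in> carrier R \<Longrightarrow> r \<otimes> x \<in> I"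
    and ideal_rmult: "x \<in> I \<Longrightarrow> r \<in> carrier R \<Longrightarrow> x \<otimes> r \<in> I"
    and ideal_uminus: "x \<in> I \<Longrightarrow> \<ominus> x \<in> I"
    and ideal_diff: "x \<in> I \<Longrightarrow> y \<in> I \<Longrightarrow> x \<ominus> y \<in> I"
proof -
  interpret ideal I R by fact
  show "x \<in> I \<Longrightarrow> x \<in> carrier R" by (rule Icarr)
  show "\<zero> \<in> I" by (rule zero_closed)
  show "x \<in> I \<Longrightarrow> y \<in> I \<Longrightarrow> x \<oplus> y \<in> I" by (rule a_closed)
  show "x \<in> I \<Longrightarrow> r \<in> carrier R \<Longrightarrow> r \<otimes> x \<in> I" by (rule I_l_closed)
  show "x \<in> I \<Longrightarrow> r \<in> carrier R \<Longrightarrow> x \<otimes> r \<in> I" by (rule I_r_closed)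
  show *: "x \<in> I \<Longrightarrow> \<ominus> x \<in> I" for x by (simp add: a_inv_closed)
  show "x \<in> I \<Longrightarrow> y \<in> I \<Longrightarrow> x \<ominus> y \<in> I"
    unfolding a_minus_def using * by (simp add: a_closed)
qed

lemma set_add_upper:
  assumes "ideal I R" "ideal J R"
  shows "I \<subseteq> I <+>\<^bsub>R\<^esub> J" "J \<subseteq> I <+>\<^bsub>R\<^esub> J"
proof -
  note I = ideal_memD[OF assms(1)] and J = ideal_memD[OF assms(2)]
  have "x \<in> I <+>\<^bsub>R\<^esub> J" if x: "x \<in> I" for x
  proof -
    have "x = x \<oplus> \<zero>" using I(1)[OF x] by simp
    then show ?thesis using x J(2) unfolding set_add_def' by blast
  qed
  moreover have "x \<in> I <+>\<^bsub>R\<^esub> J" if x: "x \<in> J" for x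
  proof -
    have "x = \<zero> \<oplus> x" using J(1)[OF x] by simp
    then show ?thesis using x I(2) unfolding set_add_def' by blast
  qed
  ultimately show "I \<subseteq> I <+>\<^bsub>R\<^esub> J" "J \<subseteq> I <+>\<^bsub>R\<^esub> J" by auto
qed

lemma primeD:
  assumes "primeideal P R"
  shows prime_ideal: "ideal P R"
    and prime_one: "\<one> \<notin> P"
    and prime_multD: "a \<in> carrier R \<Longrightarrow> b \<in> carrier R \<Longrightarrow> a \<otimes> b \<in> P \<Longrightarrow> a \<in> P \<or> b \<in> P"
proof -
  interpret primeideal P R by fact
  show "ideal P R" by (rule is_ideal)
  show "\<one> \<notin> P" using I_notcarr one_imp_carrier by auto
  show "a \<in> carrier R \<Longrightarrow> b \<in> carrier R \<Longrightarrow> a \<otimes> b \<in> P \<Longrightarrow> a \<in> P \<or> b \<in> P" by (rule I_prime)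
qed

lemma prime_mult_closed:
  assumes "primeideal P R" "s \<in> carrier R - P" "t \<in> carrier R - P"
  shows "s \<otimes> t \<in> carrier R - P"
  using primeD[OF assms(1)] assms by auto

lemma prime_pow:
  assumes "primeideal P R" "x \<in> carrier R" "x [^] (e::nat) \<in> P"
  shows "x \<in> P"
  using assms(3)
proof (induction e)
  case 0
  then show ?case using primeD[OF assms(1)] by simp
next
  case (Suc e)
  then show ?case using primeD[OF assms(1)] assms(2) by (metis nat_pow_Suc nat_pow_closed)
qed

text \<open>\<open>comb P N gs\<close> is \<open>N + P g\<^sub>1 + \<dots> + P g\<^sub>m\<close>; for \<open>P\<close> the whole ring this is the ideal generated by
  \<open>N\<close> and the entries of the list.\<close>

primrec comb :: "'a set \<Rightarrow> 'a set \<Rightarrow> 'a list \<Rightarrow> 'a set"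
  where "comb P N [] = N"
  | "comb P N (g # gs) = {p \<otimes> g \<oplus> n | p n. p \<in> P \<and> n \<in> comb P N gs}"

lemma comb_ideal:
  assumes "ideal P R" "ideal N R" "set gs \<subseteq> carrier R"
  shows "ideal (comb P N gs) R"
  using assms(3)
proof (induction gs)
  case Nil
  then show ?case using assms by simp
next
  case (Cons g gs)
  then have g: "g \<in> carrier R" and I: "ideal (comb P N gs) R" by auto
  note P = ideal_memD[OF assms(1)] and I' = ideal_memD[OF I]
  show ?case
  proof (rule ideal_intro)
    show "comb P N (g # gs) \<subseteq> carrier R" using g P I' by auto
    have "\<zero> = \<zero> \<otimes> g \<oplus> \<zero>" using g by simp
    then show "\<zero> \<in> comb P N (g # gs)" using P(2) I'(2) unfolding comb.simps mem_Collect_eq by blast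
    show "x \<oplus> y \<in> comb P N (g # gs)" if xy: "x \<in> comb P N (g # gs)" "y \<in> comb P N (g # gs)" for x y
    proof -
      obtain p n p' n' where *: "x = p \<otimes> g \<oplus> n" "y = p' \<otimes> g \<oplus> n'" "p \<in> P" "p' \<in> P"
        "n \<in> comb P N gs" "n' \<in> comb P N gs" using xy by auto
      have c: "p \<in> carrier R" "p' \<in> carrier R" "n \<in> carrier R" "n' \<in> carrier R" using * P(1) I'(1) by auto
      have "x \<oplus> y = (p \<oplus> p') \<otimes> g \<oplus> (n \<oplus> n')" unfolding * using c g by algebra
      moreover have "p \<oplus> p' \<in> P" "n \<oplus> n' \<in> comb P N gs" using * P(3) I'(3) by auto
      ultimately show ?thesis by auto
    qed
    show "r \<otimes> x \<in> comb P N (g # gs)" if r: "r \<in> carrier R" and x: "x \<in> comb P N (g # gs)" for r x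
    proof -
      obtain p n where *: "x = p \<otimes> g \<oplus> n" "p \<in> P" "n \<in> comb P N gs" using x by auto
      have c: "p \<in> carrier R" "n \<in> carrier R" using * P(1) I'(1) by auto
      have "r \<otimes> x = (r \<otimes> p) \<otimes> g \<oplus> (r \<otimes> n)" unfolding * using c g r by algebra
      moreover have "r \<otimes> p \<in> P" "r \<otimes> n \<in> comb P N gs" using * P(4) I'(4) r by auto
      ultimately show ?thesis by auto
    qed
  qed
qed

lemma comb_base:
  assumes "ideal P R" "ideal N R" "set gs \<subseteq> carrier R"
  shows "N \<subseteq> comb P N gs"
  using assms(3)
proof (induction gs)
  case (Cons g gs)
  have "x \<in> comb P N (g # gs)" if "x \<in> N" for x
  proof -
    have "x = \<zero> \<otimes> g \<oplus> x" using Cons.prems ideal_memD[OF assms(2)] that by simp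
    moreover have "\<zero> \<in> P" using ideal_memD[OF assms(1)] by simp
    ultimately show ?thesis using Cons that unfolding comb.simps mem_Collect_eq
      by (metis insert_subset list.set(2) subsetD)
  qed
  then show ?case by auto
qed auto

lemma comb_gen:
  assumes "ideal P R" "ideal N R" "set gs \<subseteq> carrier R" "p \<in> P" "g \<in> set gs"
  shows "p \<otimes> g \<in> comb P N gs"
  using assms(3,5)
proof (induction gs)
  case (Cons h gs)
  have I: "ideal (comb P N gs) R" using comb_ideal[OF assms(1,2)] Cons.prems by auto
  have pc: "p \<in> carrier R" using ideal_memD[OF assms(1)] assms(4) by simp
  show ?case
  proof (cases "g = h")
    case True
    have "p \<otimes> g = p \<otimes> h \<oplus> \<zero>" using Cons.prems pc True by simp
    then show ?thesis using assms(4) ideal_zero[OF I] by auto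
  next
    case False
    then have "p \<otimes> g \<in> comb P N gs" using Cons by auto
    moreover have "p \<otimes> g = \<zero> \<otimes> h \<oplus> p \<otimes> g" using Cons.prems pc by auto
    ultimately show ?thesis using ideal_memD(2)[OF assms(1)] by auto
  qed
qed auto

lemma comb_sub:
  assumes "ideal J R" "N \<subseteq> J" "\<And>p g. p \<in> P \<Longrightarrow> g \<in> set gs \<Longrightarrow> p \<otimes> g \<in> J"
  shows "comb P N gs \<subseteq> J"
  using assms(3)
proof (induction gs)
  case (Cons g gs)
  then have "comb P N gs \<subseteq> J" by simp
  then show ?case using Cons.prems ideal_memD(3)[OF assms(1)] by auto
qed (use assms(2) in auto)

text \<open>The ideal generated by \<open>N\<close> and \<open>gs\<close>.\<close>

abbreviation gen :: "'a set \<Rightarrow> 'a list \<Rightarrow> 'a set"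
  where "gen N gs \<equiv> comb (carrier R) N gs"

lemma gen_ideal: "ideal N R \<Longrightarrow> set gs \<subseteq> carrier R \<Longrightarrow> ideal (gen N gs) R"
  by (rule comb_ideal[OF oneideal])

lemma gen_base: "ideal N R \<Longrightarrow> set gs \<subseteq> carrier R \<Longrightarrow> N \<subseteq> gen N gs"
  by (rule comb_base[OF oneideal])

lemma gen_gen: "ideal N R \<Longrightarrow> set gs \<subseteq> carrier R \<Longrightarrow> set gs \<subseteq> gen N gs"
  using comb_gen[OF oneideal, of N gs \<one>] by force

lemma gen_sub: "ideal J R \<Longrightarrow> N \<subseteq> J \<Longrightarrow> set gs \<subseteq> J \<Longrightarrow> gen N gs \<subseteq> J"
  by (rule comb_sub) (auto dest: ideal_lmult)

lemma gen_eq_Idl: "set gs \<subseteq> carrier R \<Longrightarrow> gen {\<zero>} gs = Idl (set gs)"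
  by (intro equalityI gen_sub genideal_minimal gen_gen gen_ideal genideal_ideal genideal_self zeroideal)
    (auto intro: ideal_zero[OF genideal_ideal])

text \<open>Nakayama's lemma, localised at a prime ideal \<open>P\<close>.\<close>

lemma nakayama:
  assumes P: "primeideal P R"
  shows "ideal N R \<Longrightarrow> set gs \<subseteq> carrier R \<Longrightarrow>
    (\<And>g. g \<in> set gs \<Longrightarrow> \<exists>s\<in>carrier R - P. s \<otimes> g \<in> comb P N gs) \<Longrightarrow>
    \<exists>s\<in>carrier R - P. \<forall>g\<in>set gs. s \<otimes> g \<in> N"
proof (induction gs)
  case Nil
  then show ?case using primeD[OF P] one_closed by auto
next
  case (Cons g gs)
  note Pi = prime_ideal[OF P] and PD = ideal_memD[OF prime_ideal[OF P]]
  let ?C = "comb P N gs"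
  have g: "g \<in> carrier R" and gs: "set gs \<subseteq> carrier R" using Cons.prems by auto
  have CI: "ideal ?C R" by (rule comb_ideal[OF Pi Cons.prems(1) gs])
  note CD = ideal_memD[OF CI]
  obtain s where s: "s \<in> carrier R - P" "s \<otimes> g \<in> comb P N (g # gs)" using Cons.prems(3)[of g] by auto
  obtain p w where pw: "s \<otimes> g = p \<otimes> g \<oplus> w" "p \<in> P" "w \<in> ?C" using s(2) by auto
  define q where "q = s \<ominus> p"
  have pc: "p \<in> carrier R" using PD pw by auto
  have wc: "w \<in> carrier R" using CD pw by auto
  have q: "q \<in> carrier R - P"
  proof -
    have "q \<in> P \<Longrightarrow> s \<in> P"
    proof -
      assume "q \<in> P"
      then have "q \<oplus> p \<in> P" using PD pw by auto
      moreover have "q \<oplus> p = s" unfolding q_def minus_eq using s pc by (simp add: a_assoc l_neg)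
      ultimately show "s \<in> P" by simp
    qed
    then show ?thesis using s pc unfolding q_def by auto
  qed
  have qg: "q \<otimes> g = w"
  proof -
    have "s \<in> carrier R" using s by simp
    then have "q \<otimes> g = s \<otimes> g \<ominus> p \<otimes> g" unfolding q_def using pc g by algebra
    also have "\<dots> = w" unfolding pw(1) using pc g wc by algebra
    finally show ?thesis .
  qed
  have "\<exists>s\<in>carrier R - P. s \<otimes> h \<in> ?C" if h: "h \<in> set gs" for h
  proof -
    obtain s' where s': "s' \<in> carrier R - P" "s' \<otimes> h \<in> comb P N (g # gs)" using Cons.prems(3)[of h] h by auto
    obtain p' w' where pw': "s' \<otimes> h = p' \<otimes> g \<oplus> w'" "p' \<in> P" "w' \<in> ?C" using s'(2) by auto
    have c: "p' \<in> carrier R" "w' \<in> carrier R" "h \<in> carrier R" using PD CD pw' h gs by auto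
    have "(q \<otimes> s') \<otimes> h = q \<otimes> (s' \<otimes> h)" using q s' c by (simp add: m_assoc)
    also have "\<dots> = p' \<otimes> (q \<otimes> g) \<oplus> q \<otimes> w'" unfolding pw' using q c g by (simp add: r_distr m_lcomm)
    finally have "(q \<otimes> s') \<otimes> h \<in> ?C" unfolding qg using CD pw(3) pw'(3) c q by auto
    then show ?thesis using prime_mult_closed[OF P q s'(1)] by blast
  qed
  then obtain t where t: "t \<in> carrier R - P" "\<forall>h\<in>set gs. t \<otimes> h \<in> N"
    using Cons.IH[OF Cons.prems(1) gs] by blast
  note ND = ideal_memD[OF Cons.prems(1)]
  have tc: "t \<otimes> c \<in> N" if c: "c \<in> ?C" for c
  proof -
    have "ideal {c \<in> carrier R. t \<otimes> c \<in> N} R"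
      by (rule ideal_intro) (use ND t in \<open>auto simp: r_distr m_lcomm\<close>)
    then have "?C \<subseteq> {c \<in> carrier R. t \<otimes> c \<in> N}"
    proof (rule comb_sub)
      show "N \<subseteq> {c \<in> carrier R. t \<otimes> c \<in> N}" using ND t by auto
      show "p \<otimes> g \<in> {c \<in> carrier R. t \<otimes> c \<in> N}" if "p \<in> P" "g \<in> set gs" for p g
        using that gs t ND PD by (auto simp: m_lcomm subset_iff)
    qed
    then show ?thesis using c by auto
  qed
  have "(t \<otimes> q) \<otimes> h \<in> N" if "h \<in> set (g # gs)" for h
  proof (cases "h = g")
    case True
    then have "(t \<otimes> q) \<otimes> h = t \<otimes> w" using qg t q g by (simp add: m_assoc)
    then show ?thesis using tc pw by simp
  next
    case False
    then have "h \<in> set gs" using that by simp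
    then have "q \<otimes> (t \<otimes> h) \<in> N" and "h \<in> carrier R" using t q ND gs by auto
    then show ?thesis using t q by (simp add: m_assoc m_lcomm)
  qed
  then show ?case using prime_mult_closed[OF P t(1) q] by blast
qed

subsection \<open>Saturation\<close>

text \<open>The contraction of \<open>I R\<^sub>P\<close> to \<open>R\<close>. Working with it avoids forming the localisation.\<close>

definition satur :: "'a set \<Rightarrow> 'a set \<Rightarrow> 'a set"
  where "satur P I = {z \<in> carrier R. \<exists>s\<in>carrier R - P. s \<otimes> z \<in> I}"

lemma satur_ideal:
  assumes P: "primeideal P R" and I: "ideal I R"
  shows "ideal (satur P I) R"
proof (rule ideal_intro)
  note ID = ideal_memD[OF I]
  show "satur P I \<subseteq> carrier R" by (auto simp: satur_def)
  show "\<zero> \<in> satur P I" unfolding satur_def using ID(2) prime_one[OF P]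
    by (intro CollectI conjI bexI[of _ \<one>]) auto
  show "x \<oplus> y \<in> satur P I" if "x \<in> satur P I" "y \<in> satur P I" for x y
  proof -
    obtain s t where *: "s \<in> carrier R - P" "t \<in> carrier R - P" "s \<otimes> x \<in> I" "t \<otimes> y \<in> I"
      "x \<in> carrier R" "y \<in> carrier R" using \<open>x \<in> satur P I\<close> \<open>y \<in> satur P I\<close> unfolding satur_def by blast
    have "(s \<otimes> t) \<otimes> (x \<oplus> y) = t \<otimes> (s \<otimes> x) \<oplus> s \<otimes> (t \<otimes> y)"
      using * by (simp add: r_distr m_ac)
    then have "(s \<otimes> t) \<otimes> (x \<oplus> y) \<in> I" using * ID by auto
    then show ?thesis using prime_mult_closed[OF P *(1,2)] * unfolding satur_def by blast
  qed
  show "r \<otimes> x \<in> satur P I" if "r \<in> carrier R" "x \<in> satur P I" for r x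
  proof -
    obtain s where *: "s \<in> carrier R - P" "s \<otimes> x \<in> I" "x \<in> carrier R" using \<open>x \<in> satur P I\<close> unfolding satur_def by blast
    have "s \<otimes> (r \<otimes> x) = r \<otimes> (s \<otimes> x)" using * that by (simp add: m_lcomm)
    then have "s \<otimes> (r \<otimes> x) \<in> I" using ID(4)[OF *(2) that(1)] by simp
    then show ?thesis using *(1,3) that(1) unfolding satur_def by blast
  qed
qed

lemma satur_base: "primeideal P R \<Longrightarrow> ideal I R \<Longrightarrow> I \<subseteq> satur P I"
  unfolding satur_def using prime_one[of P] ideal_carrier[of I] by force

lemma satur_mono: "I \<subseteq> J \<Longrightarrow> satur P I \<subseteq> satur P J"
  unfolding satur_def by auto

lemma satur_satur:
  assumes P: "primeideal P R"
  shows "satur P (satur P I) \<subseteq> satur P I"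
proof
  fix z assume "z \<in> satur P (satur P I)"
  then obtain s t where *: "s \<in> carrier R - P" "t \<in> carrier R - P" "t \<otimes> (s \<otimes> z) \<in> I" "z \<in> carrier R"
    by (auto simp: satur_def)
  then have "(t \<otimes> s) \<otimes> z \<in> I" by (simp add: m_assoc)
  then show "z \<in> satur P I" using * prime_mult_closed[OF P *(2,1)] unfolding satur_def by blast
qed

lemma saturD: "satur P I \<subseteq> I \<Longrightarrow> s \<in> carrier R - P \<Longrightarrow> z \<in> carrier R \<Longrightarrow> s \<otimes> z \<in> I \<Longrightarrow> z \<in> I"
  unfolding satur_def by blast

lemma satur_prime: "primeideal P R \<Longrightarrow> I \<subseteq> P \<Longrightarrow> satur P I \<subseteq> P"
  unfolding satur_def using primeD[of P] by blast

end

section \<open>Krull's height theorem\<close>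

locale noeth = cring R + noetherian_ring R for R (structure)
begin

lemma ideal_fg:
  assumes "ideal I R"
  obtains gs where "set gs \<subseteq> carrier R" "I = gen {\<zero>} gs"
proof -
  obtain A where A: "A \<subseteq> carrier R" "finite A" "I = Idl A" using finetely_gen[OF assms] by auto
  obtain gs where "set gs = A" using A finite_list by auto
  then show ?thesis using that[of gs] gen_eq_Idl[of gs] A by auto
qed

lemma maximal_ideal_exists:
  assumes "\<C> \<noteq> {}" "\<And>I. I \<in> \<C> \<Longrightarrow> ideal I R"
  shows "\<exists>I\<in>\<C>. \<forall>J\<in>\<C>. I \<subseteq> J \<longrightarrow> J = I"
proof (rule subset_Zorn)
  fix C assume C: "subset.chain \<C> C"
  show "\<exists>U\<in>\<C>. \<forall>T\<in>C. T \<subseteq> U"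
  proof (cases "C = {}")
    case True
    then show ?thesis using assms by auto
  next
    case False
    have "subset.chain {I. ideal I R} C" using C assms(2) unfolding pred_on.chain_def by auto
    then have "\<Union>C \<in> C" using ideal_chain_is_trivial False by auto
    then show ?thesis using C unfolding pred_on.chain_def by (intro bexI[of _ "\<Union>C"]) auto
  qed
qed

lemma prime_avoiding:
  assumes H: "ideal H R" and W: "W \<subseteq> carrier R" "\<one> \<in> W" "\<And>x y. x \<in> W \<Longrightarrow> y \<in> W \<Longrightarrow> x \<otimes> y \<in> W"
    and HW: "H \<inter> W = {}"
  shows "\<exists>N. primeideal N R \<and> H \<subseteq> N \<and> N \<inter> W = {}"
proof -
  let ?\<C> = "{I. ideal I R \<and> H \<subseteq> I \<and> I \<inter> W = {}}"
  have "\<exists>I\<in>?\<C>. \<forall>J\<in>?\<C>. I \<subseteq> J \<longrightarrow> J = I"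
    by (rule maximal_ideal_exists) (use H HW in auto)
  then obtain N where N: "ideal N R" "H \<subseteq> N" "N \<inter> W = {}"
    and max: "\<And>J. ideal J R \<Longrightarrow> H \<subseteq> J \<Longrightarrow> J \<inter> W = {} \<Longrightarrow> N \<subseteq> J \<Longrightarrow> J = N"
    by auto
  note ND = ideal_memD[OF N(1)]
  have "primeideal N R"
  proof (rule primeidealI[OF N(1) is_cring])
    show "carrier R \<noteq> N" using W N by auto
    fix a b assume ab: "a \<in> carrier R" "b \<in> carrier R" "a \<otimes> b \<in> N"
    have big: "\<exists>r\<in>carrier R. \<exists>n\<in>N. r \<otimes> c \<oplus> n \<in> W" if c: "c \<in> carrier R" "c \<notin> N" for c
    proof -
      have I: "ideal (gen N [c]) R" and s: "N \<subseteq> gen N [c]" "c \<in> gen N [c]"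
        using gen_ideal[of N "[c]"] gen_base[of N "[c]"] gen_gen[of N "[c]"] N(1) c by auto
      have "gen N [c] \<inter> W \<noteq> {}" using max[OF I] N s c by blast
      then show ?thesis by auto
    qed
    show "a \<in> N \<or> b \<in> N"
    proof (rule ccontr)
      assume "\<not> (a \<in> N \<or> b \<in> N)"
      then obtain r n r' n' where *: "r \<in> carrier R" "n \<in> N" "r \<otimes> a \<oplus> n \<in> W"
        "r' \<in> carrier R" "n' \<in> N" "r' \<otimes> b \<oplus> n' \<in> W" using big ab by meson
      have c: "n \<in> carrier R" "n' \<in> carrier R" using * ND by auto
      have "(r \<otimes> a \<oplus> n) \<otimes> (r' \<otimes> b \<oplus> n') =
        (r \<otimes> r') \<otimes> (a \<otimes> b) \<oplus> (r \<otimes> a) \<otimes> n' \<oplus> (r' \<otimes> b \<oplus> n') \<otimes> n"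
        using * ab c by algebra
      also have "\<dots> \<in> N" using * ab c ND by auto
      finally show False using W(3)[OF *(3,6)] N(3) by auto
    qed
  qed
  then show ?thesis using N by blast
qed

text \<open>If no prime ideal below \<open>P\<close> contains \<open>H\<close> and misses \<open>z\<close>, then a power of \<open>z\<close> lies in \<open>H\<close>,
  up to a factor outside \<open>P\<close>.\<close>

lemma prime_below_avoiding:
  assumes P: "primeideal P R" and H: "ideal H R" and z: "z \<in> carrier R"
    and no: "\<And>s e. s \<in> carrier R - P \<Longrightarrow> s \<otimes> z [^] (e::nat) \<notin> H"
  shows "\<exists>N. primeideal N R \<and> H \<subseteq> N \<and> N \<subseteq> P \<and> z \<notin> N"
proof -
  define W where "W = {s \<otimes> z [^] (e::nat) | s e. s \<in> carrier R - P}"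
  have "\<exists>N. primeideal N R \<and> H \<subseteq> N \<and> N \<inter> W = {}"
  proof (rule prime_avoiding[OF H])
    show "W \<subseteq> carrier R" using z by (auto simp: W_def)
    have "\<one> = \<one> \<otimes> z [^] (0::nat)" by simp
    then show "\<one> \<in> W" using primeD[OF P] unfolding W_def by blast
    fix x y assume "x \<in> W" "y \<in> W"
    then obtain s t and e f :: nat where *: "x = s \<otimes> z [^] e" "y = t \<otimes> z [^] f" "s \<in> carrier R - P"
      "t \<in> carrier R - P" unfolding W_def by blast
    have "x \<otimes> y = (s \<otimes> t) \<otimes> z [^] (e + f)" unfolding * using * z
      by (simp add: nat_pow_mult[symmetric] m_ac)
    then show "x \<otimes> y \<in> W" using prime_mult_closed[OF P *(3,4)] unfolding W_def by blast
    next
    show "H \<inter> W = {}" using no unfolding W_def by auto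
  qed
  then obtain N where N: "primeideal N R" "H \<subseteq> N" "N \<inter> W = {}" by blast
  have "s \<notin> N" if "s \<in> carrier R - P" for s
  proof -
    have "s = s \<otimes> z [^] (0::nat)" using that by simp
    then have "s \<in> W" using that unfolding W_def by blast
    then show ?thesis using N by auto
  qed
  moreover have "N \<subseteq> carrier R" using ideal_carrier[OF prime_ideal[OF N(1)]] by auto
  moreover have "z \<notin> N"
  proof -
    have "z = \<one> \<otimes> z [^] (1::nat)" using z by simp
    then have "z \<in> W" using primeD[OF P] unfolding W_def by blast
    then show ?thesis using N by auto
  qed
  ultimately show ?thesis using N by blast
qed


text \<open>The localisation of \<open>R / H\<close> at a prime \<open>P\<close> minimal over \<open>H\<close> is artinian.\<close>

lemma descending_chain_stops:
  assumes P: "primeideal P R" and H: "ideal H R" "H \<subseteq> P"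
    and min: "\<And>Q. primeideal Q R \<Longrightarrow> H \<subseteq> Q \<Longrightarrow> Q \<subseteq> P \<Longrightarrow> Q = P"
    and I: "\<And>k. ideal (I k) R" "\<And>k. H \<subseteq> I k" "\<And>k. satur P (I k) \<subseteq> I k"
    and dec: "\<And>k. I (Suc k) \<subseteq> I k"
  shows "\<exists>k. I (Suc k) = I k"
proof (rule ccontr)
  assume bad: "\<not> ?thesis"
  define stop where "stop L \<longleftrightarrow> (\<forall>I. (\<forall>k. ideal (I k) R \<and> L \<subseteq> I k \<and> satur P (I k) \<subseteq> I k \<and> I (Suc k) \<subseteq> I k)
    \<longrightarrow> (\<exists>n. \<forall>k\<ge>n. I (Suc k) = I k))" for L
  let ?\<C> = "{L. ideal L R \<and> H \<subseteq> L \<and> satur P L \<subseteq> L \<and> \<not> stop L}"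
  have "satur P H \<in> ?\<C>"
  proof -
    have "\<not> stop (satur P H)"
    proof
      assume s: "stop (satur P H)"
      have "satur P H \<subseteq> I k" for k using satur_mono[OF I(2)] I(3) by blast
      then have "\<exists>n. \<forall>k\<ge>n. I (Suc k) = I k"
        using s I dec unfolding stop_def by meson
      then show False using bad by blast
    qed
    then show ?thesis using satur_ideal[OF P H(1)] satur_base[OF P H(1)] satur_satur[OF P] by auto
  qed
  then have "\<exists>I\<in>?\<C>. \<forall>J\<in>?\<C>. I \<subseteq> J \<longrightarrow> J = I"
    by (intro maximal_ideal_exists) auto
  \<comment> \<open>Noetherian induction: above each saturated ideal strictly larger than \<open>L\<close>, chains stop.\<close>
  then obtain L where L: "ideal L R" "H \<subseteq> L" "satur P L \<subseteq> L" "\<not> stop L"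
    and max: "\<And>J. ideal J R \<Longrightarrow> H \<subseteq> J \<Longrightarrow> satur P J \<subseteq> J \<Longrightarrow> L \<subseteq> J \<Longrightarrow> J \<noteq> L \<Longrightarrow> stop J"
    by (elim bexE) (simp, blast)
  note LD = ideal_memD[OF L(1)]
  obtain I' where *: "\<forall>k. ideal (I' k) R \<and> L \<subseteq> I' k \<and> satur P (I' k) \<subseteq> I' k \<and> I' (Suc k) \<subseteq> I' k"
    "\<not> (\<exists>n. \<forall>k\<ge>n. I' (Suc k) = I' k)"
    using L(4) unfolding stop_def not_all not_imp by (elim exE conjE)
  have I': "\<And>k. ideal (I' k) R" "\<And>k. L \<subseteq> I' k" "\<And>k. satur P (I' k) \<subseteq> I' k"
    "\<And>k. I' (Suc k) \<subseteq> I' k" using *(1) by simp_all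
  have ns: "\<And>n. \<exists>k\<ge>n. I' (Suc k) \<noteq> I' k" using *(2) by simp
  have one: "\<one> \<notin> L"
  proof
    assume "\<one> \<in> L"
    then have "carrier R \<subseteq> L" using LD(4) by force
    then have "I' k = carrier R" for k using I'(1,2) ideal_carrier by blast
    then show False using ns by blast
  qed
  \<comment> \<open>An associated prime of \<open>R / L\<close> contains \<open>H\<close> and lies in \<open>P\<close>, so it is \<open>P\<close>.\<close>
  define col where "col z = {x \<in> carrier R. x \<otimes> z \<in> L}" for z
  have col_ideal: "ideal (col z) R" if "z \<in> carrier R" for z
    by (rule ideal_intro) (use LD that in \<open>auto simp: col_def l_distr m_assoc\<close>)
  let ?\<D> = "col ` (carrier R - L)"
  have "\<exists>I\<in>?\<D>. \<forall>J\<in>?\<D>. I \<subseteq> J \<longrightarrow> J = I"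
    by (rule maximal_ideal_exists) (use one col_ideal in auto)
  then obtain z where z: "z \<in> carrier R" "z \<notin> L" and
    zmax: "\<And>w. w \<in> carrier R \<Longrightarrow> w \<notin> L \<Longrightarrow> col z \<subseteq> col w \<Longrightarrow> col w = col z" by auto
  have "primeideal (col z) R"
  proof (rule primeidealI[OF col_ideal[OF z(1)] is_cring])
    have "\<one> \<notin> col z" using z by (simp add: col_def)
    then show "carrier R \<noteq> col z" by auto
    fix a b assume ab: "a \<in> carrier R" "b \<in> carrier R" "a \<otimes> b \<in> col z"
    show "a \<in> col z \<or> b \<in> col z"
    proof (cases "b \<in> col z")
      case False
      then have w: "b \<otimes> z \<notin> L" using ab by (simp add: col_def)
      have "x \<otimes> (b \<otimes> z) = b \<otimes> (x \<otimes> z)" if "x \<in> carrier R" for x using ab z that by (simp add: m_lcomm)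
      then have "col z \<subseteq> col (b \<otimes> z)" using ab(2) LD(4) unfolding col_def by auto
      then have "col (b \<otimes> z) = col z" using zmax w ab z by auto
      moreover have "a \<in> col (b \<otimes> z)" using ab z by (simp add: col_def m_assoc)
      ultimately show ?thesis by simp
    qed simp
  qed
  moreover have "col z \<subseteq> P"
    using saturD[OF L(3)] z unfolding col_def by blast
  moreover have "H \<subseteq> col z" using L(2) LD z by (auto simp: col_def)
  ultimately have col: "col z = P" using min by blast
  define L' where "L' = satur P (gen L [z])"
  have gI: "ideal (gen L [z]) R" "L \<subseteq> gen L [z]" "z \<in> gen L [z]"
    using gen_ideal[of L "[z]"] gen_base[of L "[z]"] gen_gen[of L "[z]"] L(1) z by auto
  have L': "ideal L' R" "L \<subseteq> L'" "z \<in> L'" "satur P L' \<subseteq> L'"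
    using satur_ideal[OF P gI(1)] satur_base[OF P gI(1)] gI satur_satur[OF P] by (auto simp: L'_def)
  have stopL': "stop L'" using max[OF L'(1)] L' L z by auto
  have dich: "L' \<subseteq> J \<or> J \<inter> L' = L" if J: "ideal J R" "L \<subseteq> J" "satur P J \<subseteq> J" for J
  proof (cases "J \<inter> L' = L")
    case False
    note JD = ideal_memD[OF J(1)]
    obtain w where w: "w \<in> J" "w \<in> L'" "w \<notin> L" using False J L' by blast
    have wc: "w \<in> carrier R" using w JD by auto
    obtain s where s: "s \<in> carrier R - P" "s \<otimes> w \<in> gen L [z]" using w by (auto simp: L'_def satur_def)
    then obtain q l where q: "s \<otimes> w = q \<otimes> z \<oplus> l" "q \<in> carrier R" "l \<in> L" by auto
    have lc: "l \<in> carrier R" using LD q by auto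
    have "q \<notin> P"
    proof
      assume "q \<in> P"
      then have "q \<otimes> z \<in> L" using col by (auto simp: col_def)
      then have "s \<otimes> w \<in> L" using q LD by auto
      then show False using saturD[OF L(3)] s wc w by blast
    qed
    moreover have "q \<otimes> z \<in> J"
    proof -
      have "q \<otimes> z \<oplus> l \<ominus> l = q \<otimes> z" using \<open>q \<in> carrier R\<close> z(1) lc by algebra
      then have "q \<otimes> z = s \<otimes> w \<ominus> l" unfolding q(1) by simp
      moreover have "s \<otimes> w \<in> J" "l \<in> J" using JD(4)[OF w(1)] s(1) q(3) J(2) by blast+
      ultimately show ?thesis using JD(7) by simp
    qed
    ultimately have "z \<in> J" using saturD[OF J(3)] q z by blast
    then have "gen L [z] \<subseteq> J" using gen_sub[OF J(1), of L "[z]"] J by auto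
    then have "L' \<subseteq> satur P J" unfolding L'_def by (rule satur_mono)
    then show ?thesis using J by blast
  qed simp
  define A where "A k = satur P (I' k <+>\<^bsub>R\<^esub> L')" for k
  have sumI: "ideal (I' k <+>\<^bsub>R\<^esub> L') R" for k by (rule add_ideals[OF I'(1) L'(1)])
  have sumB: "I' k \<subseteq> I' k <+>\<^bsub>R\<^esub> L'" "L' \<subseteq> I' k <+>\<^bsub>R\<^esub> L'" for k
    by (rule set_add_upper[OF I'(1) L'(1)])+
  have "ideal (A k) R \<and> L' \<subseteq> A k \<and> satur P (A k) \<subseteq> A k \<and> A (Suc k) \<subseteq> A k" for k
  proof (intro conjI)
    show "ideal (A k) R" unfolding A_def by (rule satur_ideal[OF P sumI])
    show "L' \<subseteq> A k" unfolding A_def using sumB(2) satur_base[OF P sumI] by blast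
    show "satur P (A k) \<subseteq> A k" unfolding A_def by (rule satur_satur[OF P])
    show "A (Suc k) \<subseteq> A k" unfolding A_def
      by (rule satur_mono) (use I'(4)[of k] in \<open>auto simp: set_add_def'\<close>)
  qed
  then obtain n1 where n1: "\<And>k. k \<ge> n1 \<Longrightarrow> A (Suc k) = A k" using stopL' unfolding stop_def by meson
  \<comment> \<open>The intersections with \<open>L'\<close> take only the values \<open>L\<close> and \<open>L'\<close>, so they are constant too.\<close>
  have "\<exists>n2. \<forall>k\<ge>n2. I' (Suc k) \<inter> L' = I' k \<inter> L'"
  proof (cases "\<exists>m. I' m \<inter> L' = L")
    case True
    then obtain m where m: "I' m \<inter> L' = L" by blast
    have "I' k \<inter> L' = L" if "k \<ge> m" for k
    proof -
      have "I' k \<subseteq> I' m" using that I'(4) by (rule lift_Suc_antimono_le[rotated])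
      then show ?thesis using m I'(2) L' by blast
    qed
    then have "\<forall>k\<ge>m. I' (Suc k) \<inter> L' = I' k \<inter> L'" by simp
    then show ?thesis by blast
  next
    case False
    then have "L' \<subseteq> I' k" for k using dich[OF I'(1,2,3)] by blast
    then have "I' (Suc k) \<inter> L' = I' k \<inter> L'" for k by blast
    then show ?thesis by blast
  qed
  then obtain n2 where n2: "\<And>k. k \<ge> n2 \<Longrightarrow> I' (Suc k) \<inter> L' = I' k \<inter> L'" by blast
  have "I' (Suc k) = I' k" if k: "k \<ge> max n1 n2" for k
  proof
    show "I' (Suc k) \<subseteq> I' k" by (rule I'(4))
    show "I' k \<subseteq> I' (Suc k)"
    proof
      fix x assume x: "x \<in> I' k"
      note D = ideal_memD[OF I'(1)[of k]] and D' = ideal_memD[OF I'(1)[of "Suc k"]]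
      have "x \<in> A k" unfolding A_def using x sumB(1) satur_base[OF P sumI] by blast
      then have "x \<in> A (Suc k)" using n1 k by simp
      then obtain s i l where s: "s \<in> carrier R - P" "s \<otimes> x = i \<oplus> l" "i \<in> I' (Suc k)" "l \<in> L'"
        unfolding A_def satur_def set_add_def' by blast
      have c: "i \<in> carrier R" "l \<in> carrier R" "x \<in> carrier R" using s D D' ideal_carrier[OF L'(1)] x by auto
      have "i \<oplus> l \<ominus> i = l" using c by algebra
      then have "l = s \<otimes> x \<ominus> i" unfolding s(2) by simp
      moreover have "s \<otimes> x \<in> I' k" "i \<in> I' k" using D(4)[OF x] s(1,3) I'(4) by blast+
      ultimately have "l \<in> I' k" using D(7) by simp
      then have "l \<in> I' (Suc k)" using n2[of k] k s by auto
      then have "s \<otimes> x \<in> I' (Suc k)" using s D' by auto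
      then show "x \<in> I' (Suc k)" using saturD[OF I'(3)] s c by blast
    qed
  qed
  then show False using ns by blast
qed

text \<open>Krull's principal ideal theorem, in the domain \<open>R / N\<close> localised at \<open>P\<close>: no prime lies strictly
  between \<open>N\<close> and a minimal prime \<open>P\<close> of \<open>N + (y)\<close>. The ideals \<open>S k\<close> play the role of the symbolic
  powers of \<open>L\<close>.\<close>

lemma principal_ideal_theorem:
  assumes N: "primeideal N R" and L: "primeideal L R" and P: "primeideal P R"
    and NL: "N \<subset> L" and LP: "L \<subset> P" and y: "y \<in> P"
    and min: "\<And>Q. primeideal Q R \<Longrightarrow> N \<subseteq> Q \<Longrightarrow> y \<in> Q \<Longrightarrow> Q \<subseteq> P \<Longrightarrow> Q = P"
  shows False
proof -
  note Ni = prime_ideal[OF N] and Li = prime_ideal[OF L] and Pi = prime_ideal[OF P]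
  have yc: "y \<in> carrier R" using ideal_carrier[OF Pi] y by auto
  have yL: "y \<notin> L" using min[OF L] NL LP by blast
  define S where "S = rec_nat L (\<lambda>_ S. satur L (N <+>\<^bsub>R\<^esub> (L \<cdot> S)))"
  have S0: "S 0 = L" and SS: "S (Suc k) = satur L (N <+>\<^bsub>R\<^esub> (L \<cdot> S k))" for k by (simp_all add: S_def)
  have Si: "ideal (S k) R" for k
  proof (induction k)
    case (Suc k)
    then show ?case unfolding SS by (intro satur_ideal L add_ideals Ni ideal_prod_is_ideal Li)
  qed (simp add: S0 Li)
  have prodI: "ideal (L \<cdot> S k) R" for k by (rule ideal_prod_is_ideal[OF Li Si])
  have sumI: "ideal (N <+>\<^bsub>R\<^esub> (L \<cdot> S k)) R" for k by (rule add_ideals[OF Ni prodI])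
  have sumB: "N \<subseteq> N <+>\<^bsub>R\<^esub> (L \<cdot> S k)" "L \<cdot> S k \<subseteq> N <+>\<^bsub>R\<^esub> (L \<cdot> S k)" for k
    by (rule set_add_upper[OF Ni prodI])+
  have NS: "N \<subseteq> S k" for k
  proof (cases k)
    case 0
    then show ?thesis using S0 NL by auto
  next
    case (Suc j)
    then show ?thesis using sumB(1)[of j] satur_base[OF L sumI[of j]] SS[of j] by blast
  qed
  have Ssat: "satur L (S k) \<subseteq> S k" for k
    by (cases k) (simp_all add: S0 SS satur_satur[OF L] satur_prime[OF L])
  have Sdec: "S (Suc k) \<subseteq> S k" for k
  proof -
    have "N <+>\<^bsub>R\<^esub> (L \<cdot> S k) \<subseteq> S k"
      using NS[of k] ideal_prod_inter[OF Li Si[of k]] ideal_add[OF Si[of k]]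
      unfolding set_add_def' by blast
    then show ?thesis unfolding SS using satur_mono Ssat by blast
  qed
  have SL: "S k \<subseteq> L" for k
    by (induction k) (use S0 Sdec in auto)
  define H where "H = gen N [y]"
  have Hi: "ideal H R" "N \<subseteq> H" "y \<in> H" "H \<subseteq> P"
    unfolding H_def using gen_ideal[of N "[y]"] gen_base[of N "[y]"] gen_gen[of N "[y]"] Ni yc
      gen_sub[OF Pi, of N "[y]"] NL LP y by auto
  define I where "I k = satur P (gen (S k) [y])" for k
  have gi: "ideal (gen (S k) [y]) R" for k using gen_ideal[of "S k" "[y]"] Si yc by auto
  have "\<exists>k. I (Suc k) = I k"
  proof (rule descending_chain_stops[OF P Hi(1,4)])
    show "Q = P" if "primeideal Q R" "H \<subseteq> Q" "Q \<subseteq> P" for Q using min[of Q] that Hi by blast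
    show "ideal (I k) R" for k unfolding I_def by (rule satur_ideal[OF P gi])
    show "H \<subseteq> I k" for k
    proof -
      have "H \<subseteq> gen (S k) [y]" unfolding H_def
        using gen_sub[OF gi[of k], of N "[y]"] gen_base[of "S k" "[y]"] gen_gen[of "S k" "[y]"] NS Si yc by auto
      then show ?thesis unfolding I_def using satur_base[OF P gi] by blast
    qed
    show "satur P (I k) \<subseteq> I k" for k unfolding I_def by (rule satur_satur[OF P])
    show "I (Suc k) \<subseteq> I k" for k unfolding I_def
      by (rule satur_mono) (use Sdec[of k] in auto)
  qed
  then obtain k where k: "I (Suc k) = I k" by blast
  have nP: "s \<in> carrier R - L" if "s \<in> carrier R - P" for s using that LP by auto
  obtain gs where gs: "set gs \<subseteq> carrier R" "S k = gen {\<zero>} gs" using ideal_fg[OF Si] by blast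
  have gsS: "set gs \<subseteq> S k" using gen_gen[OF zeroideal] gs by auto
  \<comment> \<open>The descending chain condition gives \<open>S k = S (k + 1) + y S k\<close> locally at \<open>P\<close>.\<close>
  have "\<exists>s\<in>carrier R - P. s \<otimes> g \<in> comb P (S (Suc k)) gs" if g: "g \<in> set gs" for g
  proof -
    have gc: "g \<in> carrier R" "g \<in> S k" using g gs gsS by auto
    then have "g \<in> I k" unfolding I_def using satur_base[OF P gi[of k]] gen_base[of "S k" "[y]"] Si yc by auto
    then have "g \<in> I (Suc k)" using k by simp
    then obtain s u w where s: "s \<in> carrier R - P" "s \<otimes> g = u \<otimes> y \<oplus> w" "u \<in> carrier R" "w \<in> S (Suc k)"
      unfolding I_def satur_def by auto
    have wc: "w \<in> carrier R" using s ideal_carrier[OF Si] by auto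
    have "u \<otimes> y \<oplus> w \<ominus> w = y \<otimes> u" using \<open>u \<in> carrier R\<close> wc yc by algebra
    then have "y \<otimes> u = s \<otimes> g \<ominus> w" using s(2) by simp
    moreover have "s \<otimes> g \<in> S k" "w \<in> S k" using ideal_lmult[OF Si gc(2)] s(1,4) Sdec by blast+
    ultimately have "y \<otimes> u \<in> S k" using ideal_diff[OF Si[of k]] by simp
    then have "u \<in> S k" using saturD[OF Ssat] yL yc s by blast
    then have "u \<in> gen {\<zero>} gs" using gs by simp
    moreover have "gen {\<zero>} gs \<subseteq> {u \<in> carrier R. u \<otimes> y \<in> comb P (S (Suc k)) gs}"
    proof (rule gen_sub)
      have ci: "ideal (comb P (S (Suc k)) gs) R" by (rule comb_ideal[OF Pi Si gs(1)])
      note cd = ideal_memD[OF ci]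
      show "ideal {u \<in> carrier R. u \<otimes> y \<in> comb P (S (Suc k)) gs} R"
        by (rule ideal_intro) (use cd yc in \<open>auto simp: l_distr m_assoc\<close>)
      show "{\<zero>} \<subseteq> {u \<in> carrier R. u \<otimes> y \<in> comb P (S (Suc k)) gs}" using cd yc by auto
      show "set gs \<subseteq> {u \<in> carrier R. u \<otimes> y \<in> comb P (S (Suc k)) gs}"
        using comb_gen[OF Pi Si gs(1) y] gs(1) yc m_comm[OF yc] by (auto simp: subset_iff)
    qed
    ultimately have "u \<otimes> y \<in> comb P (S (Suc k)) gs" by auto
    moreover have "w \<in> comb P (S (Suc k)) gs" using comb_base[OF Pi Si gs(1)] s by auto
    ultimately have "s \<otimes> g \<in> comb P (S (Suc k)) gs"
      unfolding s(2) using ideal_add[OF comb_ideal[OF Pi Si gs(1)]] by auto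
    then show ?thesis using s by blast
  qed
  then obtain s where s: "s \<in> carrier R - P" "\<forall>g\<in>set gs. s \<otimes> g \<in> S (Suc k)"
    using nakayama[OF P Si gs(1)] by blast
  \<comment> \<open>So \<open>S k = S (k + 1)\<close>, and Nakayama's lemma at \<open>L\<close> gives \<open>S k = N\<close>.\<close>
  have gS': "set gs \<subseteq> S (Suc k)" using s saturD[OF Ssat] nP gs(1) by blast
  have "\<exists>s\<in>carrier R - L. s \<otimes> g \<in> comb L N gs" if g: "g \<in> set gs" for g
  proof -
    obtain s where s: "s \<in> carrier R - L" "s \<otimes> g \<in> N <+>\<^bsub>R\<^esub> (L \<cdot> S k)" using gS' g unfolding SS satur_def by blast
    have ci: "ideal (comb L N gs) R" by (rule comb_ideal[OF Li Ni gs(1)])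
    note cd = ideal_memD[OF ci]
    have "p \<otimes> x \<in> comb L N gs" if p: "p \<in> L" and x: "x \<in> S k" for p x
    proof -
      have pc: "p \<in> carrier R" using p ideal_carrier[OF Li] by auto
      have "gen {\<zero>} gs \<subseteq> {x \<in> carrier R. p \<otimes> x \<in> comb L N gs}"
      proof (rule gen_sub)
        show "ideal {x \<in> carrier R. p \<otimes> x \<in> comb L N gs} R"
          by (rule ideal_intro) (use cd pc in \<open>auto simp: r_distr m_lcomm\<close>)
        show "{\<zero>} \<subseteq> {x \<in> carrier R. p \<otimes> x \<in> comb L N gs}" using cd pc by auto
        show "set gs \<subseteq> {x \<in> carrier R. p \<otimes> x \<in> comb L N gs}"
          using comb_gen[OF Li Ni gs(1) p] gs(1) by auto
      qed
      then show ?thesis using gs(2) x by auto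
    qed
    note mul = this
    have "x \<in> comb L N gs" if "x \<in> L \<cdot> S k" for x
      using that by (induction rule: ideal_prod.induct) (auto intro: cd(3) mul)
    then have "N <+>\<^bsub>R\<^esub> (L \<cdot> S k) \<subseteq> comb L N gs"
      using comb_base[OF Li Ni gs(1)] cd(3) by (auto simp: set_add_def')
    then show ?thesis using s by blast
  qed
  then obtain t where t: "t \<in> carrier R - L" "\<forall>g\<in>set gs. t \<otimes> g \<in> N"
    using nakayama[OF L Ni gs(1)] by blast
  have "set gs \<subseteq> N" using t gs(1) prime_multD[OF N] NL by blast
  then have "S k \<subseteq> N" unfolding gs(2) using gen_sub[OF Ni] ideal_zero[OF Ni] by auto
  moreover have "S j \<subseteq> N \<Longrightarrow> L \<subseteq> N" for j
  proof (induction j)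
    case (Suc j)
    show ?case
    proof (cases "L \<subseteq> N")
      case False
      then obtain l where l: "l \<in> L" "l \<notin> N" by auto
      have "x \<in> N" if x: "x \<in> S j" for x
      proof -
        have "l \<otimes> x \<in> L \<cdot> S j" using l(1) x by (rule ideal_prod.prod)
        then have "l \<otimes> x \<in> S (Suc j)" unfolding SS using sumB(2) satur_base[OF L sumI] by blast
        then show ?thesis using Suc.prems prime_multD[OF N, of l x] l x ideal_carrier[OF Li] ideal_carrier[OF Si] by blast
      qed
      then show ?thesis using Suc.IH by auto
    qed
  qed (simp add: S0)
  ultimately show False using NL by blast
qed

theorem krull_height:
  assumes "\<And>i. i \<le> n \<Longrightarrow> primeideal (C i) R" "\<And>i. i < n \<Longrightarrow> C i \<subset> C (Suc i)"
    "set ys \<subseteq> C n" "\<And>Q. primeideal Q R \<Longrightarrow> set ys \<subseteq> Q \<Longrightarrow> Q \<subseteq> C n \<Longrightarrow> Q = C n"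
  shows "n \<le> length ys"
  using assms
proof (induction n arbitrary: C ys)
  case (Suc n)
  define P where "P = C (Suc n)"
  have P: "primeideal P R" using Suc.prems(1)[of "Suc n"] by (simp add: P_def)
  let ?\<C> = "{L. primeideal L R \<and> C n \<subseteq> L \<and> L \<subset> P}"
  have "C n \<in> ?\<C>" using Suc.prems(1)[of n] Suc.prems(2)[of n] by (auto simp: P_def)
  then have "\<exists>I\<in>?\<C>. \<forall>J\<in>?\<C>. I \<subseteq> J \<longrightarrow> J = I"
    by (intro maximal_ideal_exists) (auto intro: prime_ideal)
  \<comment> \<open>Choose the next prime \<open>L\<close> of the chain as large as possible, so that none lies between it and \<open>P\<close>.\<close>
  then obtain L where LC: "L \<in> ?\<C>" and max: "\<forall>J\<in>?\<C>. L \<subseteq> J \<longrightarrow> J = L"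
    by (elim bexE)
  have L: "primeideal L R" "C n \<subseteq> L" "L \<subset> P" using LC by auto
  have Lmax: "J = L" if "primeideal J R" "L \<subseteq> J" "J \<subset> P" for J
  proof -
    have "J \<in> ?\<C>" using that L(2) by simp
    then show ?thesis using max that(2) by simp
  qed
  have ysP: "set ys \<subseteq> P" using Suc.prems by (simp add: P_def)
  have ysc: "set ys \<subseteq> carrier R" using ysP ideal_carrier[OF prime_ideal[OF P]] by auto
  have ymin: "\<And>Q. primeideal Q R \<Longrightarrow> set ys \<subseteq> Q \<Longrightarrow> Q \<subseteq> P \<Longrightarrow> Q = P" using Suc.prems(4) by (simp add: P_def)
  obtain y where y: "y \<in> set ys" "y \<notin> L" using ymin[OF L(1)] L(3) by blast
  have yc: "y \<in> carrier R" using y ysc by auto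
  define H where "H = gen L [y]"
  have H: "ideal H R" "L \<subseteq> H" "y \<in> H" using gen_ideal[of L "[y]"] gen_base[of L "[y]"] gen_gen[of L "[y]"]
      prime_ideal[OF L(1)] yc by (auto simp: H_def)
  have ex: "\<exists>s e l u. s \<in> carrier R - P \<and> s \<otimes> z [^] (e::nat) = u \<otimes> y \<oplus> l \<and> u \<in> carrier R \<and> l \<in> L"
    if z: "z \<in> P" for z
  proof (rule ccontr)
    assume no: "\<not> ?thesis"
    have zc: "z \<in> carrier R" using z ideal_carrier[OF prime_ideal[OF P]] by auto
    have "\<And>s e. s \<in> carrier R - P \<Longrightarrow> s \<otimes> z [^] (e::nat) \<notin> H" using no unfolding H_def by auto
    then obtain J where "primeideal J R" "H \<subseteq> J" "J \<subseteq> P" "z \<notin> J"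
      using prime_below_avoiding[OF P H(1) zc] by blast
    then show False using Lmax[of J] H y z by blast
  qed
  then obtain s e l u where slu: "\<And>z. z \<in> P \<Longrightarrow> s z \<in> carrier R - P \<and> s z \<otimes> z [^] (e z::nat) = u z \<otimes> y \<oplus> l z \<and>
    u z \<in> carrier R \<and> l z \<in> L" by metis
  define zs where "zs = map l (remove1 y ys)"
  have rs: "set (remove1 y ys) \<subseteq> P" using set_remove1_subset ysP by fastforce
  have "n \<le> length zs"
  proof (rule Suc.IH[of "C(n := L)" zs])
    show "primeideal ((C(n := L)) i) R" if "i \<le> n" for i using that Suc.prems(1)[of i] L by auto
    show "(C(n := L)) i \<subset> (C(n := L)) (Suc i)" if "i < n" for i
      using that Suc.prems(2)[of i] L(2) by (cases "Suc i = n") auto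
    show "set zs \<subseteq> (C(n := L)) n" using slu rs by (auto simp: zs_def)
    fix N assume N: "primeideal N R" "set zs \<subseteq> N" "N \<subseteq> (C(n := L)) n"
    show "N = (C(n := L)) n"
    proof (rule ccontr)
      assume "N \<noteq> (C(n := L)) n"
      then have NL: "N \<subset> L" using N by auto
      show False
      proof (rule principal_ideal_theorem[OF N(1) L(1) P NL L(3)])
        show "y \<in> P" using y ysP by auto
        fix Q assume Q: "primeideal Q R" "N \<subseteq> Q" "y \<in> Q" "Q \<subseteq> P"
        note QD = ideal_memD[OF prime_ideal[OF Q(1)]]
        have "z \<in> Q" if z: "z \<in> set ys" for z
        proof (cases "z = y")
          case False
          then have zr: "z \<in> set (remove1 y ys)" using z by simp
          then have zP: "z \<in> P" and zc: "z \<in> carrier R" using rs z ysc by auto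
          have "l z \<in> Q" using zr N Q by (auto simp: zs_def)
          then have "s z \<otimes> z [^] e z \<in> Q" using slu[OF zP] QD Q by auto
          then have "z [^] e z \<in> Q" using prime_multD[OF Q(1), of "s z" "z [^] e z"] slu[OF zP] zc Q by auto
          then show ?thesis by (rule prime_pow[OF Q(1) zc])
        qed (use Q in simp)
        then show "Q = P" using ymin[OF Q(1)] Q by blast
      qed
    qed
  qed
  then show ?case using y(1) by (simp add: zs_def length_remove1 split: if_splits)
      (metis Suc_pred length_pos_if_in_set Suc_le_mono)
qed simp


lemma colon_ideal:
  assumes "ideal J R" "s \<in> carrier R"
  shows "ideal {x \<in> carrier R. s \<otimes> x \<in> J} R"
  using ideal_memD[OF assms(1)] assms(2) by (intro ideal_intro) (auto simp: r_distr m_lcomm)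

lemma nakayama_ideal:
  assumes P: "primeideal P R" and L: "ideal L R" and ys: "set ys \<subseteq> carrier R"
    and x: "\<And>x. x \<in> L \<Longrightarrow> \<exists>s\<in>carrier R - P. s \<otimes> x \<in> gen (P \<cdot> L) ys"
  shows "\<exists>s\<in>carrier R - P. \<forall>x\<in>L. s \<otimes> x \<in> gen {\<zero>} ys"
proof -
  note Pi = prime_ideal[OF P]
  obtain gs where gs: "set gs \<subseteq> carrier R" "L = gen {\<zero>} gs" using ideal_fg[OF L] by blast
  have gL: "set gs \<subseteq> L" using gen_gen[OF zeroideal] gs by auto
  let ?N = "gen {\<zero>} ys" and ?C = "comb P (gen {\<zero>} ys) gs"
  have Ni: "ideal ?N R" by (rule gen_ideal[OF zeroideal ys])
  have Ci: "ideal ?C R" by (rule comb_ideal[OF Pi Ni gs(1)])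
  have mul: "p \<otimes> l \<in> ?C" if p: "p \<in> P" and l: "l \<in> L" for p l
  proof -
    have pc: "p \<in> carrier R" using p ideal_carrier[OF Pi] by auto
    have "gen {\<zero>} gs \<subseteq> {l \<in> carrier R. p \<otimes> l \<in> ?C}"
    proof (rule gen_sub[OF colon_ideal[OF Ci pc]])
      show "{\<zero>} \<subseteq> {l \<in> carrier R. p \<otimes> l \<in> ?C}" using ideal_zero[OF Ci] pc by simp
      show "set gs \<subseteq> {l \<in> carrier R. p \<otimes> l \<in> ?C}" using comb_gen[OF Pi Ni gs(1) p] gs(1) by auto
    qed
    then show ?thesis using l gs by auto
  qed
  have "l \<in> ?C" if "l \<in> P \<cdot> L" for l
    using that by (induction rule: ideal_prod.induct) (auto intro: mul ideal_add[OF Ci])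
  then have "gen (P \<cdot> L) ys \<subseteq> ?C"
    using gen_sub[OF Ci, of "P \<cdot> L" ys] gen_gen[OF zeroideal ys] comb_base[OF Pi Ni gs(1)] by blast
  then have "\<exists>s\<in>carrier R - P. s \<otimes> g \<in> ?C" if "g \<in> set gs" for g using x[of g] gL that by blast
  then obtain s where s: "s \<in> carrier R - P" "\<forall>g\<in>set gs. s \<otimes> g \<in> ?N"
    using nakayama[OF P Ni gs(1)] by blast
  have "gen {\<zero>} gs \<subseteq> {l \<in> carrier R. s \<otimes> l \<in> ?N}"
  proof (rule gen_sub)
    show "ideal {l \<in> carrier R. s \<otimes> l \<in> ?N} R" using s by (intro colon_ideal[OF Ni]) simp
    show "{\<zero>} \<subseteq> {l \<in> carrier R. s \<otimes> l \<in> ?N}" using ideal_zero[OF Ni] s by simp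
    show "set gs \<subseteq> {l \<in> carrier R. s \<otimes> l \<in> ?N}" using s gs(1) by auto
  qed
  then show ?thesis using s(1) gs(2) by blast
qed

section \<open>Regular sequences and dimension\<close>

text \<open>An element that is regular modulo an ideal lies in no minimal prime of that ideal. So a prime
  containing the sequence contains a chain of primes, built from the top.\<close>

lemma regular_seq_prime_chain:
  assumes reg: "regular_seq R xs" and "i \<le> length xs" "primeideal P R" "set (take i xs) \<subseteq> P"
  shows "\<exists>C. C i = P \<and> (\<forall>j\<le>i. primeideal (C j) R) \<and> (\<forall>j<i. C j \<subset> C (Suc j))"
  using assms(2-)
proof (induction i arbitrary: P)
  case 0
  then show ?case by (intro exI[of _ "\<lambda>_. P"]) auto
next
  case (Suc i)
  define x where "x = xs ! i"
  have i: "i < length xs" using Suc.prems by simp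
  have xsc: "set xs \<subseteq> carrier R" using reg by (simp add: regular_seq_def)
  have tc: "set (take i xs) \<subseteq> carrier R" using xsc set_take_subset by fast
  have xP: "x \<in> P" using Suc.prems i by (auto simp: take_Suc_conv_app_nth x_def)
  have xc: "x \<in> carrier R" using xsc i by (auto simp: x_def)
  let ?I = "Idl (set (take i xs))"
  have Ii: "ideal ?I R" by (rule genideal_ideal[OF tc])
  have regx: "a \<in> ?I" if "a \<in> carrier R" "x \<otimes> a \<in> ?I" for a
    using reg i that by (auto simp: regular_seq_def x_def)
  have IP: "?I \<subseteq> P" using Suc.prems(2,3) i
    by (intro genideal_minimal prime_ideal) (auto simp: take_Suc_conv_app_nth)
  have "s \<otimes> x [^] (e::nat) \<notin> ?I" if s: "s \<in> carrier R - P" for s e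
  proof (induction e)
    case 0
    then show ?case using s IP by auto
  next
    case (Suc e)
    have "s \<otimes> x [^] Suc e = x \<otimes> (s \<otimes> x [^] e)" using s xc by (simp add: m_ac)
    then show ?case using regx[of "s \<otimes> x [^] e"] Suc s xc by auto
  qed
  then obtain N where N: "primeideal N R" "?I \<subseteq> N" "N \<subseteq> P" "x \<notin> N"
    using prime_below_avoiding[OF Suc.prems(2) Ii xc] by blast
  have "set (take i xs) \<subseteq> N" using N(2) genideal_self[OF tc] by blast
  then obtain C where C: "C i = N" "\<forall>j\<le>i. primeideal (C j) R" "\<forall>j<i. C j \<subset> C (Suc j)"
    using Suc.IH[of N] N(1) i by auto
  have "N \<subset> P" using N xP by auto
  have "primeideal ((C(Suc i := P)) j) R" if "j \<le> Suc i" for j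
    using that C(2) Suc.prems(2) by (cases "j = Suc i") auto
  moreover have "(C(Suc i := P)) j \<subset> (C(Suc i := P)) (Suc j)" if "j < Suc i" for j
    using that C(1,3) \<open>N \<subset> P\<close> by (cases "j = i") auto
  ultimately show ?case by (intro exI[of _ "C(Suc i := P)"]) simp
qed

lemma regular_seq_length:
  assumes "regular_seq R xs" "primeideal P R" "set xs \<subseteq> P"
  shows "enat (length xs) \<le> krull_dim R"
proof -
  obtain C where "\<forall>j\<le>length xs. primeideal (C j) R" "\<forall>j<length xs. C j \<subset> C (Suc j)"
    using regular_seq_prime_chain[OF assms(1) order.refl assms(2)] assms(3) by auto
  then show ?thesis unfolding krull_dim_def by (intro Sup_upper) blast
qed

text \<open>The dimension of a local ring is at most the number of generators of an ideal that is primary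
  to the maximal ideal.\<close>

lemma dim_le_generators:
  assumes M: "primeideal M R" and big: "\<And>Q. primeideal Q R \<Longrightarrow> Q \<subseteq> M"
    and dim: "krull_dim R = enat n"
    and ys: "set ys \<subseteq> M" "\<And>Q. primeideal Q R \<Longrightarrow> set ys \<subseteq> Q \<Longrightarrow> Q = M"
  shows "n \<le> length ys"
proof -
  define S where "S = {enat n | n. \<exists>C. (\<forall>i\<le>n. primeideal (C i) R) \<and> (\<forall>i<n. C i \<subset> C (Suc i))}"
  have sup: "Sup S = enat n" using dim by (simp add: krull_dim_def S_def)
  have "x \<le> enat (length ys)" if "x \<in> S" for x
  proof -
    obtain m C where m: "x = enat m" "\<forall>i\<le>m. primeideal (C i) R" "\<forall>i<m. C i \<subset> C (Suc i)"
      using \<open>x \<in> S\<close> unfolding S_def by blast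
    define D where "D = C(m := M)"
    have "m \<le> length ys"
    proof (rule krull_height[of m D ys])
      show "primeideal (D i) R" if "i \<le> m" for i using m that M by (auto simp: D_def)
      show "D i \<subset> D (Suc i)" if "i < m" for i
      proof (cases "Suc i = m")
        case True
        then show ?thesis using m(3) that big[of "C m"] m(2) by (auto simp: D_def)
      qed (use m that in \<open>auto simp: D_def\<close>)
      show "set ys \<subseteq> D m" "\<And>Q. primeideal Q R \<Longrightarrow> set ys \<subseteq> Q \<Longrightarrow> Q \<subseteq> D m \<Longrightarrow> Q = D m"
        using ys by (auto simp: D_def)
    qed
    then show ?thesis using m by simp
  qed
  then have "Sup S \<le> enat (length ys)" by (rule Sup_least)
  then show ?thesis using sup by simp
qed

section \<open>Square-zero quotients of regular local rings\<close>

text \<open>More than \<open>m\<close> elements of a vector space spanned by \<open>m\<close> elements are dependent, for the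
  localisation of \<open>(N + (xs)) / N\<close> at \<open>P\<close> as a vector space over the residue field of \<open>P\<close>: up to
  a factor outside \<open>P\<close>, one of the elements is a combination of the others.\<close>

lemma dependence:
  assumes P: "primeideal P R" and N: "ideal N R"
  shows "set xs \<subseteq> carrier R \<Longrightarrow> (\<And>p x. p \<in> P \<Longrightarrow> x \<in> set xs \<Longrightarrow> p \<otimes> x \<in> N) \<Longrightarrow>
    set zs \<subseteq> gen N xs \<Longrightarrow> length xs < length zs \<Longrightarrow>
    \<exists>z rest s. mset zs = add_mset z (mset rest) \<and> s \<in> carrier R - P \<and> s \<otimes> z \<in> gen N rest"
proof (induction xs arbitrary: zs)
  case Nil
  then obtain z rest where zs: "zs = z # rest" by (cases zs) auto
  have zN: "z \<in> N" "set rest \<subseteq> carrier R" using Nil zs ideal_carrier[OF N] by auto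
  then have "\<one> \<otimes> z \<in> gen N rest" using gen_base[OF N zN(2)] ideal_carrier[OF N] by auto
  then show ?case using prime_one[OF P] zs by (intro exI[of _ z] exI[of _ rest] exI[of _ \<one>]) auto
next
  case (Cons x xs)
  have xc: "x \<in> carrier R" and xsc: "set xs \<subseteq> carrier R" using Cons.prems by auto
  have gI: "ideal (gen N xs) R" by (rule gen_ideal[OF N xsc])
  note gD = ideal_memD[OF gI]
  have zc: "set zs \<subseteq> carrier R"
    using Cons.prems(3) ideal_carrier[OF gen_ideal[OF N Cons.prems(1)]] by blast
  have "\<forall>z\<in>set zs. \<exists>w n. w \<in> carrier R \<and> n \<in> gen N xs \<and> z = w \<otimes> x \<oplus> n" using Cons.prems(3) by auto
  then obtain w n where wn: "\<And>z. z \<in> set zs \<Longrightarrow> w z \<in> carrier R \<and> n z \<in> gen N xs \<and> z = w z \<otimes> x \<oplus> n z"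
    by metis
  show ?case
  proof (cases "\<forall>z\<in>set zs. w z \<in> P")
    case True
    have "z \<in> gen N xs" if z: "z \<in> set zs" for z
    proof -
      have "w z \<otimes> x \<in> N" using True z Cons.prems(2) by simp
      then have "w z \<otimes> x \<in> gen N xs" using gen_base[OF N xsc] by auto
      then have "w z \<otimes> x \<oplus> n z \<in> gen N xs" using gD(3) wn[OF z] by blast
      then show ?thesis using wn[OF z] by simp
    qed
    then show ?thesis using Cons.IH[of zs] Cons.prems xsc by auto
  next
    case False
    then obtain z where z: "z \<in> set zs" "w z \<notin> P" by blast
    define rest where "rest = remove1 z zs"
    have ms: "mset zs = add_mset z (mset rest)" using z by (simp add: rest_def)
    have rz: "set rest \<subseteq> set zs" by (simp add: rest_def set_remove1_subset)
    define f where "f y = w z \<otimes> y \<ominus> w y \<otimes> z" for y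
    have fg: "f y \<in> gen N xs" if y: "y \<in> set zs" for y
    proof -
      have c: "w z \<in> carrier R" "w y \<in> carrier R" "n z \<in> carrier R" "n y \<in> carrier R"
        using wn[OF y] wn[OF z(1)] gD(1) by auto
      have "f y = w z \<otimes> (w y \<otimes> x \<oplus> n y) \<ominus> w y \<otimes> (w z \<otimes> x \<oplus> n z)"
        unfolding f_def using wn[OF y] wn[OF z(1)] by simp
      also have "\<dots> = w z \<otimes> n y \<ominus> w y \<otimes> n z" using c xc by algebra
      finally show ?thesis using gD wn[OF y] wn[OF z(1)] c by auto
    qed
    have "length rest = length zs - 1" using z by (simp add: rest_def length_remove1)
    then have "length xs < length (map f rest)" using Cons.prems by simp
    moreover have "set (map f rest) \<subseteq> gen N xs" using fg rz by auto
    ultimately obtain z' rest' s where *: "mset (map f rest) = add_mset z' (mset rest')"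
      "s \<in> carrier R - P" "s \<otimes> z' \<in> gen N rest'"
      using Cons.IH[of "map f rest"] Cons.prems(2) xsc by auto
    then have "image_mset f (mset rest) = add_mset z' (mset rest')" by simp
    then obtain B y where B: "mset rest = add_mset y B" "f y = z'" "image_mset f B = mset rest'"
      by (metis msed_map_invR)
    obtain bs where bs: "mset bs = B" using ex_mset by blast
    have yzs: "y \<in> set zs" and bzs: "set bs \<subseteq> set zs"
    proof -
      have "set_mset (add_mset y B) \<subseteq> set zs" using B(1) rz by (metis set_mset_mset)
      then show "y \<in> set zs" "set bs \<subseteq> set zs" using bs by auto
    qed
    have set': "set rest' = f ` set bs" using B(3) bs by (metis set_image_mset set_mset_mset)
    have zbc: "set (z # bs) \<subseteq> carrier R" using z bzs zc by auto
    have hI: "ideal (gen N (z # bs)) R" by (rule gen_ideal[OF N zbc])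
    note hD = ideal_memD[OF hI]
    have hz: "z \<in> gen N (z # bs)" "set bs \<subseteq> gen N (z # bs)" using gen_gen[OF N zbc] by auto
    have "set rest' \<subseteq> gen N (z # bs)"
    proof
      fix c assume "c \<in> set rest'"
      then obtain b where b: "b \<in> set bs" "c = f b" using set' by auto
      then have "w z \<otimes> b \<in> gen N (z # bs)" "w b \<otimes> z \<in> gen N (z # bs)"
        using hD(4) hz wn[of b] wn[OF z(1)] bzs by blast+
      then show "c \<in> gen N (z # bs)" unfolding b f_def by (rule hD(7))
    qed
    then have "gen N rest' \<subseteq> gen N (z # bs)" by (intro gen_sub[OF hI] gen_base[OF N zbc])
    then have in1: "s \<otimes> f y \<in> gen N (z # bs)" using * B by blast
    have c: "s \<in> carrier R" "w z \<in> carrier R" "w y \<in> carrier R" "y \<in> carrier R" "z \<in> carrier R"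
      using * wn[OF yzs] wn[OF z(1)] yzs zc z by auto
    have "(s \<otimes> w z) \<otimes> y = s \<otimes> f y \<oplus> (s \<otimes> w y) \<otimes> z" unfolding f_def using c by algebra
    moreover have "(s \<otimes> w y) \<otimes> z \<in> gen N (z # bs)" using hD(4) hz c by simp
    ultimately have "(s \<otimes> w z) \<otimes> y \<in> gen N (z # bs)" using in1 hD(3) by simp
    moreover have "s \<otimes> w z \<in> carrier R - P" using prime_mult_closed[OF P] * z c by auto
    moreover have "mset zs = add_mset y (mset (z # bs))" using ms B bs by simp
    ultimately show ?thesis by blast
  qed
qed


declare comb.simps(2) [simp del]

text \<open>A local ring whose maximal ideal is generated by \<open>n = dim R\<close> elements has no ideal \<open>I\<close> with at
  most \<open>n\<close> generators such that \<open>R / I\<close> has square-zero maximal ideal of dimension \<open>2\<close>. For let \<open>cs\<close>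
  be a shortest list in \<open>I\<close> generating the maximal ideal \<open>M\<close> together with \<open>a, b\<close>. It has length
  \<open>n - 2\<close>, so the \<open>n + 1\<close> elements \<open>cs, a\<^sup>2, ab, b\<^sup>2\<close> of \<open>I\<close> are dependent modulo \<open>M I\<close>. By
  minimality of \<open>cs\<close> this is a relation between \<open>a\<^sup>2, ab, b\<^sup>2\<close> modulo \<open>(cs) + M\<^sup>3\<close>, and it puts \<open>M\<^sup>2\<close>
  into the ideal generated by \<open>cs\<close> and one of \<open>a, b, a + b\<close>. These are only \<open>n - 1\<close> elements.
  The hypothesis \<open>dim\<close> is the consequence of \<open>n = dim R\<close> given by the height theorem: every ideal
  primary to \<open>M\<close> needs at least \<open>n\<close> generators.\<close>

lemma square_zero_quotient_generators:
  assumes M: "primeideal M R"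
    and dim: "\<And>ys. set ys \<subseteq> M \<Longrightarrow> (\<And>Q. primeideal Q R \<Longrightarrow> set ys \<subseteq> Q \<Longrightarrow> Q = M) \<Longrightarrow> n \<le> length ys"
    and big: "\<And>Q. primeideal Q R \<Longrightarrow> Q \<subseteq> M"
    and as: "set as \<subseteq> carrier R" "M = gen {\<zero>} as" "length as = n"
    and xs: "set xs \<subseteq> carrier R" "I = gen {\<zero>} xs" "length xs \<le> n"
    and IM: "I \<subseteq> M" and sq: "\<And>p q. p \<in> M \<Longrightarrow> q \<in> M \<Longrightarrow> p \<otimes> q \<in> I"
    and a: "a \<in> M" and b: "b \<in> M" and ab: "M \<subseteq> gen I [a, b]"
    and ind: "\<And>u v. u \<in> carrier R \<Longrightarrow> v \<in> carrier R \<Longrightarrow> u \<otimes> a \<oplus> v \<otimes> b \<in> I \<Longrightarrow> u \<in> M \<and> v \<in> M"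
  shows False
proof -
  note Mi = prime_ideal[OF M]
  note MD = ideal_memD[OF Mi]
  have Ii: "ideal I R" unfolding xs(2) by (rule gen_ideal[OF zeroideal xs(1)])
  note ID = ideal_memD[OF Ii]
  let ?M3 = "M \<cdot> (M \<cdot> M)"
  have ac: "a \<in> carrier R" and bc: "b \<in> carrier R" using a b MD by auto
  have MMi: "ideal (M \<cdot> M) R" by (rule ideal_prod_is_ideal[OF Mi Mi])
  have MIi: "ideal (M \<cdot> I) R" by (rule ideal_prod_is_ideal[OF Mi Ii])
  have M3i: "ideal ?M3 R" by (rule ideal_prod_is_ideal[OF Mi MMi])
  have MMI: "x \<in> I" if "x \<in> M \<cdot> M" for x
    using that by (induction rule: ideal_prod.induct) (auto intro: sq ID)
  have MI_MM: "x \<in> M \<cdot> M" if "x \<in> M \<cdot> I" for x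
    using that by (induction rule: ideal_prod.induct) (use IM in \<open>auto intro: ideal_prod.intros\<close>)
  define spans where "spans cs \<longleftrightarrow> set cs \<subseteq> I \<and> (\<exists>s\<in>carrier R - M. \<forall>m\<in>M. s \<otimes> m \<in> gen {\<zero>} (a # b # cs))" for cs
  have "spans xs"
  proof -
    have c: "set (a # b # xs) \<subseteq> carrier R" using xs ac bc by auto
    have "gen I [a, b] \<subseteq> gen {\<zero>} (a # b # xs)"
    proof (rule gen_sub[OF gen_ideal[OF zeroideal c]])
      show "I \<subseteq> gen {\<zero>} (a # b # xs)" unfolding xs(2)
        using gen_gen[OF zeroideal c] gen_base[OF zeroideal c]
        by (intro gen_sub[OF gen_ideal[OF zeroideal c]]) auto
      show "set [a, b] \<subseteq> gen {\<zero>} (a # b # xs)" using gen_gen[OF zeroideal c] by auto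
    qed
    then have "\<forall>m\<in>M. \<one> \<otimes> m \<in> gen {\<zero>} (a # b # xs)" using ab MD(1) by auto
    moreover have "set xs \<subseteq> I" using gen_gen[OF zeroideal xs(1)] xs(2) by simp
    ultimately show ?thesis unfolding spans_def using prime_one[OF M] by blast
  qed
  then obtain cs where cs: "spans cs" and cs_min: "\<And>cs'. spans cs' \<Longrightarrow> length cs \<le> length cs'"
    using ex_has_least_nat[of spans xs length] by blast
  have csI: "set cs \<subseteq> I" using cs by (simp add: spans_def)
  obtain s0 where s0: "s0 \<in> carrier R - M" "\<And>m. m \<in> M \<Longrightarrow> s0 \<otimes> m \<in> gen {\<zero>} (a # b # cs)"
    using cs unfolding spans_def by blast
  have csc: "set cs \<subseteq> carrier R" using csI ID(1) by blast
  have abcs: "set (a # b # cs) \<subseteq> carrier R" using csc ac bc by simp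

  have gens: "n \<le> length ys"
    if ys: "set ys \<subseteq> M" and r: "r \<in> carrier R - M" "\<And>m. m \<in> M \<Longrightarrow> r \<otimes> (m \<otimes> m) \<in> gen {\<zero>} ys" for ys r
  proof (rule dim[OF ys])
    fix Q assume Q: "primeideal Q R" "set ys \<subseteq> Q"
    have QM: "Q \<subseteq> M" by (rule big[OF Q(1)])
    have G: "gen {\<zero>} ys \<subseteq> Q"
      using Q ideal_zero[OF prime_ideal[OF Q(1)]] by (intro gen_sub[OF prime_ideal[OF Q(1)]]) auto
    have "m \<in> Q" if m: "m \<in> M" for m
    proof -
      have mc: "m \<in> carrier R" using MD m by auto
      have "r \<notin> Q" "r \<in> carrier R" using r(1) QM by auto
      moreover have "r \<otimes> (m \<otimes> m) \<in> Q" using r(2)[OF m] G by (rule subsetD[rotated])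
      ultimately show ?thesis using primeD(3)[OF Q(1), of r "m \<otimes> m"] primeD(3)[OF Q(1) mc mc] mc by auto
    qed
    then show "Q = M" using QM by blast
  qed

  have no_drop: False
    if z: "mset cs = add_mset z (mset cs')" and s: "s \<in> carrier R - M" "s \<otimes> z \<in> gen (M \<cdot> M) (a # b # cs')"
    for z cs' s
  proof -
    have scs: "set cs = insert z (set cs')"
      using arg_cong[OF z, of set_mset] by simp
    have c: "set (a # b # cs') \<subseteq> carrier R" using scs csc ac bc by auto
    let ?J = "gen (M \<cdot> M) (a # b # cs')"
    have Ji: "ideal ?J R" by (rule gen_ideal[OF MMi c])
    have Jg: "set (a # b # cs') \<subseteq> ?J" by (rule gen_gen[OF MMi c])
    have "gen {\<zero>} (a # b # cs) \<subseteq> {x \<in> carrier R. s \<otimes> x \<in> ?J}"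
    proof (rule gen_sub)
      show "ideal {x \<in> carrier R. s \<otimes> x \<in> ?J} R" using s by (intro colon_ideal[OF Ji]) simp
      show "{\<zero>} \<subseteq> {x \<in> carrier R. s \<otimes> x \<in> ?J}" using ideal_zero[OF Ji] s by simp
      have "s \<otimes> x \<in> ?J" if "x \<in> set (a # b # cs)" for x
      proof (cases "x = z")
        case False
        then have "x \<in> ?J" using that scs Jg by auto
        then show ?thesis using ideal_lmult[OF Ji] s by blast
      qed (use s in simp)
      then show "set (a # b # cs) \<subseteq> {x \<in> carrier R. s \<otimes> x \<in> ?J}" using abcs by blast
    qed
    then have "(s \<otimes> s0) \<otimes> m \<in> ?J" if "m \<in> M" for m
      using s0(2)[OF that] s s0(1) MD(1)[OF that] by (auto simp: m_assoc)
    then have "\<exists>t\<in>carrier R - M. t \<otimes> m \<in> ?J" if "m \<in> M" for m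
      using prime_mult_closed[OF M s(1) s0(1)] that by blast
    then have "spans cs'" unfolding spans_def
      using nakayama_ideal[OF M Mi c] csI scs by auto
    then show False using cs_min[of cs'] arg_cong[OF z, of size] by simp
  qed

  have len1: "length cs + 2 \<le> n"
  proof (rule ccontr)
    assume "\<not> ?thesis"
    then have len: "length as < length (a # b # cs)" using as by simp
    have asM: "set as \<subseteq> M" using gen_gen[OF zeroideal as(1)] as(2) by simp
    have "gen {\<zero>} as \<subseteq> gen (M \<cdot> M) as"
      using gen_gen[OF MMi as(1)] ideal_zero[OF gen_ideal[OF MMi as(1)]]
      by (intro gen_sub[OF gen_ideal[OF MMi as(1)]]) auto
    then have sub: "set (a # b # cs) \<subseteq> gen (M \<cdot> M) as" using as(2) a b csI IM by auto
    have "p \<otimes> x \<in> M \<cdot> M" if "p \<in> M" "x \<in> set as" for p x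
      using ideal_prod.prod[of p M x M R] that asM by blast
    then obtain z rest s where z: "mset (a # b # cs) = add_mset z (mset rest)"
      "s \<in> carrier R - M" "s \<otimes> z \<in> gen (M \<cdot> M) rest"
      using dependence[OF M MMi as(1) _ sub len] by blast
    have srest: "set (a # b # cs) = insert z (set rest)" using arg_cong[OF z(1), of set_mset] by simp
    have into: "s \<otimes> z \<in> gen I [c]" if c: "c \<in> carrier R" "set rest \<subseteq> insert c I" for c
    proof -
      have cc: "set [c] \<subseteq> carrier R" using c by simp
      have "gen (M \<cdot> M) rest \<subseteq> gen I [c]"
      proof (rule gen_sub[OF gen_ideal[OF Ii cc]])
        show "M \<cdot> M \<subseteq> gen I [c]" using MMI gen_base[OF Ii cc] by blast
        show "set rest \<subseteq> gen I [c]" using c(2) gen_base[OF Ii cc] gen_gen[OF Ii cc] by auto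
      qed
      then show ?thesis using z(3) by blast
    qed
    consider "z = a" | "z \<noteq> a" "z = b" | "z \<noteq> a" "z \<noteq> b" by blast
    then show False
    proof cases
      case 1
      then have "mset rest = mset (b # cs)" using z(1) by simp
      then have "set rest = set (b # cs)" by (rule mset_eq_setD)
      then have "set rest \<subseteq> insert b I" using csI by auto
      from into[OF bc this] obtain v i where v: "s \<otimes> a = v \<otimes> b \<oplus> i" "v \<in> carrier R" "i \<in> I" using 1 by (auto simp: comb.simps)
      have c: "s \<in> carrier R" "i \<in> carrier R" using z v ID by auto
      have "s \<otimes> a \<oplus> (\<ominus> v) \<otimes> b = i" unfolding v(1) using v(2) c ac bc by algebra
      then have "s \<in> M" using ind[of s "\<ominus> v"] v c by auto
      then show False using z by simp
    next
      case 2
      then have "mset rest = mset (a # cs)" using z(1) by (simp add: add_mset_commute)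
      then have "set rest = set (a # cs)" by (rule mset_eq_setD)
      then have "set rest \<subseteq> insert a I" using csI by auto
      from into[OF ac this] obtain v i where v: "s \<otimes> b = v \<otimes> a \<oplus> i" "v \<in> carrier R" "i \<in> I" using 2 by (auto simp: comb.simps)
      have c: "s \<in> carrier R" "i \<in> carrier R" using z v ID by auto
      have "(\<ominus> v) \<otimes> a \<oplus> s \<otimes> b = i" unfolding v(1) using v(2) c ac bc by algebra
      then have "s \<in> M" using ind[of "\<ominus> v" s] v c by auto
      then show False using z by simp
    next
      case 3
      then have "z \<in> set cs" using srest by auto
      then have "mset cs = add_mset z (mset (remove1 z cs))" by simp
      then obtain cs' where cz: "mset cs = add_mset z (mset cs')" by blast
      have cs': "set cs' \<subseteq> set cs" using arg_cong[OF cz, of set_mset] by auto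
      have "mset rest = mset (a # b # cs')" using z(1) cz by (simp add: add_mset_commute)
      then have sr: "set rest = set (a # b # cs')" by (rule mset_eq_setD)
      have c: "set (a # b # cs') \<subseteq> carrier R" using abcs cs' by auto
      have "gen (M \<cdot> M) rest \<subseteq> gen (M \<cdot> M) (a # b # cs')"
        using gen_gen[OF MMi c] gen_base[OF MMi c] sr by (intro gen_sub[OF gen_ideal[OF MMi c]]) auto
      then show False using no_drop[OF cz z(2)] z(3) by blast
    qed
  qed

  define T where "T e = gen ?M3 (e # cs)" for e
  have Ti: "ideal (T e) R" if "e \<in> carrier R" for e
    unfolding T_def using that csc by (intro gen_ideal[OF M3i]) simp
  have Tg: "e \<in> T e" "set cs \<subseteq> T e" "?M3 \<subseteq> T e" if "e \<in> carrier R" for e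
    using that csc gen_gen[OF M3i, of "e # cs"] gen_base[OF M3i, of "e # cs"] unfolding T_def by auto

  have key: False
    if e: "e \<in> M" and t: "t \<in> carrier R - M"
      and tt: "t \<otimes> (a \<otimes> a) \<in> T e" "t \<otimes> (a \<otimes> b) \<in> T e" "t \<otimes> (b \<otimes> b) \<in> T e" for e t
  proof -
    have ec: "e \<in> carrier R" using e MD by auto
    note TD = ideal_memD[OF Ti[OF ec]]
    let ?G = "gen {\<zero>} (a # b # cs)"
    have Gi: "ideal ?G R" by (rule gen_ideal[OF zeroideal abcs])
    have one_side: "t \<otimes> (x \<otimes> y) \<in> T e"
      if x: "x \<in> carrier R" "t \<otimes> (x \<otimes> a) \<in> T e" "t \<otimes> (x \<otimes> b) \<in> T e" and y: "y \<in> ?G" for x y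
    proof -
      have tx: "t \<otimes> x \<in> carrier R" using t x by simp
      have as: "t \<otimes> (x \<otimes> z) = (t \<otimes> x) \<otimes> z" if "z \<in> carrier R" for z using that t x by (simp add: m_assoc)
      have "?G \<subseteq> {y \<in> carrier R. (t \<otimes> x) \<otimes> y \<in> T e}"
      proof (rule gen_sub[OF colon_ideal[OF Ti[OF ec] tx]])
        show "{\<zero>} \<subseteq> {y \<in> carrier R. (t \<otimes> x) \<otimes> y \<in> T e}" using TD(2) tx by simp
        have "(t \<otimes> x) \<otimes> c \<in> T e" if "c \<in> set cs" for c using TD(4) Tg(2)[OF ec] that tx by blast
        then show "set (a # b # cs) \<subseteq> {y \<in> carrier R. (t \<otimes> x) \<otimes> y \<in> T e}"
          using csc ac bc x as by auto
      qed
      then show ?thesis using y as by auto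
    qed
    have tab: "t \<otimes> (x \<otimes> y) \<in> T e" if "x \<in> {a, b}" "y \<in> ?G" for x y
      using one_side[of x y] that ac bc tt m_comm[OF ac bc] by auto
    have two_side: "t \<otimes> (x \<otimes> y) \<in> T e" if x: "x \<in> ?G" and y: "y \<in> ?G" for x y
    proof -
      have c: "x \<in> carrier R" "y \<in> carrier R" using ideal_carrier[OF Gi] x y by auto
      have yx: "t \<otimes> (y \<otimes> z) \<in> T e" if "z \<in> {a, b}" for z
        using tab[OF that y] m_comm[of y z] that ac bc c by auto
      have "t \<otimes> (y \<otimes> x) \<in> T e" using one_side[of y x] yx c x by simp
      then show ?thesis using m_comm[of x y] c by simp
    qed
    define t' where "t' = t \<otimes> (s0 \<otimes> s0)"
    have t': "t' \<in> carrier R - M"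
      unfolding t'_def by (intro prime_mult_closed[OF M] t s0(1))
    have "x \<in> carrier R \<and> t' \<otimes> x \<in> T e" if "x \<in> M \<cdot> M" for x
      using that
    proof (induction rule: ideal_prod.induct)
      case (prod p q)
      then have c: "p \<in> carrier R" "q \<in> carrier R" "t \<in> carrier R" "s0 \<in> carrier R" using MD t s0 by auto
      then have "t' \<otimes> (p \<otimes> q) = t \<otimes> ((s0 \<otimes> p) \<otimes> (s0 \<otimes> q))" unfolding t'_def by algebra
      then show ?case using two_side[OF s0(2) s0(2)] prod c by simp
    next
      case (sum x y)
      then show ?case using TD(3) t' by (auto simp: r_distr)
    qed
    then have "\<exists>t\<in>carrier R - M. t \<otimes> x \<in> gen ?M3 (e # cs)" if "x \<in> M \<cdot> M" for x
      using t' that unfolding T_def by blast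
    then obtain r where r: "r \<in> carrier R - M" "\<forall>x\<in>M \<cdot> M. r \<otimes> x \<in> gen {\<zero>} (e # cs)"
      using nakayama_ideal[OF M MMi, of "e # cs"] ec csc by auto
    have "r \<otimes> (m \<otimes> m) \<in> gen {\<zero>} (e # cs)" if "m \<in> M" for m
      using r(2) ideal_prod.prod[OF that that] by blast
    then have "n \<le> length (e # cs)" using gens[of "e # cs" r] r(1) e csI IM by auto
    then show False using len1 by simp
  qed

  let ?qs = "[a \<otimes> a, a \<otimes> b, b \<otimes> b]"
  have len2: "length xs < length (cs @ ?qs)"
  proof -
    have c: "set (a # b # cs) \<subseteq> M" using a b csI IM by auto
    have "s0 \<otimes> (m \<otimes> m) \<in> gen {\<zero>} (a # b # cs)" if "m \<in> M" for m
      using s0(2)[of "m \<otimes> m"] MD(4)[OF that] MD(1)[OF that] by blast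
    then have "n \<le> length (a # b # cs)" using gens[OF c s0(1)] by blast
    then show ?thesis using xs(3) by simp
  qed
  have qsM: "set ?qs \<subseteq> M \<cdot> M" using a b by (auto intro: ideal_prod.prod)
  have "gen {\<zero>} xs \<subseteq> gen (M \<cdot> I) xs"
    using gen_gen[OF MIi xs(1)] ideal_zero[OF gen_ideal[OF MIi xs(1)]]
    by (intro gen_sub[OF gen_ideal[OF MIi xs(1)]]) auto
  then have sub: "set (cs @ ?qs) \<subseteq> gen (M \<cdot> I) xs" using xs(2) csI qsM MMI by auto
  have "p \<otimes> x \<in> M \<cdot> I" if "p \<in> M" "x \<in> set xs" for p x
    using ideal_prod.prod[of p M x I R] that gen_gen[OF zeroideal xs(1)] xs(2) by blast
  then obtain z rest s where z: "mset (cs @ ?qs) = add_mset z (mset rest)"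
    "s \<in> carrier R - M" "s \<otimes> z \<in> gen (M \<cdot> I) rest"
    using dependence[OF M MIi xs(1) _ sub len2] by blast
  have srest: "set (cs @ ?qs) = insert z (set rest)" using arg_cong[OF z(1), of set_mset] by simp
  have qsc: "set ?qs \<subseteq> carrier R" using ac bc by simp
  have "set (cs @ ?qs) \<subseteq> carrier R" using csc qsc by simp
  then have rc: "set rest \<subseteq> carrier R" and zc: "z \<in> carrier R" unfolding srest by auto

  show False
  proof (cases "z \<in> set cs")
    case True
    then have "mset cs = add_mset z (mset (remove1 z cs))" by simp
      then obtain cs' where cz: "mset cs = add_mset z (mset cs')" by blast
      have cs': "set cs' \<subseteq> set cs" using arg_cong[OF cz, of set_mset] by auto
    have "mset rest = mset (cs' @ ?qs)" using z(1) cz by (simp add: add_mset_commute)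
    then have sr: "set rest = set (cs' @ ?qs)" by (rule mset_eq_setD)
    have c: "set (a # b # cs') \<subseteq> carrier R" using abcs cs' by auto
    have "gen (M \<cdot> I) rest \<subseteq> gen (M \<cdot> M) (a # b # cs')"
    proof (rule gen_sub[OF gen_ideal[OF MMi c]])
      show "M \<cdot> I \<subseteq> gen (M \<cdot> M) (a # b # cs')" using MI_MM gen_base[OF MMi c] by blast
      show "set rest \<subseteq> gen (M \<cdot> M) (a # b # cs')"
        unfolding sr using gen_gen[OF MMi c] gen_base[OF MMi c] qsM by auto
    qed
    then show False using no_drop[OF cz z(2)] z(3) by blast
  next
    case False
    \<comment> \<open>Up to \<open>s0\<close>, an element of \<open>I\<close> lies in \<open>(cs) + M\<^sup>2\<close>, as \<open>a, b\<close> are independent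
      modulo \<open>I\<close>. So \<open>M I\<close> lies in \<open>(cs) + M\<^sup>3\<close>.\<close>
    have s0MI: "s0 \<otimes> x \<in> gen ?M3 (cs @ ws)" if x: "x \<in> M \<cdot> I" and ws: "set ws \<subseteq> carrier R" for x ws
    proof -
      have cws: "set (cs @ ws) \<subseteq> carrier R" using csc ws by simp
      let ?J = "gen ?M3 (cs @ ws)"
      have Ji: "ideal ?J R" by (rule gen_ideal[OF M3i cws])
      note JD = ideal_memD[OF Ji]
      have Jg: "set cs \<subseteq> ?J" "?M3 \<subseteq> ?J" using gen_gen[OF M3i cws] gen_base[OF M3i cws] by auto
      have "x \<in> carrier R \<and> s0 \<otimes> x \<in> ?J" using x
      proof (induction rule: ideal_prod.induct)
        case (prod p i)
        have pc: "p \<in> carrier R" "i \<in> carrier R" using prod MD ID by auto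
        have gc: "gen {\<zero>} cs \<subseteq> I" using csI ID(2) by (intro gen_sub[OF Ii]) auto
        have "s0 \<otimes> i \<in> gen {\<zero>} (a # b # cs)" using s0(2) prod IM by blast
        then obtain u v c where uv: "s0 \<otimes> i = u \<otimes> a \<oplus> (v \<otimes> b \<oplus> c)" "u \<in> carrier R" "v \<in> carrier R" "c \<in> gen {\<zero>} cs"
          by (auto simp: comb.simps)
        have c: "c \<in> carrier R" "c \<in> I" using uv gc ID by auto
        have "u \<otimes> a \<oplus> v \<otimes> b = (u \<otimes> a \<oplus> (v \<otimes> b \<oplus> c)) \<ominus> c" using uv(2,3) c(1) ac bc by algebra
        then have "u \<otimes> a \<oplus> v \<otimes> b = s0 \<otimes> i \<ominus> c" using uv(1) by simp
        moreover have "s0 \<otimes> i \<in> I" using ID(4) prod s0(1) by blast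
        ultimately have "u \<in> M \<and> v \<in> M" using ind uv(2,3) ID(7) c(2) by simp
        then have "p \<otimes> (u \<otimes> a) \<in> ?M3" "p \<otimes> (v \<otimes> b) \<in> ?M3"
          using a b prod by (auto intro: ideal_prod.prod)
        then have "p \<otimes> (u \<otimes> a) \<in> ?J" "p \<otimes> (v \<otimes> b) \<in> ?J" using Jg by auto
        moreover have "p \<otimes> c \<in> ?J"
        proof -
          have "gen {\<zero>} cs \<subseteq> ?J" using Jg JD(2) by (intro gen_sub[OF Ji]) auto
          then show ?thesis using uv pc JD(4) by blast
        qed
        moreover have "s0 \<otimes> (p \<otimes> i) = p \<otimes> (u \<otimes> a) \<oplus> (p \<otimes> (v \<otimes> b) \<oplus> p \<otimes> c)"
        proof -
          have "s0 \<otimes> (p \<otimes> i) = p \<otimes> (s0 \<otimes> i)" using s0(1) pc by (simp add: m_lcomm)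
          then show ?thesis unfolding uv(1) using uv(2,3) c pc ac bc by (simp add: r_distr)
        qed
        ultimately show ?case using JD(3) pc by simp
      next
        case (sum x y)
        then show ?case using JD(3) s0(1) by (auto simp: r_distr)
      qed
      then show ?thesis by blast
    qed
    have rel: "(s0 \<otimes> s) \<otimes> z \<in> gen ?M3 (cs @ ws)"
      if ws: "set ws \<subseteq> carrier R" "set rest \<subseteq> set cs \<union> set ws" for ws
    proof -
      have cws: "set (cs @ ws) \<subseteq> carrier R" using csc ws by simp
      let ?J = "gen ?M3 (cs @ ws)"
      have Ji: "ideal ?J R" by (rule gen_ideal[OF M3i cws])
      have s0c: "s0 \<in> carrier R" using s0(1) by simp
      have "gen (M \<cdot> I) rest \<subseteq> {x \<in> carrier R. s0 \<otimes> x \<in> ?J}"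
      proof (rule gen_sub[OF colon_ideal[OF Ji s0c]])
        show "M \<cdot> I \<subseteq> {x \<in> carrier R. s0 \<otimes> x \<in> ?J}" using s0MI[OF _ ws(1)] ideal_carrier[OF MIi] by blast
        have "x \<in> ?J" if "x \<in> set rest" for x using gen_gen[OF M3i cws] ws(2) that by auto
        then show "set rest \<subseteq> {x \<in> carrier R. s0 \<otimes> x \<in> ?J}" using ideal_lmult[OF Ji] s0c rc by blast
      qed
      then have "s0 \<otimes> (s \<otimes> z) \<in> ?J" using z(3) by blast
      then show ?thesis using s0c z(2) zc by (simp add: m_assoc)
    qed
    define t where "t = s0 \<otimes> s"
    have t: "t \<in> carrier R - M" unfolding t_def by (rule prime_mult_closed[OF M s0(1) z(2)])
    have tc: "t \<in> carrier R" using t by simp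
    have into: "gen ?M3 (cs @ ws) \<subseteq> T e" if "e \<in> carrier R" "set ws \<subseteq> T e" for e ws
      using Tg[OF that(1)] that by (intro gen_sub[OF Ti[OF that(1)]]) auto
    have Tmul: "r \<otimes> x \<in> T e" if "x \<in> T e" "r \<in> carrier R" "e \<in> carrier R" for r x e
      using ideal_lmult[OF Ti[OF that(3)]] that by blast
    have Ta: "a \<otimes> a \<in> T a" "a \<otimes> b \<in> T a" and Tb: "a \<otimes> b \<in> T b" "b \<otimes> b \<in> T b"
      using Tmul[OF Tg(1)[OF ac] ac ac] Tmul[OF Tg(1)[OF ac] bc ac] m_comm[OF ac bc]
        Tmul[OF Tg(1)[OF bc] ac bc] Tmul[OF Tg(1)[OF bc] bc bc] by auto
    have aa: False if "r \<in> carrier R - M" "r \<otimes> (a \<otimes> a) \<in> T b" for r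
      using key[OF b that(1)] that Tmul[OF Tb(1) _ bc] Tmul[OF Tb(2) _ bc] by blast
    have bb: False if "r \<in> carrier R - M" "r \<otimes> (b \<otimes> b) \<in> T a" for r
      using key[OF a that(1)] that Tmul[OF Ta(1) _ ac] Tmul[OF Ta(2) _ ac] by blast
    have inj: "set rest \<subseteq> set cs \<union> set ws" if "mset (cs @ ?qs) = add_mset z (mset (cs @ ws))" for ws
      using z(1) that by (metis add_mset_add_mset_same_iff mset_eq_setD set_append order.refl)
    consider "z = a \<otimes> a" | "z = a \<otimes> b" | "z = b \<otimes> b" using False srest by auto
    then show False
    proof cases
      case 1
      have "t \<otimes> z \<in> gen ?M3 (cs @ [a \<otimes> b, b \<otimes> b])"
        unfolding t_def using rel[of "[a \<otimes> b, b \<otimes> b]"] inj[of "[a \<otimes> b, b \<otimes> b]"] ac bc 1 by simp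
      then show False using into[OF bc, of "[a \<otimes> b, b \<otimes> b]"] Tb aa[OF t] 1 by auto
    next
      case 3
      have "t \<otimes> z \<in> gen ?M3 (cs @ [a \<otimes> a, a \<otimes> b])"
        unfolding t_def using rel[of "[a \<otimes> a, a \<otimes> b]"] inj[of "[a \<otimes> a, a \<otimes> b]"] ac bc 3
        by (simp add: add_mset_commute)
      then show False using into[OF ac, of "[a \<otimes> a, a \<otimes> b]"] Ta bb[OF t] 3 by auto
    next
      case 2
      let ?ws = "[a \<otimes> a, b \<otimes> b]"
      have wsc: "set (?ws @ cs) \<subseteq> carrier R" "set (cs @ ?ws) \<subseteq> carrier R" using csc ac bc by auto
      have "t \<otimes> z \<in> gen ?M3 (cs @ ?ws)"
        unfolding t_def using rel[of ?ws] inj[of ?ws] ac bc 2 by (simp add: add_mset_commute)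
      moreover have "gen ?M3 (cs @ ?ws) \<subseteq> gen ?M3 (?ws @ cs)"
        using gen_gen[OF M3i wsc(1)] gen_base[OF M3i wsc(1)] by (intro gen_sub[OF gen_ideal[OF M3i wsc(1)]]) auto
      ultimately obtain u v k where uv: "t \<otimes> (a \<otimes> b) = u \<otimes> (a \<otimes> a) \<oplus> (v \<otimes> (b \<otimes> b) \<oplus> k)"
        "u \<in> carrier R" "v \<in> carrier R" "k \<in> gen ?M3 cs" using 2 by (auto simp: comb.simps)
      have ki: "ideal (gen ?M3 cs) R" by (rule gen_ideal[OF M3i csc])
      have kc: "k \<in> carrier R" using uv ideal_carrier[OF ki] by auto
      have kT: "gen ?M3 cs \<subseteq> T e" if "e \<in> carrier R" for e using into[of e "[]"] that by simp
      show False
      proof (cases "u \<in> M \<and> v \<in> M")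
        case True
        \<comment> \<open>Up to the factor \<open>t\<close> the product \<open>a b\<close> vanishes modulo \<open>(cs) + M\<^sup>3\<close>, so that \<open>a\<^sup>2\<close> and \<open>b\<^sup>2\<close> are
          multiples of \<open>a + b\<close>.\<close>
        have "u \<otimes> (a \<otimes> a) \<in> ?M3" "v \<otimes> (b \<otimes> b) \<in> ?M3"
          using True a b by (auto intro: ideal_prod.prod)
        define e where "e = a \<oplus> b"
        have eM: "e \<in> M" and ec: "e \<in> carrier R" using a b MD(1,3) by (auto simp: e_def)
        note TD = ideal_memD[OF Ti[OF ec]]
        have abT: "t \<otimes> (a \<otimes> b) \<in> T e"
          unfolding uv(1) using \<open>u \<otimes> (a \<otimes> a) \<in> _\<close> \<open>v \<otimes> (b \<otimes> b) \<in> _\<close> Tg(3)[OF ec] kT[OF ec] uv(4) TD(3) by blast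
        have ae: "(t \<otimes> a) \<otimes> e \<in> T e" "(t \<otimes> b) \<otimes> e \<in> T e" using TD(4)[OF Tg(1)[OF ec]] tc ac bc by auto
        have "t \<otimes> (a \<otimes> a) = (t \<otimes> a) \<otimes> e \<ominus> t \<otimes> (a \<otimes> b)" "t \<otimes> (b \<otimes> b) = (t \<otimes> b) \<otimes> e \<ominus> t \<otimes> (a \<otimes> b)"
          unfolding e_def using tc ac bc by algebra+
        then have "t \<otimes> (a \<otimes> a) \<in> T e" "t \<otimes> (b \<otimes> b) \<in> T e" using TD(7) ae abT by auto
        then show False using key[OF eM t _ abT] by blast
      next
        case False
        have e1: "u \<otimes> (a \<otimes> a) = t \<otimes> (a \<otimes> b) \<ominus> (v \<otimes> (b \<otimes> b) \<oplus> k)"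
          unfolding uv(1) using uv(2,3) kc ac bc by algebra
        have e2: "v \<otimes> (b \<otimes> b) = t \<otimes> (a \<otimes> b) \<ominus> (u \<otimes> (a \<otimes> a) \<oplus> k)"
          unfolding uv(1) using uv(2,3) kc ac bc by algebra
        show False
        proof (cases "u \<in> M")
          case False
          note TD = ideal_memD[OF Ti[OF bc]]
          have "u \<otimes> (a \<otimes> a) \<in> T b" unfolding e1
            using TD(3,4,7) Tb tc uv(3,4) kT[OF bc] by (meson subsetD)
          then show False using aa[of u] False uv by auto
        next
          case True
          note TD = ideal_memD[OF Ti[OF ac]]
          have "v \<otimes> (b \<otimes> b) \<in> T a" unfolding e2
            using TD(3,4,7) Ta tc uv(2,4) kT[OF ac] by (meson subsetD)
          then show False using bb[of v] False True uv by auto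
        qed
      qed
    qed
  qed
qed

end

section \<open>Local rings with square-zero maximal ideal of dimension two\<close>

text \<open>A local ring with maximal ideal \<open>m\<close> such that \<open>m\<^sup>2 = 0\<close> and \<open>m\<close> is a vector space with basis
  \<open>a, b\<close> over the residue field.\<close>

locale short_local = cring R for R (structure) +
  fixes m :: "'a set" and a b :: 'a
  assumes m_eq: "m = {r \<otimes> a \<oplus> s \<otimes> b | r s. r \<in> carrier R \<and> s \<in> carrier R}"
    and ab_carrier: "a \<in> carrier R" "b \<in> carrier R"
    and ab_null: "a \<otimes> a = \<zero>" "a \<otimes> b = \<zero>" "b \<otimes> b = \<zero>"
    and ab_indep: "\<And>r s. r \<in> carrier R \<Longrightarrow> s \<in> carrier R \<Longrightarrow> r \<otimes> a \<oplus> s \<otimes> b = \<zero> \<Longrightarrow> r \<in> m \<and> s \<in> m"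
    and one_notin: "\<one> \<notin> m"
    and unit: "\<And>x. x \<in> carrier R \<Longrightarrow> x \<notin> m \<Longrightarrow> \<exists>y\<in>carrier R. x \<otimes> y = \<one>"
begin

lemma m_repr:
  assumes "x \<in> m"
  obtains r s where "r \<in> carrier R" "s \<in> carrier R" "x = r \<otimes> a \<oplus> s \<otimes> b"
  using assms unfolding m_eq by blast

lemma m_ideal: "ideal m R"
proof (rule ideal_intro)
  show "m \<subseteq> carrier R" using ab_carrier by (auto simp: m_eq)
  have "\<zero> = \<zero> \<otimes> a \<oplus> \<zero> \<otimes> b" using ab_carrier by simp
  then show "\<zero> \<in> m" unfolding m_eq using zero_closed by blast
  show "x \<oplus> y \<in> m" if xy: "x \<in> m" "y \<in> m" for x y
  proof -
    obtain r s where r: "r \<in> carrier R" "s \<in> carrier R" "x = r \<otimes> a \<oplus> s \<otimes> b" using xy(1) by (rule m_repr)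
    obtain t u where t: "t \<in> carrier R" "u \<in> carrier R" "y = t \<otimes> a \<oplus> u \<otimes> b" using xy(2) by (rule m_repr)
    have "x \<oplus> y = (r \<oplus> t) \<otimes> a \<oplus> (s \<oplus> u) \<otimes> b" unfolding r(3) t(3) using r(1,2) t(1,2) ab_carrier by algebra
    then show ?thesis unfolding m_eq using r t by blast
  qed
  show "c \<otimes> x \<in> m" if c: "c \<in> carrier R" and x: "x \<in> m" for c x
  proof -
    obtain r s where r: "r \<in> carrier R" "s \<in> carrier R" "x = r \<otimes> a \<oplus> s \<otimes> b" using x by (rule m_repr)
    have "c \<otimes> x = (c \<otimes> r) \<otimes> a \<oplus> (c \<otimes> s) \<otimes> b" unfolding r(3) using r(1,2) c ab_carrier by algebra
    then show ?thesis unfolding m_eq using r c by blast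
  qed
qed

lemmas mD = ideal_memD[OF m_ideal]

lemma ab_m: "a \<in> m" "b \<in> m"
proof -
  have "a = \<one> \<otimes> a \<oplus> \<zero> \<otimes> b" "b = \<zero> \<otimes> a \<oplus> \<one> \<otimes> b" using ab_carrier by simp_all
  then show "a \<in> m" "b \<in> m" unfolding m_eq using zero_closed one_closed by blast+
qed

lemma m_mult: "x \<in> m \<Longrightarrow> y \<in> m \<Longrightarrow> x \<otimes> y = \<zero>"
proof -
  assume xy: "x \<in> m" "y \<in> m"
  obtain r s where r: "r \<in> carrier R" "s \<in> carrier R" "x = r \<otimes> a \<oplus> s \<otimes> b" using xy(1) by (rule m_repr)
  obtain t u where t: "t \<in> carrier R" "u \<in> carrier R" "y = t \<otimes> a \<oplus> u \<otimes> b" using xy(2) by (rule m_repr)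
  have "x \<otimes> y = (r \<otimes> t) \<otimes> (a \<otimes> a) \<oplus> (r \<otimes> u \<oplus> s \<otimes> t) \<otimes> (a \<otimes> b) \<oplus> (s \<otimes> u) \<otimes> (b \<otimes> b)"
    unfolding r(3) t(3) using r(1,2) t(1,2) ab_carrier by algebra
  then show "x \<otimes> y = \<zero>" unfolding ab_null using r t by simp
qed

lemma ideal_cases:
  assumes "ideal J R"
  shows "J = carrier R \<or> J \<subseteq> m"
proof (cases "J \<subseteq> m")
  case False
  then obtain x where x: "x \<in> J" "x \<notin> m" by auto
  then obtain y where "y \<in> carrier R" "x \<otimes> y = \<one>" using unit ideal_carrier[OF assms] by blast
  then have "\<one> \<in> J" using ideal_rmult[OF assms x(1)] by force
  then have "r \<in> J" if "r \<in> carrier R" for r using ideal_lmult[OF assms, of \<one> r] that by simp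
  then show ?thesis using ideal_carrier[OF assms] by auto
qed simp

lemma m_maximal: "maximalideal m R"
  using m_ideal one_notin ideal_cases by (intro maximalidealI) auto

lemma maximal_unique: "maximalideal J R \<Longrightarrow> J = m"
proof -
  assume J: "maximalideal J R"
  interpret J: maximalideal J R by fact
  have "J \<subseteq> m" using ideal_cases[OF J.is_ideal] J.I_notcarr by auto
  then show "J = m" using J.I_maximal[OF m_ideal] mD(1) one_notin by auto
qed

lemma noetherian: "noetherian_ring R"
proof
  fix I assume I: "ideal I R"
  note ID = ideal_memD[OF I]
  have gen: "\<exists>A\<subseteq>carrier R. finite A \<and> I = Idl A" if A: "A \<subseteq> I" "finite A" "I \<subseteq> Idl A" for A
  proof (intro exI conjI)
    show "A \<subseteq> carrier R" using A ID(1) by auto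
    show "I = Idl A" using genideal_minimal[OF I A(1)] A(3) by blast
  qed (rule A)
  show "\<exists>A\<subseteq>carrier R. finite A \<and> I = Idl A"
  proof (cases "I \<subseteq> m")
    case False
    then have I1: "I = carrier R" using ideal_cases[OF I] by simp
    show ?thesis by (rule gen[of "{\<one>}"]) (simp_all add: I1 genideal_one)
  next
    case True
    show ?thesis
    proof (cases "\<exists>x\<in>I. I \<subseteq> Idl {x}")
      case True
      then show ?thesis using gen by blast
    next
      case False
      then obtain x where x: "x \<in> I" "x \<noteq> \<zero>"
        using genideal_zero ID(2) by (metis subsetI singleton_iff)
      then obtain y where y: "y \<in> I" "y \<notin> Idl {x}" using False by blast
      have xc: "x \<in> carrier R" and yc: "y \<in> carrier R" using x y ID by auto
      have Gi: "ideal (Idl {x}) R" using xc by (intro genideal_ideal) simp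
      note GD = ideal_memD[OF Gi]
      have xG: "x \<in> Idl {x}" using xc by (rule genideal_self')
      obtain r s where r: "r \<in> carrier R" "s \<in> carrier R" "x = r \<otimes> a \<oplus> s \<otimes> b"
        using True x by (meson m_repr subsetD)
      obtain t u where t: "t \<in> carrier R" "u \<in> carrier R" "y = t \<otimes> a \<oplus> u \<otimes> b"
        using True y by (meson m_repr subsetD)
      define D where "D = r \<otimes> u \<ominus> s \<otimes> t"
      have Dc: "D \<in> carrier R" using r t by (simp add: D_def)
      have Da: "D \<otimes> a = u \<otimes> x \<ominus> s \<otimes> y" and Db: "D \<otimes> b = r \<otimes> y \<ominus> t \<otimes> x"
        unfolding D_def r(3) t(3) using r(1,2) t(1,2) ab_carrier by algebra+
      have "D \<notin> m"
      proof
        \<comment> \<open>If the determinant vanishes in the residue field, then \<open>y\<close> is a multiple of \<open>x\<close>.\<close>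
        assume D: "D \<in> m"
        have 0: "D \<otimes> a = \<zero>" "D \<otimes> b = \<zero>" using m_mult[OF D] ab_m by auto
        have solve: "y \<in> Idl {x}" if c: "c \<in> carrier R" "c \<notin> m" "d \<in> carrier R" "c \<otimes> y = d \<otimes> x" for c d
        proof -
          obtain c' where c': "c' \<in> carrier R" "c \<otimes> c' = \<one>" using unit c by blast
          have "y = (c \<otimes> c') \<otimes> y" using c' yc by simp
          also have "\<dots> = c' \<otimes> (c \<otimes> y)" using c'(1) c(1) yc by (simp add: m_ac)
          also have "\<dots> \<in> Idl {x}" unfolding c(4) using GD(4) xG c c' by simp
          finally show ?thesis .
        qed
        have "s \<otimes> y = u \<otimes> x"
          using 0(1) Da r_right_minus_eq[of "u \<otimes> x" "s \<otimes> y"] r t xc yc by simp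
        moreover have "r \<otimes> y = t \<otimes> x"
          using 0(2) Db r_right_minus_eq[of "r \<otimes> y" "t \<otimes> x"] r t xc yc by simp
        ultimately have "r \<in> m" "s \<in> m" using solve y(2) r t by blast+
        then have "x = \<zero>" unfolding r(3) using m_mult ab_m by simp
        then show False using x by simp
      qed
      then obtain D' where D': "D' \<in> carrier R" "D \<otimes> D' = \<one>" using unit Dc by blast
      have cancel: "z = D' \<otimes> (D \<otimes> z)" if "z \<in> carrier R" for z
      proof -
        have "D' \<otimes> (D \<otimes> z) = (D \<otimes> D') \<otimes> z" using D'(1) Dc that by (simp add: m_ac)
        then show ?thesis using D' that by simp
      qed
      let ?G = "Idl {x, y}"
      have XYi: "ideal ?G R" using xc yc by (intro genideal_ideal) simp
      note XYD = ideal_memD[OF XYi]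
      have xy: "x \<in> ?G" "y \<in> ?G" using genideal_self[of "{x, y}"] xc yc by auto
      have "D \<otimes> a \<in> ?G" "D \<otimes> b \<in> ?G" unfolding Da Db using XYD(4,7) xy r t by auto
      then have "a \<in> ?G" "b \<in> ?G" using cancel[OF ab_carrier(1)] cancel[OF ab_carrier(2)] XYD(4) D'(1) by metis+
      then have "m \<subseteq> ?G" unfolding m_eq using XYD(3,4) by blast
      then show ?thesis using gen[of "{x, y}"] x y True by auto
    qed
  qed
qed

lemma local: "local_ring R"
  unfolding local_ring_def using is_cring noetherian m_maximal maximal_unique by blast

lemma max_ideal_eq: "max_ideal R = m"
  unfolding max_ideal_def using m_maximal by (rule the_equality) (rule maximal_unique)

section \<open>Infinite injective dimension\<close>

text \<open>Here \<open>C\<close> is a submodule of \<open>E\<close>. The linear maps \<open>m \<rightarrow> C\<close> are the maps \<open>a \<mapsto> c1, b \<mapsto> c2\<close> for elements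
  \<open>c1, c2\<close> of the socle of \<open>C\<close>, and the condition says that each of them extends to \<open>R\<close>: the first Ext
  group of the residue field with values in \<open>C\<close> vanishes.\<close>

definition lifts :: "('a, 'e) module \<Rightarrow> 'e set \<Rightarrow> bool"
  where "lifts E C \<longleftrightarrow> (\<forall>c1\<in>C. \<forall>c2\<in>C. (\<forall>x\<in>m. x \<odot>\<^bsub>E\<^esub> c1 = \<zero>\<^bsub>E\<^esub> \<and> x \<odot>\<^bsub>E\<^esub> c2 = \<zero>\<^bsub>E\<^esub>) \<longrightarrow>
    (\<exists>c\<in>C. a \<odot>\<^bsub>E\<^esub> c = c1 \<and> b \<odot>\<^bsub>E\<^esub> c = c2))"

lemma injective_lifts:
  fixes E :: "('a, 'e) module"
  assumes E: "injective R E"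
  shows "lifts E (carrier E)"
  unfolding lifts_def
proof (intro ballI impI)
  interpret E: module R E using E by (simp add: injective_def)
  fix c1 c2 assume c: "c1 \<in> carrier E" "c2 \<in> carrier E"
    and "\<forall>x\<in>m. x \<odot>\<^bsub>E\<^esub> c1 = \<zero>\<^bsub>E\<^esub> \<and> x \<odot>\<^bsub>E\<^esub> c2 = \<zero>\<^bsub>E\<^esub>"
  then have kill: "x \<odot>\<^bsub>E\<^esub> c1 = \<zero>\<^bsub>E\<^esub>" "x \<odot>\<^bsub>E\<^esub> c2 = \<zero>\<^bsub>E\<^esub>" if "x \<in> m" for x using that by auto
  \<comment> \<open>The constant functions form a copy of \<open>R\<close> within the carrier type of the test modules.\<close>
  define K :: "'a \<Rightarrow> ('e + 'a) list \<Rightarrow> 'a" where "K r = (\<lambda>_. r)" for r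
  have K_inj: "K r = K s \<longleftrightarrow> r = s" for r s by (auto simp: K_def fun_eq_iff)
  define B where "B = mk_mod (K ` carrier R) (K \<zero>) (\<lambda>f g x. f x \<oplus> g x) (\<lambda>r f x. r \<otimes> f x)"
  have B: "carrier B = K ` carrier R" "\<zero>\<^bsub>B\<^esub> = K \<zero>" "K r \<oplus>\<^bsub>B\<^esub> K s = K (r \<oplus> s)" "r \<odot>\<^bsub>B\<^esub> K s = K (r \<otimes> s)" for r s
    by (auto simp: B_def mk_mod_def K_def)
  have Bm: "module R B"
  proof (rule moduleI)
    show "cring R" by (rule is_cring)
    show "abelian_group B"
    proof (rule abelian_groupI)
      show "\<exists>y\<in>carrier B. y \<oplus>\<^bsub>B\<^esub> x = \<zero>\<^bsub>B\<^esub>" if x: "x \<in> carrier B" for x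
      proof -
        obtain r where r: "r \<in> carrier R" "x = K r" using x B by auto
        then have "K (\<ominus> r) \<oplus>\<^bsub>B\<^esub> x = \<zero>\<^bsub>B\<^esub>" "K (\<ominus> r) \<in> carrier B" by (auto simp: B l_neg)
        then show ?thesis by blast
      qed
    qed (auto simp: B a_ac)
  qed (auto simp: B l_distr r_distr m_assoc)
  let ?A = "K ` m"
  have A: "submodule ?A R B"
  proof (rule submodule.intro)
    show "subgroup ?A (add_monoid B)"
    proof (rule group.subgroupI[OF abelian_group.a_group[OF module.axioms(2)[OF Bm]]])
      show "?A \<subseteq> carrier (add_monoid B)" using mD(1) by (auto simp: B)
      show "?A \<noteq> {}" using ab_m by auto
      show "inv\<^bsub>add_monoid B\<^esub> x \<in> ?A" if "x \<in> ?A" for x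
      proof -
        obtain r where r: "r \<in> m" "x = K r" using \<open>x \<in> ?A\<close> by auto
        have rc: "r \<in> carrier R" using r mD(1) by auto
        interpret Bm: module R B by (rule Bm)
        have "\<ominus>\<^bsub>B\<^esub> x = K (\<ominus> r)"
        proof (rule Bm.minus_equality)
          show "K (\<ominus> r) \<oplus>\<^bsub>B\<^esub> x = \<zero>\<^bsub>B\<^esub>" using rc r by (simp add: B l_neg)
        qed (use rc r in \<open>auto simp: B\<close>)
        then show ?thesis using r mD(6) by (auto simp: a_inv_def)
      qed
      show "x \<otimes>\<^bsub>add_monoid B\<^esub> y \<in> ?A" if "x \<in> ?A" "y \<in> ?A" for x y
        using that mD(3) by (auto simp: B)
    qed
    show "submodule_axioms ?A R B"
      by (rule submodule_axioms.intro) (use mD(4) in \<open>auto simp: B\<close>)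
  qed
  define f where "f h = (SOME e. \<exists>r\<in>carrier R. \<exists>s\<in>carrier R. h = K (r \<otimes> a \<oplus> s \<otimes> b) \<and>
    e = r \<odot>\<^bsub>E\<^esub> c1 \<oplus>\<^bsub>E\<^esub> s \<odot>\<^bsub>E\<^esub> c2)" for h
  have f: "f (K (r \<otimes> a \<oplus> s \<otimes> b)) = r \<odot>\<^bsub>E\<^esub> c1 \<oplus>\<^bsub>E\<^esub> s \<odot>\<^bsub>E\<^esub> c2" if rs: "r \<in> carrier R" "s \<in> carrier R" for r s
  proof -
    have "\<exists>e. \<exists>t\<in>carrier R. \<exists>u\<in>carrier R. K (r \<otimes> a \<oplus> s \<otimes> b) = K (t \<otimes> a \<oplus> u \<otimes> b) \<and>
      e = t \<odot>\<^bsub>E\<^esub> c1 \<oplus>\<^bsub>E\<^esub> u \<odot>\<^bsub>E\<^esub> c2" using rs by blast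
    from someI_ex[OF this] obtain t u where t: "t \<in> carrier R" "u \<in> carrier R"
      "K (r \<otimes> a \<oplus> s \<otimes> b) = K (t \<otimes> a \<oplus> u \<otimes> b)"
      "f (K (r \<otimes> a \<oplus> s \<otimes> b)) = t \<odot>\<^bsub>E\<^esub> c1 \<oplus>\<^bsub>E\<^esub> u \<odot>\<^bsub>E\<^esub> c2" unfolding f_def by blast
    have eq: "r \<otimes> a \<oplus> s \<otimes> b = t \<otimes> a \<oplus> u \<otimes> b" using t(3) K_inj by simp
    have "(r \<ominus> t) \<otimes> a \<oplus> (s \<ominus> u) \<otimes> b = (r \<otimes> a \<oplus> s \<otimes> b) \<ominus> (t \<otimes> a \<oplus> u \<otimes> b)"
      using rs t(1,2) ab_carrier by algebra
    also have "\<dots> = \<zero>" unfolding eq using t(1,2) ab_carrier by (simp add: r_right_minus_eq)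
    finally have mm: "r \<ominus> t \<in> m" "s \<ominus> u \<in> m" using ab_indep[of "r \<ominus> t" "s \<ominus> u"] rs t by auto
    have "r = t \<oplus> (r \<ominus> t)" "s = u \<oplus> (s \<ominus> u)" using rs t(1,2) by algebra+
    then have "r \<odot>\<^bsub>E\<^esub> c1 = t \<odot>\<^bsub>E\<^esub> c1" "s \<odot>\<^bsub>E\<^esub> c2 = u \<odot>\<^bsub>E\<^esub> c2"
      using E.smult_l_distr[of t "r \<ominus> t" c1] E.smult_l_distr[of u "s \<ominus> u" c2] kill mm t(1,2) c rs by auto
    then show ?thesis using t(4) by simp
  qed
  have "f \<in> lin_maps R (B\<lparr>carrier := ?A\<rparr>) E"
    unfolding lin_maps_def
  proof (intro CollectI conjI ballI)
    show "f \<in> carrier (B\<lparr>carrier := ?A\<rparr>) \<rightarrow> carrier E"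
    proof (rule Pi_I)
      fix h assume "h \<in> carrier (B\<lparr>carrier := ?A\<rparr>)"
      then obtain x where x: "x \<in> m" "h = K x" by auto
      then show "f h \<in> carrier E" using f c by (auto elim!: m_repr)
    qed
    fix h assume "h \<in> carrier (B\<lparr>carrier := ?A\<rparr>)"
    then obtain x where x: "x \<in> m" "h = K x" by auto
    obtain r s where r: "r \<in> carrier R" "s \<in> carrier R" "x = r \<otimes> a \<oplus> s \<otimes> b" using x(1) by (rule m_repr)
    show "f (h \<oplus>\<^bsub>B\<lparr>carrier := ?A\<rparr>\<^esub> k) = f h \<oplus>\<^bsub>E\<^esub> f k" if k: "k \<in> carrier (B\<lparr>carrier := ?A\<rparr>)" for k
    proof -
      obtain y where y: "y \<in> m" "k = K y" using k by auto
      obtain t u where t: "t \<in> carrier R" "u \<in> carrier R" "y = t \<otimes> a \<oplus> u \<otimes> b" using y(1) by (rule m_repr)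
      have "x \<oplus> y = (r \<oplus> t) \<otimes> a \<oplus> (s \<oplus> u) \<otimes> b" unfolding r(3) t(3) using r(1,2) t(1,2) ab_carrier by algebra
      then have "f (h \<oplus>\<^bsub>B\<lparr>carrier := ?A\<rparr>\<^esub> k) = (r \<oplus> t) \<odot>\<^bsub>E\<^esub> c1 \<oplus>\<^bsub>E\<^esub> (s \<oplus> u) \<odot>\<^bsub>E\<^esub> c2"
        using f[of "r \<oplus> t" "s \<oplus> u"] r t by (simp add: x y B)
      also have "\<dots> = f h \<oplus>\<^bsub>E\<^esub> f k"
        unfolding x y r(3) t(3) using f r(1,2) t(1,2) c by (simp add: E.smult_l_distr E.a_ac)
      finally show ?thesis .
    qed
    show "f (q \<odot>\<^bsub>B\<lparr>carrier := ?A\<rparr>\<^esub> h) = q \<odot>\<^bsub>E\<^esub> f h" if q: "q \<in> carrier R" for q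
    proof -
      have "q \<otimes> x = (q \<otimes> r) \<otimes> a \<oplus> (q \<otimes> s) \<otimes> b" unfolding r(3) using r(1,2) q ab_carrier by algebra
      then have "f (q \<odot>\<^bsub>B\<lparr>carrier := ?A\<rparr>\<^esub> h) = (q \<otimes> r) \<odot>\<^bsub>E\<^esub> c1 \<oplus>\<^bsub>E\<^esub> (q \<otimes> s) \<odot>\<^bsub>E\<^esub> c2"
        using f[of "q \<otimes> r" "q \<otimes> s"] r q by (simp add: x B)
      also have "\<dots> = q \<odot>\<^bsub>E\<^esub> f h"
        unfolding x r(3) using f r(1,2) c q by (simp add: E.smult_r_distr E.smult_assoc1)
      finally show ?thesis .
    qed
  qed
  then obtain g where g: "g \<in> lin_maps R B E" "\<forall>x\<in>?A. g x = f x"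
    using E Bm A unfolding injective_def by blast
  have gK: "r \<odot>\<^bsub>E\<^esub> g (K \<one>) = g (K r)" if "r \<in> carrier R" for r
  proof -
    have "\<forall>r\<in>carrier R. \<forall>x\<in>carrier R. g (K (r \<otimes> x)) = r \<odot>\<^bsub>E\<^esub> g (K x)"
      using g(1) by (auto simp: lin_maps_def B)
    from bspec[OF bspec[OF this that] one_closed] show ?thesis using that by simp
  qed
  have "a = \<one> \<otimes> a \<oplus> \<zero> \<otimes> b" "b = \<zero> \<otimes> a \<oplus> \<one> \<otimes> b" using ab_carrier by simp_all
  then have "f (K a) = c1" "f (K b) = c2"
    using f[of \<one> \<zero>] f[of \<zero> \<one>] c E.smult_l_null by simp_all
  then have "a \<odot>\<^bsub>E\<^esub> g (K \<one>) = c1" "b \<odot>\<^bsub>E\<^esub> g (K \<one>) = c2" using gK ab_carrier g(2) ab_m by auto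
  moreover have "g (K \<one>) \<in> carrier E" using g(1) by (auto simp: lin_maps_def B)
  ultimately show "\<exists>e\<in>carrier E. a \<odot>\<^bsub>E\<^esub> e = c1 \<and> b \<odot>\<^bsub>E\<^esub> e = c2" by blast
qed

text \<open>Dimension shifting along \<open>ker d \<rightarrow> E \<rightarrow> d E\<close>. It works because the syzygy of the residue field is \<open>m\<close>, a
  direct sum of two copies of the residue field.\<close>

lemma lifts_kernel:
  assumes E: "module R E" and F: "module R F" and d: "d \<in> lin_maps R E F"
    and lE: "lifts E (carrier E)" and lF: "lifts F (d ` carrier E)"
  shows "lifts E (a_kernel E F d)"
  unfolding lifts_def
proof (intro ballI impI)
  interpret E: module R E by (rule E)
  interpret F: module R F by (rule F)
  have dc: "x \<in> carrier E \<Longrightarrow> d x \<in> carrier F" and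
    dadd: "x \<in> carrier E \<Longrightarrow> y \<in> carrier E \<Longrightarrow> d (x \<oplus>\<^bsub>E\<^esub> y) = d x \<oplus>\<^bsub>F\<^esub> d y" and
    dsm: "r \<in> carrier R \<Longrightarrow> x \<in> carrier E \<Longrightarrow> d (r \<odot>\<^bsub>E\<^esub> x) = r \<odot>\<^bsub>F\<^esub> d x" for x y r
    using d by (auto simp: lin_maps_def)
  have d0: "d \<zero>\<^bsub>E\<^esub> = \<zero>\<^bsub>F\<^esub>" using dsm[of \<zero> "\<zero>\<^bsub>E\<^esub>"] dc[of "\<zero>\<^bsub>E\<^esub>"] by (simp add: F.smult_l_null)
  fix c1 c2 assume c: "c1 \<in> a_kernel E F d" "c2 \<in> a_kernel E F d"
    and kill: "\<forall>x\<in>m. x \<odot>\<^bsub>E\<^esub> c1 = \<zero>\<^bsub>E\<^esub> \<and> x \<odot>\<^bsub>E\<^esub> c2 = \<zero>\<^bsub>E\<^esub>"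
  have cE: "c1 \<in> carrier E" "c2 \<in> carrier E" and dcz: "d c1 = \<zero>\<^bsub>F\<^esub>" "d c2 = \<zero>\<^bsub>F\<^esub>"
    using c by (auto simp: a_kernel_def')
  obtain e where e: "e \<in> carrier E" "a \<odot>\<^bsub>E\<^esub> e = c1" "b \<odot>\<^bsub>E\<^esub> e = c2"
    using lE cE kill unfolding lifts_def by blast
  have killde: "x \<odot>\<^bsub>F\<^esub> d e = \<zero>\<^bsub>F\<^esub>" if x: "x \<in> m" for x
  proof -
    obtain r s where r: "r \<in> carrier R" "s \<in> carrier R" "x = r \<otimes> a \<oplus> s \<otimes> b" using x by (rule m_repr)
    have "x \<odot>\<^bsub>E\<^esub> e = r \<odot>\<^bsub>E\<^esub> c1 \<oplus>\<^bsub>E\<^esub> s \<odot>\<^bsub>E\<^esub> c2"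
      unfolding r(3) using r(1,2) e ab_carrier by (simp add: E.smult_l_distr E.smult_assoc1)
    then have "d (x \<odot>\<^bsub>E\<^esub> e) = \<zero>\<^bsub>F\<^esub>" using r cE by (simp add: dadd dsm dcz F.smult_r_null)
    then show ?thesis using dsm[of x e] e(1) x mD(1) by simp
  qed
  have "d e \<in> d ` carrier E" "\<zero>\<^bsub>F\<^esub> \<in> d ` carrier E" using e(1) d0 by (auto intro: rev_image_eqI)
  moreover have "\<forall>x\<in>m. x \<odot>\<^bsub>F\<^esub> d e = \<zero>\<^bsub>F\<^esub> \<and> x \<odot>\<^bsub>F\<^esub> \<zero>\<^bsub>F\<^esub> = \<zero>\<^bsub>F\<^esub>"
    using killde mD(1) F.smult_r_null by simp
  ultimately obtain w where w: "w \<in> carrier E" "a \<odot>\<^bsub>F\<^esub> d w = d e"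
    using lF unfolding lifts_def by blast
  \<comment> \<open>As \<open>m\<^sup>2 = 0\<close>, the lift \<open>a w\<close> of \<open>d e\<close> lies in the socle.\<close>
  define v where "v = a \<odot>\<^bsub>E\<^esub> w"
  have v: "v \<in> carrier E" "d v = d e" using w dsm ab_carrier by (auto simp: v_def)
  have kv: "x \<odot>\<^bsub>E\<^esub> v = \<zero>\<^bsub>E\<^esub>" if "x \<in> m" for x
  proof -
    have "x \<odot>\<^bsub>E\<^esub> v = (x \<otimes> a) \<odot>\<^bsub>E\<^esub> w" using that mD(1) w ab_carrier by (simp add: v_def E.smult_assoc1)
    then show ?thesis using m_mult[OF that ab_m(1)] w by (simp add: E.smult_l_null)
  qed
  define n where "n = (\<ominus> \<one>) \<odot>\<^bsub>E\<^esub> v"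
  have n: "n \<in> carrier E" using v by (simp add: n_def)
  have kn: "x \<odot>\<^bsub>E\<^esub> n = \<zero>\<^bsub>E\<^esub>" if x: "x \<in> m" for x
  proof -
    have "x \<odot>\<^bsub>E\<^esub> n = (x \<otimes> (\<ominus> \<one>)) \<odot>\<^bsub>E\<^esub> v" using x mD(1) v by (simp add: n_def E.smult_assoc1)
    also have "x \<otimes> (\<ominus> \<one>) \<in> m" using mD(5)[OF x, of "\<ominus> \<one>"] by simp
    then have "(x \<otimes> (\<ominus> \<one>)) \<odot>\<^bsub>E\<^esub> v = \<zero>\<^bsub>E\<^esub>" by (rule kv)
    finally show ?thesis .
  qed
  have "d (e \<oplus>\<^bsub>E\<^esub> n) = d e \<oplus>\<^bsub>F\<^esub> (\<ominus> \<one>) \<odot>\<^bsub>F\<^esub> d e" using e(1) n v by (simp add: dadd n_def dsm)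
  also have "\<dots> = (\<one> \<oplus> \<ominus> \<one>) \<odot>\<^bsub>F\<^esub> d e" using dc[OF e(1)] by (simp add: F.smult_l_distr del: minus_closed)
  also have "\<dots> = \<zero>\<^bsub>F\<^esub>" using dc[OF e(1)] by (simp add: r_neg F.smult_l_null)
  finally have "e \<oplus>\<^bsub>E\<^esub> n \<in> a_kernel E F d" using e(1) n by (simp add: a_kernel_def')
  moreover have "a \<odot>\<^bsub>E\<^esub> (e \<oplus>\<^bsub>E\<^esub> n) = c1" "b \<odot>\<^bsub>E\<^esub> (e \<oplus>\<^bsub>E\<^esub> n) = c2"
    using e n kn ab_m ab_carrier cE by (simp_all add: E.smult_r_distr)
  ultimately show "\<exists>c\<in>a_kernel E F d. a \<odot>\<^bsub>E\<^esub> c = c1 \<and> b \<odot>\<^bsub>E\<^esub> c = c2" by blast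
qed

theorem not_gorenstein: "\<not> gorenstein R"
proof
  assume "gorenstein R"
  then have fin: "inj_dim R (self_mod R) < \<infinity>" by (simp add: gorenstein_def)
  have "\<exists>n. \<exists>(E :: nat \<Rightarrow> ('a, ('a + 'a) list \<Rightarrow> 'a) module) d \<eta>. coresolution R (self_mod R) E d \<eta> \<and>
      (\<forall>i\<le>n. injective R (E i)) \<and> (\<forall>i>n. trivial_mod (E i))"
  proof (rule ccontr)
    assume "\<not> ?thesis"
    then have "inj_dim R (self_mod R) = Inf {}" unfolding inj_dim_def by (intro arg_cong[where f = Inf]) blast
    then show False using fin by (simp add: top_enat_def)
  qed
  then obtain n and E :: "nat \<Rightarrow> ('a, ('a + 'a) list \<Rightarrow> 'a) module" and d \<eta> where
    co: "coresolution R (self_mod R) E d \<eta>" and inj: "\<And>i. i \<le> n \<Longrightarrow> injective R (E i)"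
    and triv: "\<And>i. i > n \<Longrightarrow> trivial_mod (E i)" by blast
  have Em: "module R (E i)" for i using co by (simp add: coresolution_def)
  have d: "d i \<in> lin_maps R (E i) (E (Suc i))" for i using co by (simp add: coresolution_def)
  have ex: "a_kernel (E (Suc i)) (E (Suc (Suc i))) (d (Suc i)) = d i ` carrier (E i)" for i
    using co by (simp add: coresolution_def)
  have triv_lifts: "lifts (E i) C" if "i > n" "C \<subseteq> carrier (E i)" for i C
  proof -
    have "C \<subseteq> {\<zero>\<^bsub>E i\<^esub>}" using triv[OF that(1)] that(2) by (simp add: trivial_mod_def)
    moreover have "a \<odot>\<^bsub>E i\<^esub> \<zero>\<^bsub>E i\<^esub> = \<zero>\<^bsub>E i\<^esub>" "b \<odot>\<^bsub>E i\<^esub> \<zero>\<^bsub>E i\<^esub> = \<zero>\<^bsub>E i\<^esub>"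
      using module.smult_r_null[OF Em] ab_carrier by auto
    ultimately show ?thesis unfolding lifts_def by blast
  qed
  have kc: "a_kernel (E i) (E (Suc i)) (d i) \<subseteq> carrier (E i)" for i by (auto simp: a_kernel_def')
  have "lifts (E i) (a_kernel (E i) (E (Suc i)) (d i))" if "i \<le> Suc n" for i
    using that
  proof (induction rule: inc_induct)
    case base
    then show ?case by (rule triv_lifts[OF _ kc]) simp
  next
    case (step i)
    then show ?case using lifts_kernel[OF Em Em d injective_lifts[OF inj]] ex by simp
  qed
  from this[of 0] have l0: "lifts (E 0) (\<eta> ` carrier R)" using co by (simp add: coresolution_def self_mod_def mk_mod_def)
  have \<eta>: "\<eta> x \<in> carrier (E 0)" "\<eta> (r \<otimes> x) = r \<odot>\<^bsub>E 0\<^esub> \<eta> x" if "r \<in> carrier R" "x \<in> carrier R" for r x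
    using co that by (auto simp: coresolution_def lin_maps_def self_mod_def mk_mod_def)
  have \<eta>_inj: "inj_on \<eta> (carrier R)" using co by (simp add: coresolution_def self_mod_def mk_mod_def)
  have \<eta>0: "\<eta> \<zero> = \<zero>\<^bsub>E 0\<^esub>"
    using \<eta>(2)[of \<zero> \<zero>] \<eta>(1)[of \<zero> \<zero>] module.smult_l_null[OF Em[of 0]] by simp
  have "\<forall>x\<in>m. x \<odot>\<^bsub>E 0\<^esub> \<eta> a = \<zero>\<^bsub>E 0\<^esub> \<and> x \<odot>\<^bsub>E 0\<^esub> \<eta> \<zero> = \<zero>\<^bsub>E 0\<^esub>"
    using \<eta>(2)[OF mD(1) ab_carrier(1)] \<eta>(2)[OF mD(1) zero_closed] m_mult[OF _ ab_m(1)] mD(1) \<eta>0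
    by (metis r_null)
  then obtain r where r: "r \<in> carrier R" "a \<odot>\<^bsub>E 0\<^esub> \<eta> r = \<eta> a" "b \<odot>\<^bsub>E 0\<^esub> \<eta> r = \<eta> \<zero>"
    using l0 ab_carrier zero_closed unfolding lifts_def by blast
  have "\<eta> (a \<otimes> r) = \<eta> a" "\<eta> (b \<otimes> r) = \<eta> \<zero>" using \<eta>(2) r ab_carrier by simp_all
  then have ar: "a \<otimes> r = a" and br: "b \<otimes> r = \<zero>"
    using \<eta>_inj r(1) ab_carrier by (auto dest: inj_onD)
  have "\<zero> \<otimes> a \<oplus> r \<otimes> b = \<zero>" using br r(1) ab_carrier by (simp add: m_comm)
  then have "r \<in> m" using ab_indep[of \<zero> r] r(1) by simp
  then have "a = \<zero>" using ar m_mult[OF ab_m(1)] by simp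
  then have "\<one> \<otimes> a \<oplus> \<zero> \<otimes> b = \<zero>" using ab_carrier by simp
  then show False using ab_indep[of \<one> \<zero>] one_notin by simp
qed

end

section \<open>Failure of the complete intersection property\<close>

lemma (in noeth) proper_ideal_in_maximal:
  assumes I: "ideal I R" "\<one> \<notin> I"
  shows "\<exists>J. maximalideal J R \<and> I \<subseteq> J"
proof -
  let ?\<C> = "{J. ideal J R \<and> I \<subseteq> J \<and> \<one> \<notin> J}"
  have "\<exists>J\<in>?\<C>. \<forall>K\<in>?\<C>. J \<subseteq> K \<longrightarrow> K = J"
    by (rule maximal_ideal_exists) (use I in auto)
  then obtain J where J: "J \<in> ?\<C>" and max: "\<forall>K\<in>?\<C>. J \<subseteq> K \<longrightarrow> K = J" by (elim bexE)
  have "maximalideal J R"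
  proof (rule maximalidealI)
    show "ideal J R" "carrier R \<noteq> J" using J by auto
    fix K assume K: "ideal K R" "J \<subseteq> K" "K \<subseteq> carrier R"
    show "K = J \<or> K = carrier R"
    proof (cases "\<one> \<in> K")
      case True
      then have "carrier R \<subseteq> K" using ideal_lmult[OF K(1)] by force
      then show ?thesis using K by auto
    next
      case False
      then have "K \<in> ?\<C>" using K J by auto
      then show ?thesis using max K by auto
    qed
  qed
  then show ?thesis using J by auto
qed

context short_local
begin

lemma ideal_pow_m: "ideal_pow R m 0 = carrier R" "ideal_pow R m (Suc 0) = m" "ideal_pow R m (Suc (Suc n)) = {\<zero>}"
proof -
  have sub: "m \<cdot> carrier R \<subseteq> m" using ideal_prod_inter[OF m_ideal oneideal] by simp
  have "x \<in> m \<cdot> carrier R" if "x \<in> m" for x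
    using ideal_prod.prod[OF that one_closed, of R] mD(1)[OF that] by simp
  then show 1: "ideal_pow R m (Suc 0) = m" using sub by auto
  have "ideal_pow R m (Suc (Suc n)) \<subseteq> {\<zero>} \<and> ideal (ideal_pow R m (Suc (Suc n))) R" for n
  proof (induction n)
    case 0
    have "x = \<zero>" if "x \<in> m \<cdot> m" for x
      using that by (induction rule: ideal_prod.induct) (auto simp: m_mult)
    then show ?case using 1 ideal_prod_is_ideal[OF m_ideal m_ideal] by auto
  next
    case (Suc n)
    have "x = \<zero>" if "x \<in> m \<cdot> ideal_pow R m (Suc (Suc n))" for x
      using that by (induction rule: ideal_prod.induct) (use Suc mD(1) in auto)
    moreover have "ideal (m \<cdot> ideal_pow R m (Suc (Suc n))) R"
      using Suc by (intro ideal_prod_is_ideal[OF m_ideal]) blast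
    ultimately show ?case by (metis ideal_pow.simps(2) singletonI subsetI)
  qed
  then show "ideal_pow R m (Suc (Suc n)) = {\<zero>}" using ideal_zero by blast
qed simp

lemma pow_ideal: "ideal (ideal_pow R m n) R"
  by (cases n; cases "n - 1") (auto simp only: ideal_pow_m oneideal m_ideal zeroideal diff_Suc_1 nat.distinct)

lemma pow_dec: "ideal_pow R m (Suc n) \<subseteq> ideal_pow R m n"
proof (cases n)
  case 0
  then show ?thesis using mD(1) by (auto simp only: ideal_pow_m)
next
  case (Suc k)
  then show ?thesis using ideal_zero[OF pow_ideal] by (auto simp only: ideal_pow_m)
qed

text \<open>As \<open>m\<close> is nilpotent, \<open>R\<close> is its own completion.\<close>

lemma completion_iso: "(\<lambda>r n. ideal_pow R m n +> r) \<in> ring_iso R (completion R)"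
proof -
  let ?p = "ideal_pow R m" and ?h = "\<lambda>r n. ideal_pow R m n +> r"
  let ?A = "\<lambda>n. R Quot ?p n"
  have cmp: "carrier (completion R) = {x. \<forall>n. x n \<in> carrier (?A n) \<and> x (Suc n) \<subseteq> x n}"
    "mult (completion R) = (\<lambda>x y n. x n \<otimes>\<^bsub>?A n\<^esub> y n)" "one (completion R) = (\<lambda>n. \<one>\<^bsub>?A n\<^esub>)"
    "add (completion R) = (\<lambda>x y n. x n \<oplus>\<^bsub>?A n\<^esub> y n)"
    by (simp_all add: completion_def Let_def max_ideal_eq)
  have hom: "(+>) (?p n) \<in> ring_hom R (?A n)" for n by (rule ideal.rcos_ring_hom[OF pow_ideal])
  have car: "?h r \<in> carrier (completion R)" if "r \<in> carrier R" for r
  proof -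
    have "?p n +> r \<in> carrier (?A n)" for n using ring_hom_closed[OF hom that] .
    moreover have "?p (Suc n) +> r \<subseteq> ?p n +> r" for n using pow_dec[of n] by (auto simp: a_r_coset_def')
    ultimately show ?thesis by (simp add: cmp)
  qed
  have two: "?p (Suc (Suc n)) +> r = {r}" if "r \<in> carrier R" for n r
    using that by (simp only: ideal_pow_m) (simp add: a_r_coset_def')
  have "?h \<in> ring_hom R (completion R)"
    using ring_hom_mult[OF hom] ring_hom_add[OF hom] ring_hom_one[OF hom] car
    by (intro ring_hom_memI) (auto simp: cmp)
  moreover have "inj_on ?h (carrier R)"
  proof (rule inj_onI)
    fix r s assume rs: "r \<in> carrier R" "s \<in> carrier R" "?h r = ?h s"
    from fun_cong[OF rs(3), of "Suc (Suc 0)"] show "r = s" using two rs(1,2) by (simp del: ideal_pow.simps)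
  qed
  moreover have "?h ` carrier R = carrier (completion R)"
  proof
    show "?h ` carrier R \<subseteq> carrier (completion R)" using car by auto
    show "carrier (completion R) \<subseteq> ?h ` carrier R"
    proof
      fix x assume x: "x \<in> carrier (completion R)"
      have co: "\<exists>r\<in>carrier R. x n = ?p n +> r" for n
        using x by (auto simp: cmp FactRing_def A_RCOSETS_def')
      have dec: "x (Suc n) \<subseteq> x n" for n using x by (simp add: cmp)
      obtain r where r: "r \<in> carrier R" "x (Suc (Suc 0)) = {r}" using co[of "Suc (Suc 0)"] two by (auto simp del: ideal_pow.simps)
      have mem: "r \<in> x n" for n
      proof (cases "n \<ge> 2")
        case True
        then show ?thesis
        proof (induction rule: dec_induct)
          case base
          then show ?case using r by (simp add: numeral_2_eq_2)
        next
          case (step n)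
          then obtain k where "n = Suc (Suc k)" by (metis add_2_eq_Suc le_Suc_ex)
          then obtain s where "x (Suc n) = {s}" using co[of "Suc n"] two by (auto simp del: ideal_pow.simps)
          moreover obtain t where "x n = {t}" using co[of n] two \<open>n = _\<close> by (auto simp del: ideal_pow.simps)
          ultimately show ?case using dec[of n] step by auto
        qed
      next
        case False
        then have "n = 0 \<or> n = 1" by auto
        then show ?thesis using r dec[of 0] dec[of 1] by (auto simp: One_nat_def)
      qed
      have "x n = ?p n +> r" for n
      proof -
        obtain s where s: "s \<in> carrier R" "x n = ?p n +> s" using co by blast
        interpret pn: ideal "?p n" R by (rule pow_ideal)
        have "r \<in> ?p n +> s" using mem[of n] s by simp
        then show ?thesis using pn.a_repr_independence' s by simp
      qed
      then have "x = ?h r" by (rule ext)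
      then show "x \<in> ?h ` carrier R" using r(1) by (rule image_eqI)
    qed
  qed
  ultimately show ?thesis by (simp add: ring_iso_def bij_betw_def)
qed

theorem not_complete_intersection: "\<not> complete_intersection R"
proof
  assume "complete_intersection R"
  then obtain Q :: "(nat \<Rightarrow> 'a) ring" and xs where Q: "regular_local_ring Q" "regular_seq Q xs"
    "completion R \<simeq> Q Quot (Idl\<^bsub>Q\<^esub> (set xs))" unfolding complete_intersection_def by blast
  define I where "I = Idl\<^bsub>Q\<^esub> (set xs)"
  have Ql: "local_ring Q" using Q(1) by (simp add: regular_local_ring_def)
  interpret Q: noeth Q using Ql by (simp add: local_ring_def noeth_def)
  have xs: "set xs \<subseteq> carrier Q" using Q(2) by (simp add: regular_seq_def)
  have Ii: "ideal I Q" unfolding I_def by (rule Q.genideal_ideal[OF xs])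
  note ID = Q.ideal_memD[OF Ii]
  obtain h where h: "h \<in> ring_iso (completion R) (Q Quot I)" using Q(3) by (auto simp: is_ring_iso_def I_def)
  obtain \<phi> where \<phi>: "\<phi> \<in> ring_iso R (Q Quot I)" using ring_iso_set_trans[OF completion_iso h] by blast
  have \<psi>: "inv_into (carrier R) \<phi> \<in> ring_iso (Q Quot I) R" by (rule ring_iso_set_sym[OF ring_axioms \<phi>])
  \<comment> \<open>The surjection \<open>g\<close> from \<open>Q\<close> to \<open>R\<close> with kernel \<open>I\<close>.\<close>
  define g where "g = inv_into (carrier R) \<phi> \<circ> (+>\<^bsub>Q\<^esub>) I"
  have hom: "g \<in> ring_hom Q R"
    unfolding g_def using ideal.rcos_ring_hom[OF Ii] \<psi> by (intro ring_hom_trans) (auto simp: ring_iso_def)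
  interpret g: ring_hom_ring Q R g
    by (rule ring_hom_ringI2[OF Q.ring_axioms ring_axioms hom])
  have bij: "bij_betw (inv_into (carrier R) \<phi>) (carrier (Q Quot I)) (carrier R)" using \<psi> by (simp add: ring_iso_def)
  have surj: "\<exists>q\<in>carrier Q. g q = r" if "r \<in> carrier R" for r
  proof -
    have "r \<in> inv_into (carrier R) \<phi> ` carrier (Q Quot I)" using bij that by (simp add: bij_betw_def)
    then show ?thesis by (auto simp: g_def FactRing_def A_RCOSETS_def')
  qed
  have ker: "g q = \<zero> \<longleftrightarrow> q \<in> I" if q: "q \<in> carrier Q" for q
  proof -
    have z: "I +>\<^bsub>Q\<^esub> \<zero>\<^bsub>Q\<^esub> = I" using ID(1) Q.a_coset_add_zero by (simp add: subsetI)
    have "g q = \<zero> \<longleftrightarrow> g q = g \<zero>\<^bsub>Q\<^esub>" by simp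
    also have "\<dots> \<longleftrightarrow> I +>\<^bsub>Q\<^esub> q = I +>\<^bsub>Q\<^esub> \<zero>\<^bsub>Q\<^esub>"
    proof -
      have "I +>\<^bsub>Q\<^esub> p \<in> carrier (Q Quot I)" if "p \<in> carrier Q" for p
        using that by (auto simp: FactRing_def A_RCOSETS_def')
      then show ?thesis unfolding g_def comp_def using inj_on_eq_iff[OF bij_betw_imp_inj_on[OF bij]] q by blast
    qed
    also have "\<dots> \<longleftrightarrow> q \<in> I"
      unfolding z using q ideal.rcos_const_imp_mem[OF Ii q] Q.a_coset_join2[OF q] ideal.axioms(1)[OF Ii]
        additive_subgroup.a_subgroup by blast
    finally show ?thesis .
  qed
  define M where "M = {q \<in> carrier Q. g q \<in> m}"
  have Mi: "ideal M Q"
    by (rule Q.ideal_intro) (use mD in \<open>auto simp: M_def\<close>)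
  have IM: "I \<subseteq> M" using ker[THEN iffD2] ID(1) mD(2) by (auto simp: M_def)
  have Mmax: "maximalideal M Q"
  proof (rule maximalidealI[OF Mi])
    have "\<one>\<^bsub>Q\<^esub> \<notin> M" using one_notin by (simp add: M_def)
    then show "carrier Q \<noteq> M" by auto
    fix J assume J: "ideal J Q" "M \<subseteq> J" "J \<subseteq> carrier Q"
    note JD = Q.ideal_memD[OF J(1)]
    show "J = M \<or> J = carrier Q"
    proof (cases "J = M")
      case False
      then obtain p where p: "p \<in> J" "p \<notin> M" using J by auto
      have pc: "p \<in> carrier Q" using p J by auto
      then have "g p \<notin> m" using p by (simp add: M_def)
      then obtain y where y: "y \<in> carrier R" "g p \<otimes> y = \<one>" using unit[of "g p"] pc by auto
      obtain q where q: "q \<in> carrier Q" "g q = y" using surj y by blast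
      have "g (\<one>\<^bsub>Q\<^esub> \<ominus>\<^bsub>Q\<^esub> p \<otimes>\<^bsub>Q\<^esub> q) = \<zero>" using pc q y by (simp add: a_minus_def r_neg)
      moreover have "\<one>\<^bsub>Q\<^esub> \<ominus>\<^bsub>Q\<^esub> p \<otimes>\<^bsub>Q\<^esub> q \<in> carrier Q" using pc q(1) by simp
      ultimately have "\<one>\<^bsub>Q\<^esub> \<ominus>\<^bsub>Q\<^esub> p \<otimes>\<^bsub>Q\<^esub> q \<in> I" using ker by simp
      then have i: "\<one>\<^bsub>Q\<^esub> \<ominus>\<^bsub>Q\<^esub> p \<otimes>\<^bsub>Q\<^esub> q \<in> J" using IM J(2) by blast
      have "\<one>\<^bsub>Q\<^esub> = (\<one>\<^bsub>Q\<^esub> \<ominus>\<^bsub>Q\<^esub> p \<otimes>\<^bsub>Q\<^esub> q) \<oplus>\<^bsub>Q\<^esub> p \<otimes>\<^bsub>Q\<^esub> q" using pc q by algebra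
      then have "\<one>\<^bsub>Q\<^esub> \<in> J" using JD(3)[OF i JD(5)[OF p(1) q(1)]] by simp
      then have "x \<in> J" if "x \<in> carrier Q" for x using JD(4)[of "\<one>\<^bsub>Q\<^esub>" x] that by simp
      then show ?thesis using J(3) by blast
    qed simp
  qed
  have Muniq: "J = M" if "maximalideal J Q" for J using Ql Mmax that unfolding local_ring_def by blast
  have Mmi: "max_ideal Q = M" unfolding max_ideal_def using Mmax by (rule the_equality) (rule Muniq)
  have Mp: "primeideal M Q" by (rule Q.maximalideal_prime[OF Mmax])
  have big: "P \<subseteq> M" if "primeideal P Q" for P
    using Q.proper_ideal_in_maximal[OF Q.prime_ideal[OF that] Q.prime_one[OF that]] Muniq by blast
  obtain A where A: "finite A" "A \<subseteq> carrier Q" "M = Idl\<^bsub>Q\<^esub> A" "enat (card A) = krull_dim Q"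
    using Q(1) Mmi by (auto simp: regular_local_ring_def)
  obtain as where as: "set as = A" "length as = card A"
    using finite_distinct_list[OF A(1)] distinct_card by metis
  obtain a' b' where ab': "a' \<in> carrier Q" "g a' = a" "b' \<in> carrier Q" "g b' = b" using surj ab_carrier by meson
  show False
  proof (rule Q.square_zero_quotient_generators[OF Mp, of "card A" as xs I a' b'])
    fix ys assume "set ys \<subseteq> M" "\<And>P. primeideal P Q \<Longrightarrow> set ys \<subseteq> P \<Longrightarrow> P = M"
    then show "card A \<le> length ys" using Q.dim_le_generators[OF Mp big A(4)[symmetric]] by blast
  next
    show "P \<subseteq> M" if "primeideal P Q" for P using that by (rule big)
    show "set as \<subseteq> carrier Q" "length as = card A" using as A by auto
    show "M = Q.gen {\<zero>\<^bsub>Q\<^esub>} as" using Q.gen_eq_Idl[of as] as A by simp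
    show "set xs \<subseteq> carrier Q" by (rule xs)
    show "I = Q.gen {\<zero>\<^bsub>Q\<^esub>} xs" using Q.gen_eq_Idl[OF xs] by (simp add: I_def)
    have "set xs \<subseteq> M" using Q.genideal_self[OF xs] IM by (auto simp: I_def)
    then show "length xs \<le> card A" using Q.regular_seq_length[OF Q(2) Mp] A(4)[symmetric] by simp
    show "I \<subseteq> M" by (rule IM)
    show "p \<otimes>\<^bsub>Q\<^esub> q \<in> I" if "p \<in> M" "q \<in> M" for p q
      using that ker[of "p \<otimes>\<^bsub>Q\<^esub> q"] m_mult by (auto simp: M_def)
    show "a' \<in> M" "b' \<in> M" using ab' ab_m by (auto simp: M_def)
    show "M \<subseteq> Q.gen I [a', b']"
    proof
      fix p assume p: "p \<in> M"
      then have pc: "p \<in> carrier Q" and "g p \<in> m" by (auto simp: M_def)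
      then obtain r s where r: "r \<in> carrier R" "s \<in> carrier R" "g p = r \<otimes> a \<oplus> s \<otimes> b" by (auto elim: m_repr)
      obtain u v where u: "u \<in> carrier Q" "g u = r" "v \<in> carrier Q" "g v = s" using surj r by meson
      define i where "i = p \<ominus>\<^bsub>Q\<^esub> (u \<otimes>\<^bsub>Q\<^esub> a' \<oplus>\<^bsub>Q\<^esub> v \<otimes>\<^bsub>Q\<^esub> b')"
      have ic: "i \<in> carrier Q" using pc u ab' by (simp add: i_def)
      have "g i = \<zero>" unfolding i_def using pc u ab' r ab_carrier by (simp add: a_minus_def r_neg)
      then have "i \<in> I" using ker ic by simp
      moreover have "p = u \<otimes>\<^bsub>Q\<^esub> a' \<oplus>\<^bsub>Q\<^esub> (v \<otimes>\<^bsub>Q\<^esub> b' \<oplus>\<^bsub>Q\<^esub> i)"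
        unfolding i_def using pc u(1,3) ab'(1,3) by algebra
      ultimately show "p \<in> Q.gen I [a', b']" using u(1,3) by (auto simp: Q.comb.simps)
    qed
    show "u \<in> M \<and> v \<in> M"
      if "u \<in> carrier Q" "v \<in> carrier Q" "u \<otimes>\<^bsub>Q\<^esub> a' \<oplus>\<^bsub>Q\<^esub> v \<otimes>\<^bsub>Q\<^esub> b' \<in> I" for u v
    proof -
      have "g (u \<otimes>\<^bsub>Q\<^esub> a' \<oplus>\<^bsub>Q\<^esub> v \<otimes>\<^bsub>Q\<^esub> b') = \<zero>"
        using ker[THEN iffD2, OF ID(1)[OF that(3)] that(3)] .
      then have "g u \<otimes> a \<oplus> g v \<otimes> b = \<zero>" using that ab' by simp
      then show ?thesis using ab_indep[of "g u" "g v"] that by (simp add: M_def)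
    qed
  qed
qed

end

section \<open>Homological dimensions of the zero module\<close>

context cring
begin

lemma trivial_moduleI:
  assumes "carrier N = {\<zero>\<^bsub>N\<^esub>}" "\<zero>\<^bsub>N\<^esub> \<oplus>\<^bsub>N\<^esub> \<zero>\<^bsub>N\<^esub> = \<zero>\<^bsub>N\<^esub>"
    "\<And>r. r \<in> carrier R \<Longrightarrow> r \<odot>\<^bsub>N\<^esub> \<zero>\<^bsub>N\<^esub> = \<zero>\<^bsub>N\<^esub>"
  shows "module R N"
  by (intro moduleI is_cring abelian_groupI) (auto simp: assms)

lemma lin_maps_closed: "f \<in> lin_maps R M N \<Longrightarrow> x \<in> carrier M \<Longrightarrow> f x \<in> carrier N"
  and lin_maps_add: "f \<in> lin_maps R M N \<Longrightarrow> x \<in> carrier M \<Longrightarrow> y \<in> carrier M \<Longrightarrow>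
    f (x \<oplus>\<^bsub>M\<^esub> y) = f x \<oplus>\<^bsub>N\<^esub> f y"
  and lin_maps_smult: "f \<in> lin_maps R M N \<Longrightarrow> r \<in> carrier R \<Longrightarrow> x \<in> carrier M \<Longrightarrow>
    f (r \<odot>\<^bsub>M\<^esub> x) = r \<odot>\<^bsub>N\<^esub> f x"
  unfolding lin_maps_def by blast+

lemma lin_maps_zero:
  assumes "module R M" "module R N" "f \<in> lin_maps R M N"
  shows "f \<zero>\<^bsub>M\<^esub> = \<zero>\<^bsub>N\<^esub>"
proof -
  interpret M: module R M by fact
  interpret N: module R N by fact
  show ?thesis
    using lin_maps_smult[OF assms(3) zero_closed M.zero_closed] lin_maps_closed[OF assms(3) M.zero_closed]
    by (simp add: M.smult_l_null N.smult_l_null)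
qed

lemma lin_maps_comp_restrict:
  assumes "module R M" "f \<in> lin_maps R M N" "g \<in> lin_maps R N P"
  shows "(\<lambda>x\<in>carrier M. g (f x)) \<in> lin_maps R M P"
proof -
  interpret M: module R M by fact
  show ?thesis unfolding lin_maps_def
    by (auto simp: lin_maps_closed[OF assms(2)] lin_maps_closed[OF assms(3)] lin_maps_add[OF assms(2)]
        lin_maps_add[OF assms(3)] lin_maps_smult[OF assms(2)] lin_maps_smult[OF assms(3)])
qed

lemma (in module) add_neg_one: "x \<in> carrier M \<Longrightarrow> x \<oplus>\<^bsub>M\<^esub> (\<ominus> \<one>) \<odot>\<^bsub>M\<^esub> x = \<zero>\<^bsub>M\<^esub>"
  using smult_l_distr[of \<one> "\<ominus> \<one>" x] by (simp add: R.r_neg smult_l_null)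

lemma free_mod_simps:
  "carrier (free_mod R S) = {f. (\<forall>i. f i \<in> carrier R) \<and> (\<forall>i. i \<notin> S \<longrightarrow> f i = \<zero>) \<and> finite {i. f i \<noteq> \<zero>}}"
  "zero (free_mod R S) = (\<lambda>_. \<zero>)"
  "x \<oplus>\<^bsub>free_mod R S\<^esub> y = (\<lambda>i. x i \<oplus> y i)"
  "r \<odot>\<^bsub>free_mod R S\<^esub> x = (\<lambda>i. r \<otimes> x i)"
  by (simp_all add: free_mod_def mk_mod_def)

lemma free_gen_carrier: "i \<in> S \<Longrightarrow> free_gen R i \<in> carrier (free_mod R S)"
proof -
  assume "i \<in> S"
  moreover have "{j. free_gen R i j \<noteq> \<zero>} \<subseteq> {i}" by (auto simp: free_gen_def)
  then have "finite {j. free_gen R i j \<noteq> \<zero>}" by (rule finite_subset) simp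
  ultimately show ?thesis by (auto simp: free_mod_simps free_gen_def)
qed

lemma free_mod_induct [consumes 1, case_names zero add gen]:
  assumes x: "x \<in> carrier (free_mod R S)"
    and zero: "P (\<lambda>_. \<zero>)"
    and add: "\<And>x y. x \<in> carrier (free_mod R S) \<Longrightarrow> y \<in> carrier (free_mod R S) \<Longrightarrow> P x \<Longrightarrow> P y \<Longrightarrow>
      P (x \<oplus>\<^bsub>free_mod R S\<^esub> y)"
    and gen: "\<And>r i. r \<in> carrier R \<Longrightarrow> i \<in> S \<Longrightarrow> P (r \<odot>\<^bsub>free_mod R S\<^esub> free_gen R i)"
  shows "P x"
proof -
  have "finite A \<Longrightarrow> x \<in> carrier (free_mod R S) \<Longrightarrow> {i. x i \<noteq> \<zero>} \<subseteq> A \<Longrightarrow> P x" for A x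
  proof (induction A arbitrary: x rule: finite_induct)
    case empty
    then have "x = (\<lambda>_. \<zero>)" by auto
    then show ?case using zero by simp
  next
    case (insert i A)
    show ?case
    proof (cases "x i = \<zero>")
      case True
      then have "{i. x i \<noteq> \<zero>} \<subseteq> A" using insert.prems(2) by blast
      then show ?thesis using insert.IH insert.prems(1) by blast
    next
      case False
      let ?F = "free_mod R S"
      have xi: "x i \<in> carrier R" and iS: "i \<in> S" using insert.prems(1) False by (auto simp: free_mod_simps)
      have "{j. (x(i := \<zero>)) j \<noteq> \<zero>} \<subseteq> {j. x j \<noteq> \<zero>}" by auto
      then have "finite {j. (x(i := \<zero>)) j \<noteq> \<zero>}"
        by (rule finite_subset) (use insert.prems(1) in \<open>simp add: free_mod_simps\<close>)
      then have y: "x(i := \<zero>) \<in> carrier ?F" using insert.prems(1) by (auto simp: free_mod_simps)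
      have "{j. (x(i := \<zero>)) j \<noteq> \<zero>} \<subseteq> A" using insert.prems(2) by auto
      then have Py: "P (x(i := \<zero>))" using insert.IH y by blast
      have "{j. (x i \<odot>\<^bsub>?F\<^esub> free_gen R i) j \<noteq> \<zero>} \<subseteq> {i}" using xi by (auto simp: free_mod_simps free_gen_def)
      then have "finite {j. (x i \<odot>\<^bsub>?F\<^esub> free_gen R i) j \<noteq> \<zero>}" by (rule finite_subset) simp
      then have z: "x i \<odot>\<^bsub>?F\<^esub> free_gen R i \<in> carrier ?F"
        using xi iS by (auto simp: free_mod_simps free_gen_def)
      have "x = x(i := \<zero>) \<oplus>\<^bsub>?F\<^esub> x i \<odot>\<^bsub>?F\<^esub> free_gen R i"
        using insert.prems(1) by (auto simp: free_mod_simps free_gen_def fun_eq_iff)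
      then show ?thesis using add[OF y z Py gen[OF xi iS]] by simp
    qed
  qed
  from this[of "{i. x i \<noteq> \<zero>}" x] show ?thesis using x by (auto simp: free_mod_simps)
qed

lemma free_mod_extend:
  assumes N: "module R N" and b: "\<And>i. i \<in> S \<Longrightarrow> b i \<in> carrier N"
  shows "\<exists>h\<in>lin_maps R (free_mod R S) N. \<forall>i\<in>S. h (free_gen R i) = b i"
proof -
  interpret N: module R N by (rule N)
  define h where "h x = (\<Oplus>\<^bsub>N\<^esub>i\<in>{i. x i \<noteq> \<zero>}. x i \<odot>\<^bsub>N\<^esub> b i)" for x
  have supp: "{i. x i \<noteq> \<zero>} \<subseteq> S" "finite {i. x i \<noteq> \<zero>}" "\<And>i. x i \<in> carrier R"
    if "x \<in> carrier (free_mod R S)" for x using that by (auto simp: free_mod_simps)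
  have h_eq: "h x = (\<Oplus>\<^bsub>N\<^esub>i\<in>A. x i \<odot>\<^bsub>N\<^esub> b i)"
    if x: "x \<in> carrier (free_mod R S)" and A: "finite A" "{i. x i \<noteq> \<zero>} \<subseteq> A" "A \<subseteq> S" for x A
    unfolding h_def
  proof (rule N.add.finprod_mono_neutral_cong_left[OF A(1,2)])
    show "x i \<odot>\<^bsub>N\<^esub> b i = \<zero>\<^bsub>N\<^esub>" if "i \<in> A - {i. x i \<noteq> \<zero>}" for i
      using that b A(3) by (auto simp: N.smult_l_null)
    show "(\<lambda>i. x i \<odot>\<^bsub>N\<^esub> b i) \<in> A \<rightarrow> carrier N" using supp(3)[OF x] b A(3) by auto
  qed simp
  have "h \<in> lin_maps R (free_mod R S) N"
    unfolding lin_maps_def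
  proof (intro CollectI conjI ballI Pi_I)
    show hx: "h x \<in> carrier N" if "x \<in> carrier (free_mod R S)" for x
      unfolding h_def using supp[OF that] b by (intro N.finsum_closed) auto
    fix x assume x: "x \<in> carrier (free_mod R S)"
    show "h (x \<oplus>\<^bsub>free_mod R S\<^esub> y) = h x \<oplus>\<^bsub>N\<^esub> h y" if y: "y \<in> carrier (free_mod R S)" for y
    proof -
      let ?A = "{i. x i \<noteq> \<zero>} \<union> {i. y i \<noteq> \<zero>}"
      have A: "finite ?A" "?A \<subseteq> S" using supp[OF x] supp[OF y] by auto
      have sub: "{i. (x \<oplus>\<^bsub>free_mod R S\<^esub> y) i \<noteq> \<zero>} \<subseteq> ?A" by (auto simp: free_mod_simps)
      then have "finite {i. (x \<oplus>\<^bsub>free_mod R S\<^esub> y) i \<noteq> \<zero>}" using A(1) by (rule finite_subset)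
      then have xy: "x \<oplus>\<^bsub>free_mod R S\<^esub> y \<in> carrier (free_mod R S)" using x y by (auto simp: free_mod_simps)
      have "h (x \<oplus>\<^bsub>free_mod R S\<^esub> y) = (\<Oplus>\<^bsub>N\<^esub>i\<in>?A. (x i \<oplus> y i) \<odot>\<^bsub>N\<^esub> b i)"
        using h_eq[OF xy A(1) sub A(2)] by (simp add: free_mod_simps)
      also have "\<dots> = (\<Oplus>\<^bsub>N\<^esub>i\<in>?A. x i \<odot>\<^bsub>N\<^esub> b i \<oplus>\<^bsub>N\<^esub> y i \<odot>\<^bsub>N\<^esub> b i)"
        using supp(3)[OF x] supp(3)[OF y] b A(2) by (intro N.add.finprod_cong') (auto simp: N.smult_l_distr)
      also have "\<dots> = (\<Oplus>\<^bsub>N\<^esub>i\<in>?A. x i \<odot>\<^bsub>N\<^esub> b i) \<oplus>\<^bsub>N\<^esub> (\<Oplus>\<^bsub>N\<^esub>i\<in>?A. y i \<odot>\<^bsub>N\<^esub> b i)"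
        using supp(3)[OF x] supp(3)[OF y] b A(2) by (intro N.finsum_addf) auto
      also have "\<dots> = h x \<oplus>\<^bsub>N\<^esub> h y"
        using h_eq[OF x A(1) _ A(2)] h_eq[OF y A(1) _ A(2)] by simp
      finally show ?thesis .
    qed
    show "h (r \<odot>\<^bsub>free_mod R S\<^esub> x) = r \<odot>\<^bsub>N\<^esub> h x" if r: "r \<in> carrier R" for r
    proof -
      let ?A = "{i. x i \<noteq> \<zero>}"
      have sub: "{i. (r \<odot>\<^bsub>free_mod R S\<^esub> x) i \<noteq> \<zero>} \<subseteq> ?A" using r by (auto simp: free_mod_simps)
      then have "finite {i. (r \<odot>\<^bsub>free_mod R S\<^esub> x) i \<noteq> \<zero>}" using supp(2)[OF x] by (rule finite_subset)
      then have rx: "r \<odot>\<^bsub>free_mod R S\<^esub> x \<in> carrier (free_mod R S)" using x r by (auto simp: free_mod_simps)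
      have "h (r \<odot>\<^bsub>free_mod R S\<^esub> x) = (\<Oplus>\<^bsub>N\<^esub>i\<in>?A. (r \<otimes> x i) \<odot>\<^bsub>N\<^esub> b i)"
        using h_eq[OF rx supp(2)[OF x] sub supp(1)[OF x]] by (simp add: free_mod_simps)
      also have "\<dots> = (\<Oplus>\<^bsub>N\<^esub>i\<in>?A. r \<odot>\<^bsub>N\<^esub> (x i \<odot>\<^bsub>N\<^esub> b i))"
        using supp[OF x] b r by (intro N.add.finprod_cong') (auto simp: N.smult_assoc1)
      also have "\<dots> = r \<odot>\<^bsub>N\<^esub> h x" unfolding h_def
        using supp[OF x] b r by (intro N.finsum_smult_ldistr[symmetric]) auto
      finally show ?thesis .
    qed
  qed
  moreover have "h (free_gen R i) = b i" if i: "i \<in> S" for i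
  proof -
    have "h (free_gen R i) = (\<Oplus>\<^bsub>N\<^esub>j\<in>{i}. free_gen R i j \<odot>\<^bsub>N\<^esub> b j)"
      using i by (intro h_eq free_gen_carrier) (auto simp: free_gen_def)
    also have "\<dots> = b i" using b[OF i] by (simp add: free_gen_def)
    finally show ?thesis .
  qed
  ultimately show ?thesis by blast
qed

text \<open>The contracting homotopy of an exact complex \<open>C \<rightarrow> B \<rightarrow> A\<close> with free \<open>B\<close> is extended by one step:
  for a basis element \<open>x\<close>, a preimage under \<open>d\<close> of the cycle \<open>x - s (e x)\<close> is chosen.\<close>

lemma splitting_step:
  fixes A :: "('a, 'm) module" and C :: "('a, 'n) module" and S :: "'i set"
  defines "B \<equiv> free_mod R S"
  assumes A: "module R A" and B: "module R B" and C: "module R C"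
    and e: "e \<in> lin_maps R B A" and d: "d \<in> lin_maps R C B" and ex: "a_kernel B A e = d ` carrier C"
    and s: "s \<in> lin_maps R A B" "\<And>x. x \<in> carrier B \<Longrightarrow> e (s (e x)) = e x"
  shows "\<exists>t\<in>lin_maps R B C. \<forall>y\<in>carrier C. d (t (d y)) = d y"
proof -
  interpret A: module R A by (rule A)
  interpret B: module R B by (rule B)
  interpret C: module R C by (rule C)
  note ec = lin_maps_closed[OF e] and eadd = lin_maps_add[OF e] and esm = lin_maps_smult[OF e]
  note dc = lin_maps_closed[OF d] and dadd = lin_maps_add[OF d] and dsm = lin_maps_smult[OF d]
  define p where "p x = s (e x)" for x
  have pc: "p x \<in> carrier B" if "x \<in> carrier B" for x
    unfolding p_def by (intro lin_maps_closed[OF s(1)] ec that)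
  have padd: "p (x \<oplus>\<^bsub>B\<^esub> y) = p x \<oplus>\<^bsub>B\<^esub> p y" if "x \<in> carrier B" "y \<in> carrier B" for x y
    unfolding p_def using eadd[OF that] lin_maps_add[OF s(1) ec ec] that by simp
  have psm: "p (r \<odot>\<^bsub>B\<^esub> x) = r \<odot>\<^bsub>B\<^esub> p x" if "x \<in> carrier B" "r \<in> carrier R" for x r
    unfolding p_def using esm[OF that(2,1)] lin_maps_smult[OF s(1) that(2) ec] that by simp
  have lift: "\<exists>u\<in>carrier C. d u \<oplus>\<^bsub>B\<^esub> p x = x" if x: "x \<in> carrier B" for x
  proof -
    define y where "y = x \<oplus>\<^bsub>B\<^esub> (\<ominus> \<one>) \<odot>\<^bsub>B\<^esub> p x"
    have yc: "y \<in> carrier B" using x pc by (simp add: y_def)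
    have "e y = e x \<oplus>\<^bsub>A\<^esub> (\<ominus> \<one>) \<odot>\<^bsub>A\<^esub> e (p x)"
      unfolding y_def using x pc[OF x] by (simp add: eadd esm)
    also have "\<dots> = \<zero>\<^bsub>A\<^esub>" using s(2)[OF x] A.add_neg_one[OF ec[OF x]] by (simp add: p_def)
    finally have "y \<in> a_kernel B A e" using yc by (simp add: a_kernel_def')
    then obtain u where u: "u \<in> carrier C" "d u = y" using ex by auto
    have "y \<oplus>\<^bsub>B\<^esub> p x = x \<oplus>\<^bsub>B\<^esub> (p x \<oplus>\<^bsub>B\<^esub> (\<ominus> \<one>) \<odot>\<^bsub>B\<^esub> p x)"
      unfolding y_def using x pc[OF x] by (simp add: B.a_ac)
    also have "\<dots> = x" using B.add_neg_one[OF pc[OF x]] x by simp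
    finally show ?thesis using u by blast
  qed
  have gB: "free_gen R i \<in> carrier B" if "i \<in> S" for i unfolding B_def by (rule free_gen_carrier[OF that])
  have "\<forall>i\<in>S. \<exists>u. u \<in> carrier C \<and> d u \<oplus>\<^bsub>B\<^esub> p (free_gen R i) = free_gen R i"
    using lift[OF gB] by blast
  from bchoice[OF this] obtain u where
    u: "\<forall>i\<in>S. u i \<in> carrier C \<and> d (u i) \<oplus>\<^bsub>B\<^esub> p (free_gen R i) = free_gen R i" by (elim exE)
  then obtain t where t: "t \<in> lin_maps R B C" "\<And>i. i \<in> S \<Longrightarrow> t (free_gen R i) = u i"
    using free_mod_extend[OF C, of S u] unfolding B_def by blast
  note tc = lin_maps_closed[OF t(1)] and tadd = lin_maps_add[OF t(1)] and tsm = lin_maps_smult[OF t(1)]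
  have hom: "d (t x) \<oplus>\<^bsub>B\<^esub> p x = x" if "x \<in> carrier B" for x
    using that
  proof (induction rule: free_mod_induct[where S = S, folded B_def, consumes 1, case_names zero add gen])
    case zero
    have "d (t \<zero>\<^bsub>B\<^esub>) \<oplus>\<^bsub>B\<^esub> p \<zero>\<^bsub>B\<^esub> = \<zero>\<^bsub>B\<^esub>"
      unfolding p_def lin_maps_zero[OF B A e] lin_maps_zero[OF A B s(1)] lin_maps_zero[OF B C t(1)]
        lin_maps_zero[OF C B d] by simp
    then show ?case by (simp add: B_def free_mod_simps)
  next
    case (add x y)
    have c: "d (t x) \<in> carrier B" "d (t y) \<in> carrier B" using dc[OF tc[OF add(1)]] dc[OF tc[OF add(2)]] .
    have "d (t (x \<oplus>\<^bsub>B\<^esub> y)) \<oplus>\<^bsub>B\<^esub> p (x \<oplus>\<^bsub>B\<^esub> y) = (d (t x) \<oplus>\<^bsub>B\<^esub> p x) \<oplus>\<^bsub>B\<^esub> (d (t y) \<oplus>\<^bsub>B\<^esub> p y)"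
      unfolding padd[OF add(1,2)] tadd[OF add(1,2)] dadd[OF tc[OF add(1)] tc[OF add(2)]]
      using c pc[OF add(1)] pc[OF add(2)] by (simp only: B.a_ac B.a_closed)
    then show ?case unfolding add(3,4) .
  next
    case (gen r i)
    note g = gB[OF gen(2)]
    have ui: "u i \<in> carrier C" "d (u i) \<oplus>\<^bsub>B\<^esub> p (free_gen R i) = free_gen R i"
      using bspec[OF u gen(2)] by (rule conjunct1, rule conjunct2)
    have "d (t (r \<odot>\<^bsub>B\<^esub> free_gen R i)) \<oplus>\<^bsub>B\<^esub> p (r \<odot>\<^bsub>B\<^esub> free_gen R i) =
      r \<odot>\<^bsub>B\<^esub> (d (u i) \<oplus>\<^bsub>B\<^esub> p (free_gen R i))"
      using tsm[OF gen(1) g] t(2)[OF gen(2)] dsm[OF gen(1) ui(1)] psm[OF g gen(1)]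
        B.smult_r_distr[OF gen(1) dc[OF ui(1)] pc[OF g]] by simp
    then show ?case unfolding ui(2) .
  qed
  have "d (t (d y)) = d y" if y: "y \<in> carrier C" for y
  proof -
    have z: "d y \<in> carrier B" by (rule dc[OF y])
    have "d y \<in> a_kernel B A e" unfolding ex using y by blast
    then have "p (d y) = \<zero>\<^bsub>B\<^esub>" using lin_maps_zero[OF A B s(1)] by (simp add: p_def a_kernel_def')
    then show ?thesis using hom[OF z] dc[OF tc[OF z]] by simp
  qed
  then show ?thesis using t(1) by blast
qed

text \<open>A free resolution of the zero module splits: \<open>d j\<close> has a linear section on its image.\<close>

lemma free_resolution_zero_splits:
  fixes S :: "nat \<Rightarrow> 'i set" and M :: "('a, 'm) module"
  assumes res: "resolution R M (\<lambda>n. free_mod R (S n)) d \<epsilon>" and M: "module R M" "trivial_mod M"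
  shows "\<exists>s\<in>lin_maps R (free_mod R (S j)) (free_mod R (S (Suc j))).
    \<forall>x\<in>carrier (free_mod R (S (Suc j))). d j (s (d j x)) = d j x"
proof -
  let ?F = "\<lambda>n. free_mod R (S n)"
  interpret M: module R M by (rule M)
  have Fm: "module R (?F n)" and dl: "d n \<in> lin_maps R (?F (Suc n)) (?F n)"
    and ker: "a_kernel (?F (Suc n)) (?F n) (d n) = d (Suc n) ` carrier (?F (Suc (Suc n)))" for n
    using res by (simp_all add: resolution_def)
  show ?thesis
  proof (induction j)
    case 0
    interpret F0: module R "?F 0" by (rule Fm)
    have \<epsilon>: "\<epsilon> \<in> lin_maps R (?F 0) M" and k0: "a_kernel (?F 0) M \<epsilon> = d 0 ` carrier (?F (Suc 0))"
      using res by (simp_all add: resolution_def)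
    have "(\<lambda>_. \<zero>\<^bsub>?F 0\<^esub>) \<in> lin_maps R M (?F 0)" by (simp add: lin_maps_def F0.smult_r_null)
    moreover have "\<epsilon> \<zero>\<^bsub>?F 0\<^esub> = \<epsilon> x" if "x \<in> carrier (?F 0)" for x
      using lin_maps_closed[OF \<epsilon> that] lin_maps_closed[OF \<epsilon> F0.zero_closed] M(2) by (simp add: trivial_mod_def)
    ultimately show ?case by (rule splitting_step[where A = M and S = "S 0" and C = "?F (Suc 0)", OF M(1) Fm Fm \<epsilon> dl k0])
  next
    case (Suc j)
    then obtain s where s: "s \<in> lin_maps R (?F j) (?F (Suc j))"
      "\<And>x. x \<in> carrier (?F (Suc j)) \<Longrightarrow> d j (s (d j x)) = d j x" by blast
    show ?case by (rule splitting_step[where A = "?F j" and S = "S (Suc j)" and C = "?F (Suc (Suc j))", OF Fm Fm Fm dl dl ker s])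
  qed
qed

lemma zero_resolution:
  assumes M: "module R M" "trivial_mod M"
  shows "resolution R M (\<lambda>n. free_mod R {}) (\<lambda>n x. (\<lambda>_. \<zero>)) (\<lambda>_. \<zero>\<^bsub>M\<^esub>)"
proof -
  interpret M: module R M by (rule M)
  have c: "carrier (free_mod R {}) = {\<lambda>_. \<zero>}" by (auto simp: free_mod_simps)
  have m: "module R (free_mod R {})"
    by (rule trivial_moduleI) (auto simp: free_mod_simps)
  show ?thesis unfolding resolution_def
    using M(2) m by (auto simp: lin_maps_def c a_kernel_def' trivial_mod_def free_mod_simps(2-4) M.smult_r_null)
qed

text \<open>Whichever free resolution of the zero module computes Ext, every cocycle is a coboundary.\<close>

lemma Ext_zero:
  fixes M :: "('a, 'm) module" and N :: "('a, 'n) module"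
  assumes M: "module R M" "trivial_mod M" and N: "module R N" and i: "i \<ge> 1"
  shows "trivial_mod (Ext_mod R i M N)"
proof -
  interpret N: module R N by (rule N)
  obtain S d where Sd: "chosen_free_resolution R M = (S, d)" by (cases "chosen_free_resolution R M")
  have "\<exists>Sd. case Sd of (S, d) \<Rightarrow> \<exists>\<epsilon>. resolution R M (\<lambda>n. free_mod R (S n)) d \<epsilon>"
    using zero_resolution[OF M] by (intro exI[of _ "(\<lambda>_. {}, \<lambda>n x. (\<lambda>_. \<zero>))"]) auto
  then have "case chosen_free_resolution R M of (S, d) \<Rightarrow> \<exists>\<epsilon>. resolution R M (\<lambda>n. free_mod R (S n)) d \<epsilon>"
    unfolding chosen_free_resolution_def by (rule someI_ex)
  then obtain \<epsilon> where res: "resolution R M (\<lambda>n. free_mod R (S n)) d \<epsilon>" using Sd by auto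
  obtain j where j: "i = Suc j" using i by (cases i) auto
  let ?F = "\<lambda>n. free_mod R (S n)"
  define C where "C = Hom_mod R (?F i) N"
  define Z where "Z = {f \<in> carrier C. \<forall>x\<in>carrier (?F (Suc i)). f (d i x) = \<zero>\<^bsub>N\<^esub>}"
  define B where "B = (\<lambda>g. \<lambda>x\<in>carrier (?F i). g (d j x)) ` carrier (Hom_mod R (?F j) N)"
  have Ext: "Ext_mod R i M N = quot_mod (C\<lparr>carrier := Z\<rparr>) B"
    using j by (simp add: Ext_mod_def Sd Let_def C_def Z_def B_def)
  have Fm: "module R (?F n)" for n using res by (simp add: resolution_def)
  interpret Fi: module R "?F i" by (rule Fm)
  have dl: "d n \<in> lin_maps R (?F (Suc n)) (?F n)" for n using res by (simp add: resolution_def)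
  have dj: "d j \<in> lin_maps R (?F i) (?F j)" using dl[of j] j by simp
  have ker: "a_kernel (?F (Suc n)) (?F n) (d n) = d (Suc n) ` carrier (?F (Suc (Suc n)))" for n
    using res by (simp add: resolution_def)
  have C: "carrier C = lin_maps R (?F i) N \<inter> extensional (carrier (?F i))"
    "f \<oplus>\<^bsub>C\<^esub> g = (\<lambda>x\<in>carrier (?F i). f x \<oplus>\<^bsub>N\<^esub> g x)" for f g
    by (simp_all add: C_def Hom_mod_def mk_mod_def)
  have lin: "f \<in> lin_maps R (?F i) N" if "f \<in> carrier C" for f using that C by auto
  have Zsub: "Z \<subseteq> B"
  proof
    fix f assume f: "f \<in> Z"
    then have fC: "f \<in> carrier C" and cyc: "\<And>x. x \<in> carrier (?F (Suc i)) \<Longrightarrow> f (d i x) = \<zero>\<^bsub>N\<^esub>" by (auto simp: Z_def)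
    obtain s where s: "s \<in> lin_maps R (?F j) (?F i)"
      "\<And>x. x \<in> carrier (?F i) \<Longrightarrow> d j (s (d j x)) = d j x"
      using free_resolution_zero_splits[OF res M, of j] unfolding j by blast
    interpret Fj: module R "?F j" by (rule Fm)
    define g where "g = (\<lambda>x\<in>carrier (?F j). f (s x))"
    have "g \<in> lin_maps R (?F j) N" unfolding g_def by (rule lin_maps_comp_restrict[OF Fm s(1) lin[OF fC]])
    then have gC: "g \<in> carrier (Hom_mod R (?F j) N)" by (simp add: Hom_mod_def mk_mod_def g_def)
    have eq: "f (s (d j x)) = f x" if x: "x \<in> carrier (?F i)" for x
    proof -
      have dx: "d j x \<in> carrier (?F j)" by (rule lin_maps_closed[OF dj x])
      define y where "y = s (d j x)"
      have y: "y \<in> carrier (?F i)" "d j y = d j x" unfolding y_def using lin_maps_closed[OF s(1) dx] s(2)[OF x] .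
      define w where "w = x \<oplus>\<^bsub>?F i\<^esub> (\<ominus> \<one>) \<odot>\<^bsub>?F i\<^esub> y"
      have w: "w \<in> carrier (?F i)" using x y by (simp add: w_def)
      have "d j w = d j x \<oplus>\<^bsub>?F j\<^esub> (\<ominus> \<one>) \<odot>\<^bsub>?F j\<^esub> d j x"
        unfolding w_def using x y by (simp add: lin_maps_add[OF dj] lin_maps_smult[OF dj])
      also have "\<dots> = \<zero>\<^bsub>?F j\<^esub>" by (rule Fj.add_neg_one[OF dx])
      finally have "w \<in> a_kernel (?F (Suc j)) (?F j) (d j)" using w j by (simp add: a_kernel_def')
      then obtain v where "v \<in> carrier (?F (Suc i))" "w = d i v" unfolding ker j by blast
      then have fw: "f w = \<zero>\<^bsub>N\<^esub>" using cyc by simp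
      have "w \<oplus>\<^bsub>?F i\<^esub> y = x \<oplus>\<^bsub>?F i\<^esub> (y \<oplus>\<^bsub>?F i\<^esub> (\<ominus> \<one>) \<odot>\<^bsub>?F i\<^esub> y)"
        unfolding w_def using x y by (simp add: Fi.a_ac)
      also have "\<dots> = x" using Fi.add_neg_one[OF y(1)] x by simp
      finally have "f x = f w \<oplus>\<^bsub>N\<^esub> f y" using lin_maps_add[OF lin[OF fC] w y(1)] by simp
      then show ?thesis using fw lin_maps_closed[OF lin[OF fC] y(1)] by (simp add: y_def)
    qed
    have "f = (\<lambda>x\<in>carrier (?F i). g (d j x))"
    proof (rule extensionalityI)
      show "f \<in> extensional (carrier (?F i))" using fC C by simp
      show "f x = (\<lambda>x\<in>carrier (?F i). g (d j x)) x" if x: "x \<in> carrier (?F i)" for x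
        using eq[OF x] lin_maps_closed[OF dj x] x by (simp add: g_def)
    qed simp
    then show "f \<in> B" unfolding B_def using gC by (rule image_eqI)
  qed
  have Bsub: "B \<subseteq> Z"
  proof
    fix f assume "f \<in> B"
    then obtain g where g: "f = (\<lambda>x\<in>carrier (?F i). g (d j x))" "g \<in> lin_maps R (?F j) N"
      by (auto simp: B_def Hom_mod_def mk_mod_def)
    have g0: "g \<zero>\<^bsub>?F j\<^esub> = \<zero>\<^bsub>N\<^esub>" by (rule lin_maps_zero[OF Fm N g(2)])
    have "f \<in> lin_maps R (?F i) N" unfolding g(1) by (rule lin_maps_comp_restrict[OF Fm dj g(2)])
    then have "f \<in> carrier C" unfolding C g(1) by simp
    moreover have "f (d i x) = \<zero>\<^bsub>N\<^esub>" if x: "x \<in> carrier (?F (Suc i))" for x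
    proof -
      have "d i x \<in> a_kernel (?F (Suc j)) (?F j) (d j)" unfolding ker using x j by blast
      then show ?thesis using g0 j by (simp add: g(1) a_kernel_def')
    qed
    ultimately show "f \<in> Z" by (simp add: Z_def)
  qed
  have BZ: "B = Z" using Zsub Bsub by blast
  have di: "d i x \<in> carrier (?F i)" if "x \<in> carrier (?F (Suc i))" for x
    by (rule lin_maps_closed[OF dl that])
  have Zadd: "f \<oplus>\<^bsub>C\<^esub> g \<in> Z" if "f \<in> Z" "g \<in> Z" for f g
  proof -
    have fg: "f \<in> carrier C" "g \<in> carrier C" using that by (auto simp: Z_def)
    note fl = lin[OF fg(1)] and gl = lin[OF fg(2)]
    note lin_maps_simps = lin_maps_closed[OF fl] lin_maps_closed[OF gl] lin_maps_add[OF fl] lin_maps_add[OF gl]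
      lin_maps_smult[OF fl] lin_maps_smult[OF gl]
    have "(\<lambda>x\<in>carrier (?F i). f x \<oplus>\<^bsub>N\<^esub> g x) \<in> lin_maps R (?F i) N"
      unfolding lin_maps_def using fl gl by (auto simp: lin_maps_simps N.a_ac N.smult_r_distr)
    then have "f \<oplus>\<^bsub>C\<^esub> g \<in> carrier C" by (simp add: C)
    then show ?thesis using that di by (simp add: Z_def C(2))
  qed
  have Zdiff: "\<exists>h\<in>Z. h \<oplus>\<^bsub>C\<^esub> g = f" if "f \<in> Z" "g \<in> Z" for f g
  proof -
    have fg: "f \<in> carrier C" "g \<in> carrier C" using that by (auto simp: Z_def)
    note fl = lin[OF fg(1)] and gl = lin[OF fg(2)]
    note lin_maps_simps = lin_maps_closed[OF fl] lin_maps_closed[OF gl] lin_maps_add[OF fl] lin_maps_add[OF gl]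
      lin_maps_smult[OF fl] lin_maps_smult[OF gl]
    define h where "h = (\<lambda>x\<in>carrier (?F i). f x \<oplus>\<^bsub>N\<^esub> (\<ominus> \<one>) \<odot>\<^bsub>N\<^esub> g x)"
    have "(\<ominus> \<one>) \<odot>\<^bsub>N\<^esub> (r \<odot>\<^bsub>N\<^esub> v) = r \<odot>\<^bsub>N\<^esub> ((\<ominus> \<one>) \<odot>\<^bsub>N\<^esub> v)" if "r \<in> carrier R" "v \<in> carrier N" for r v
      using that N.smult_assoc1[symmetric] by (simp add: m_comm)
    then have "h \<in> lin_maps R (?F i) N"
      unfolding lin_maps_def h_def using fl gl by (auto simp: lin_maps_simps N.a_ac N.smult_r_distr)
    then have "h \<in> carrier C" by (simp add: C h_def)
    then have "h \<in> Z" using that di by (simp add: Z_def h_def N.smult_r_null)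
    moreover have "h \<oplus>\<^bsub>C\<^esub> g = f"
    proof (rule extensionalityI)
      show "f \<in> extensional (carrier (?F i))" using fg C by simp
      fix x assume x: "x \<in> carrier (?F i)"
      have c: "f x \<in> carrier N" "g x \<in> carrier N" using lin_maps_closed[OF fl x] lin_maps_closed[OF gl x] .
      have "(\<ominus> \<one>) \<odot>\<^bsub>N\<^esub> g x \<oplus>\<^bsub>N\<^esub> g x = (\<ominus> \<one> \<oplus> \<one>) \<odot>\<^bsub>N\<^esub> g x"
        using N.smult_l_distr[of "\<ominus> \<one>" \<one> "g x"] c by simp
      also have "\<dots> = \<zero>\<^bsub>N\<^esub>" using c by (simp add: l_neg N.smult_l_null)
      finally show "(h \<oplus>\<^bsub>C\<^esub> g) x = f x" using x c by (simp add: C h_def N.a_assoc)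
    qed (simp add: C)
    ultimately show ?thesis by blast
  qed
  have "Z \<noteq> {}"
  proof -
    have "(\<lambda>x\<in>carrier (?F i). \<zero>\<^bsub>N\<^esub>) \<in> Z" unfolding Z_def C lin_maps_def
      using di by (simp add: N.smult_r_null)
    then show ?thesis by blast
  qed
  have coset: "Z +>\<^bsub>C\<lparr>carrier := Z\<rparr>\<^esub> g = Z" if "g \<in> Z" for g
    using Zadd[OF _ that] Zdiff[OF _ that] by (force simp: a_r_coset_def')
  have "a_rcosets\<^bsub>C\<lparr>carrier := Z\<rparr>\<^esub> Z = {Z}"
    using coset \<open>Z \<noteq> {}\<close> by (auto simp: A_RCOSETS_def')
  then show ?thesis unfolding Ext BZ by (simp add: trivial_mod_def quot_mod_def mk_mod_def)
qed

lemma self_mod_module: "module R (self_mod R)"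
  unfolding self_mod_def mk_mod_def
  by (intro moduleI is_cring abelian_groupI)
    (auto simp: a_ac m_assoc l_distr r_distr intro: l_neg a_inv_closed bexI[of _ "\<ominus> _"])

lemma dual_trivial:
  fixes M :: "('a, 'm) module"
  assumes M: "module R M" "trivial_mod M"
  shows "module R (dual_mod R M)" "trivial_mod (dual_mod R M)"
proof -
  interpret M: module R M by (rule M)
  have cM: "carrier M = {\<zero>\<^bsub>M\<^esub>}" using M(2) by (simp add: trivial_mod_def)
  have "f \<zero>\<^bsub>M\<^esub> = \<zero>" if f: "f \<in> lin_maps R M (self_mod R)" for f
  proof -
    have "\<forall>r\<in>carrier R. \<forall>x\<in>carrier M. f (r \<odot>\<^bsub>M\<^esub> x) = r \<otimes> f x"
      using f by (simp add: lin_maps_def self_mod_def mk_mod_def)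
    from bspec[OF bspec[OF this zero_closed] M.zero_closed]
    have "f (\<zero> \<odot>\<^bsub>M\<^esub> \<zero>\<^bsub>M\<^esub>) = \<zero> \<otimes> f \<zero>\<^bsub>M\<^esub>" .
    moreover have "f \<zero>\<^bsub>M\<^esub> \<in> carrier R"
      using f M.zero_closed by (auto simp: lin_maps_def self_mod_def mk_mod_def)
    ultimately show ?thesis by (simp add: M.smult_l_null)
  qed
  then have "f = (\<lambda>x\<in>carrier M. \<zero>)" if "f \<in> lin_maps R M (self_mod R) \<inter> extensional (carrier M)" for f
    using that by (auto simp: cM extensional_def fun_eq_iff)
  moreover have "(\<lambda>x\<in>carrier M. \<zero>) \<in> lin_maps R M (self_mod R)"
    by (auto simp: lin_maps_def self_mod_def mk_mod_def)
  ultimately have c: "carrier (dual_mod R M) = {\<zero>\<^bsub>dual_mod R M\<^esub>}"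
    by (auto simp: dual_mod_def Hom_mod_def mk_mod_def self_mod_def)
  then show "trivial_mod (dual_mod R M)" by (simp add: trivial_mod_def)
  show "module R (dual_mod R M)"
    by (rule trivial_moduleI[OF c]) (auto simp: dual_mod_def Hom_mod_def mk_mod_def self_mod_def)
qed

lemma zero_totally_reflexive:
  fixes M :: "('a, 'm) module"
  assumes M: "module R M" "trivial_mod M"
  shows "totally_reflexive R M"
  unfolding totally_reflexive_def
proof (intro conjI allI impI)
  note D = dual_trivial[OF M]
  note DD = dual_trivial[OF D]
  show "trivial_mod (Ext_mod R i M (self_mod R))" "trivial_mod (Ext_mod R i (dual_mod R M) (self_mod R))" if "i \<ge> 1" for i
    using Ext_zero[OF M self_mod_module that] Ext_zero[OF D self_mod_module that] .
  have "bidual_map R M x = \<zero>\<^bsub>dual_mod R (dual_mod R M)\<^esub>" if "x \<in> carrier M" for x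
  proof -
    have z: "\<zero>\<^bsub>dual_mod R N\<^esub> = (\<lambda>x\<in>carrier N. \<zero>)" for N :: "('a, 'n) module"
      by (simp add: dual_mod_def Hom_mod_def mk_mod_def self_mod_def)
    have "carrier (dual_mod R M) = {\<lambda>x\<in>carrier M. \<zero>}" using D(2) z[of M] by (simp add: trivial_mod_def)
    then show ?thesis using that by (simp add: bidual_map_def dual_mod_def Hom_mod_def mk_mod_def self_mod_def fun_eq_iff)
  qed
  then show "bij_betw (bidual_map R M) (carrier M) (carrier (dual_mod R (dual_mod R M)))"
    using M(2) DD(2) by (auto simp: trivial_mod_def bij_betw_def)
qed (rule M)

lemma Gdim_zero:
  fixes M :: "('a, 'm) module"
  assumes M: "module R M" "trivial_mod M"
  shows "Gdim R M < \<infinity>"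
proof -
  let ?G = "\<lambda>n::nat. free_mod R ({} :: ('m + 'a) list set)"
  have triv: "trivial_mod (?G i)" for i
    by (auto simp: trivial_mod_def free_mod_simps)
  have mod: "module R (?G i)" for i
    by (rule trivial_moduleI) (auto simp: free_mod_simps)
  have "Gdim R M \<le> enat 0" unfolding Gdim_def
    using zero_resolution[OF M] zero_totally_reflexive[OF mod triv] triv
    by (intro Inf_lower CollectI exI[of _ "0 :: nat"] exI[of _ ?G] conjI) blast+
  then show ?thesis by (rule order.strict_trans1) simp
qed

end

section \<open>A ring without derivations\<close>

text \<open>In characteristic \<open>2\<close> derivations kill squares. So they vanish on a ring that is generated by its
  squares together with the image of \<open>k\<close>.\<close>

lemma Der_trivial:
  fixes k :: "('k, 'y) ring_scheme" and R :: "('k, 'r) module" (structure)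
  assumes R: "cring R" and two: "\<one> \<oplus> \<one> = \<zero>"
    and c: "c \<in> carrier k" "c' \<in> carrier k" and k_one: "\<And>c. c \<in> carrier k \<Longrightarrow> c \<odot> \<one> \<in> carrier R"
    and repr: "\<And>r. r \<in> carrier R \<Longrightarrow> \<exists>p\<in>carrier R. \<exists>q\<in>carrier R. \<exists>w\<in>carrier R. \<exists>q'\<in>carrier R. \<exists>w'\<in>carrier R.
      r = p \<otimes> p \<oplus> (q \<otimes> q \<otimes> (c \<odot> \<one> \<oplus> w \<otimes> w) \<oplus>
        q' \<otimes> q' \<otimes> (c' \<odot> \<one> \<oplus> w' \<otimes> w'))"
  shows "trivial_mod (Der k R)" and "module R (Der k R)"
proof -
  interpret cring R by fact
  let ?z = "\<lambda>x\<in>carrier R. \<zero>"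
  have "D = ?z" if D: "D \<in> carrier (Der k R)" for D
  proof -
    note kc = k_one[OF c(1)] k_one[OF c(2)]
    have Dc: "D x \<in> carrier R" and Dadd: "D (x \<oplus> y) = D x \<oplus> D y"
      and Dmult: "D (x \<otimes> y) = x \<otimes> D y \<oplus> y \<otimes> D x"
      if "x \<in> carrier R" "y \<in> carrier R" for x y
      using D that unfolding Der_def mk_mod_def by auto
    have Dk: "D (c \<odot> \<one>) = \<zero>" "D (c' \<odot> \<one>) = \<zero>"
      and Dext: "D \<in> extensional (carrier R)"
      using D c unfolding Der_def mk_mod_def by auto
    have sq: "D (x \<otimes> x) = \<zero>" if x: "x \<in> carrier R" for x
    proof -
      have "D (x \<otimes> x) = (\<one> \<oplus> \<one>) \<otimes> (x \<otimes> D x)"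
        using Dmult[OF x x] Dc[OF x x] x by (simp add: l_distr)
      then show ?thesis using Dc[OF x x] x unfolding two by simp
    qed
    have prod0: "D (q \<otimes> q \<otimes> (e \<oplus> w \<otimes> w)) = \<zero>"
      if "q \<in> carrier R" "w \<in> carrier R" "e \<in> carrier R" "D e = \<zero>" for q w e
      using that sq by (simp add: Dmult Dadd)
    have "D r = \<zero>" if r: "r \<in> carrier R" for r
    proof -
      obtain p q w q' w' where pq: "p \<in> carrier R" "q \<in> carrier R" "w \<in> carrier R" "q' \<in> carrier R" "w' \<in> carrier R"
        and r: "r = p \<otimes> p \<oplus> (q \<otimes> q \<otimes> (c \<odot> \<one> \<oplus> w \<otimes> w) \<oplus>
          q' \<otimes> q' \<otimes> (c' \<odot> \<one> \<oplus> w' \<otimes> w'))" using repr[OF r] by blast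
      show ?thesis unfolding r using pq kc sq prod0[OF pq(2,3) kc(1) Dk(1)] prod0[OF pq(4,5) kc(2) Dk(2)]
        by (simp add: Dadd)
    qed
    then show ?thesis using Dext by (auto simp: extensional_def fun_eq_iff)
  qed
  moreover have "?z \<in> carrier (Der k R)" using k_one by (auto simp: Der_def mk_mod_def)
  ultimately have car: "carrier (Der k R) = {\<zero>\<^bsub>Der k R\<^esub>}" by (auto simp: Der_def mk_mod_def)
  then show "trivial_mod (Der k R)" by (simp add: trivial_mod_def)
  show "module R (Der k R)"
    by (rule trivial_moduleI[OF car]) (auto simp: Der_def mk_mod_def)
qed

subsection \<open>The ring \<open>F[a, b] / (a\<^sup>2, ab, b\<^sup>2)\<close>\<close>

text \<open>\<open>Dual2 x u v\<close> stands for \<open>x + u a + v b\<close>. As a type of its own it is an instance of the class of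
  commutative rings.\<close>

datatype 'f dual2 = Dual2 (body: 'f) (eps1: 'f) (eps2: 'f)

instantiation dual2 :: (comm_ring_1) comm_ring_1
begin

definition "0 = Dual2 0 0 0"
definition "1 = Dual2 1 0 0"
definition "x + y = Dual2 (body x + body y) (eps1 x + eps1 y) (eps2 x + eps2 y)"
definition "- x = Dual2 (- body x) (- eps1 x) (- eps2 x)"
definition "(x :: 'a dual2) - y = x + - y"
definition "x * y = Dual2 (body x * body y) (body x * eps1 y + body y * eps1 x) (body x * eps2 y + body y * eps2 x)"

lemmas dual2_defs = zero_dual2_def one_dual2_def plus_dual2_def uminus_dual2_def minus_dual2_def times_dual2_def

instance
  by standard (auto simp: dual2_defs algebra_simps)

end

lemma dual2_unit:
  fixes x :: "'f :: field dual2"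
  assumes "body x \<noteq> 0"
  shows "\<exists>y. x * y = 1"
  using assms
  by (intro exI[of _ "Dual2 (inverse (body x)) (- eps1 x * inverse (body x) ^ 2) (- eps2 x * inverse (body x) ^ 2)"])
    (simp add: dual2_defs field_simps power2_eq_square)

text \<open>The ring structure on a subring \<open>S\<close> of a type, transported along an injection \<open>e\<close>.\<close>

definition image_ring :: "('t :: comm_ring_1 \<Rightarrow> 'x) \<Rightarrow> 't set \<Rightarrow> 'x ring"
  where "image_ring e S = \<lparr>carrier = e ` S, mult = \<lambda>x y. e (inv_into UNIV e x * inv_into UNIV e y), one = e 1,
    zero = e 0, add = \<lambda>x y. e (inv_into UNIV e x + inv_into UNIV e y)\<rparr>"

text \<open>The ring structure of a whole type, transported along \<open>j\<close>, as an algebra over any subring that is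
  transported along \<open>e\<close>.\<close>

definition image_algebra :: "('t :: comm_ring_1 \<Rightarrow> 'c) \<Rightarrow> ('t \<Rightarrow> 'x) \<Rightarrow> ('c, 'x) module"
  where "image_algebra e j = \<lparr>carrier = range j, mult = \<lambda>x y. j (inv_into UNIV j x * inv_into UNIV j y), one = j 1,
    zero = j 0, add = \<lambda>x y. j (inv_into UNIV j x + inv_into UNIV j y), module.smult = \<lambda>c x. j (inv_into UNIV e c * inv_into UNIV j x)\<rparr>"

lemma image_ring_cring:
  fixes e :: "'t :: comm_ring_1 \<Rightarrow> 'x"
  assumes e: "inj e" and S: "0 \<in> S" "1 \<in> S" "\<And>x y. x \<in> S \<Longrightarrow> y \<in> S \<Longrightarrow> x + y \<in> S"
    "\<And>x y. x \<in> S \<Longrightarrow> y \<in> S \<Longrightarrow> x * y \<in> S" "\<And>x. x \<in> S \<Longrightarrow> - x \<in> S"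
  shows "cring (image_ring e S)"
proof (rule cringI)
  show "abelian_group (image_ring e S)"
  proof (rule abelian_groupI)
    show "\<exists>y\<in>carrier (image_ring e S). y \<oplus>\<^bsub>image_ring e S\<^esub> x = \<zero>\<^bsub>image_ring e S\<^esub>"
      if x: "x \<in> carrier (image_ring e S)" for x
    proof -
      obtain t where t: "t \<in> S" "x = e t" using x by (auto simp: image_ring_def)
      then have "e (- t) \<oplus>\<^bsub>image_ring e S\<^esub> x = \<zero>\<^bsub>image_ring e S\<^esub>" "e (- t) \<in> carrier (image_ring e S)"
        using e S(5) by (auto simp: image_ring_def)
      then show ?thesis by blast
    qed
  qed (use e S in \<open>auto simp: image_ring_def ac_simps\<close>)
  show "comm_monoid (image_ring e S)"
    by (rule comm_monoidI) (use e S in \<open>auto simp: image_ring_def ac_simps\<close>)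
qed (use e in \<open>auto simp: image_ring_def algebra_simps\<close>)

text \<open>The fractions with numerator and denominator in \<open>S\<close>, as a subset of the ambient ring.\<close>

definition fractions :: "'t :: comm_ring_1 set \<Rightarrow> 't set"
  where "fractions S = {x. \<exists>g\<in>S. g \<noteq> 0 \<and> x * g \<in> S}"

lemma fractions_field:
  fixes e :: "'t :: comm_ring_1 \<Rightarrow> 'x"
  assumes e: "inj e" and S: "0 \<in> S" "1 \<in> S" "\<And>x y. x \<in> S \<Longrightarrow> y \<in> S \<Longrightarrow> x + y \<in> S"
    "\<And>x y. x \<in> S \<Longrightarrow> y \<in> S \<Longrightarrow> x * y \<in> S" "\<And>x. x \<in> S \<Longrightarrow> - x \<in> S"
    and unit: "\<And>x. x \<in> S \<Longrightarrow> x \<noteq> 0 \<Longrightarrow> \<exists>y. x * y = 1"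
  shows "field (image_ring e (fractions S))"
proof -
  have nz: "g * h \<noteq> 0" if gh: "g \<in> S" "h \<in> S" "g \<noteq> 0" "h \<noteq> 0" for g h
  proof
    assume gh0: "g * h = 0"
    obtain y where "g * y = 1" using unit gh by blast
    moreover have "y * (g * h) = (g * y) * h" by (simp add: ac_simps)
    ultimately have "h = y * (g * h)" by simp
    then show False using gh0 gh by simp
  qed
  have SF: "x \<in> fractions S" if "x \<in> S" for x
    using that S(2) by (cases "(1::'t) = 0") (auto simp: fractions_def intro!: bexI[of _ 1])
  interpret cring "image_ring e (fractions S)"
  proof (rule image_ring_cring[OF e])
    fix x y assume "x \<in> fractions S" "y \<in> fractions S"
    then obtain g h where g: "g \<in> S" "g \<noteq> 0" "x * g \<in> S" and h: "h \<in> S" "h \<noteq> 0" "y * h \<in> S"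
      by (auto simp: fractions_def)
    have eqs: "(x + y) * (g * h) = (x * g) * h + (y * h) * g" "(x * y) * (g * h) = (x * g) * (y * h)"
      by (simp_all add: algebra_simps)
    have "(x + y) * (g * h) \<in> S" "(x * y) * (g * h) \<in> S"
      unfolding eqs by (intro S(3,4) g(1,3) h(1,3))+
    then show "x + y \<in> fractions S" "x * y \<in> fractions S"
      using nz[OF g(1) h(1) g(2) h(2)] S(4)[OF g(1) h(1)] unfolding fractions_def by blast+
  next
    fix x assume "x \<in> fractions S"
    then show "- x \<in> fractions S" using S(5) by (auto simp: fractions_def)
  qed (use S SF in auto)
  show ?thesis
  proof (rule cring_fieldI2)
    show "\<zero>\<^bsub>image_ring e (fractions S)\<^esub> \<noteq> \<one>\<^bsub>image_ring e (fractions S)\<^esub>"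
      using e by (simp add: image_ring_def inj_eq)
    fix a assume a: "a \<in> carrier (image_ring e (fractions S))" "a \<noteq> \<zero>\<^bsub>image_ring e (fractions S)\<^esub>"
    then obtain x where x: "a = e x" "x \<in> fractions S" "x \<noteq> 0" by (auto simp: image_ring_def)
    then obtain g where g: "g \<in> S" "g \<noteq> 0" "x * g \<in> S" by (auto simp: fractions_def)
    obtain g' where g': "g * g' = 1" using unit g by blast
    have f: "x * g \<noteq> 0"
    proof
      assume "x * g = 0"
      then have "(x * g) * g' = 0" by simp
      then show False using g' x(3) by (simp add: mult.assoc)
    qed
    then obtain f' where f': "x * g * f' = 1" using unit g by blast
    have "(g * f') * (x * g) = g * (x * g * f')" by (simp add: ac_simps)
    then have "(g * f') * (x * g) \<in> S" using f' g by simp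
    then have "g * f' \<in> fractions S" using f g(3) unfolding fractions_def by blast
    then have "e (g * f') \<in> carrier (image_ring e (fractions S))" by (simp add: image_ring_def)
    moreover have "a \<otimes>\<^bsub>image_ring e (fractions S)\<^esub> e (g * f') = \<one>\<^bsub>image_ring e (fractions S)\<^esub>"
      using f' e by (simp add: x image_ring_def mult.assoc)
    ultimately show "\<exists>b\<in>carrier (image_ring e (fractions S)). a \<otimes>\<^bsub>image_ring e (fractions S)\<^esub> b =
      \<one>\<^bsub>image_ring e (fractions S)\<^esub>" by blast
  qed
qed

lemma image_algebra_simps:
  assumes "inj e" "inj j"
  shows "carrier (image_algebra e j) = range j" "j x \<otimes>\<^bsub>image_algebra e j\<^esub> j y = j (x * y)"
    "j x \<oplus>\<^bsub>image_algebra e j\<^esub> j y = j (x + y)" "\<one>\<^bsub>image_algebra e j\<^esub> = j 1" "\<zero>\<^bsub>image_algebra e j\<^esub> = j 0"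
    "e x \<odot>\<^bsub>image_algebra e j\<^esub> j y = j (x * y)"
  using assms by (simp_all add: image_algebra_def)

lemma image_algebra_cring:
  assumes "inj e" "inj j"
  shows "cring (image_algebra e j)"
proof (rule cringI)
  show "abelian_group (image_algebra e j)"
  proof (rule abelian_groupI)
    show "\<exists>y\<in>carrier (image_algebra e j). y \<oplus>\<^bsub>image_algebra e j\<^esub> x = \<zero>\<^bsub>image_algebra e j\<^esub>"
      if x: "x \<in> carrier (image_algebra e j)" for x
    proof -
      obtain t where t: "x = j t" using x assms by (auto simp: image_algebra_simps)
      then have "j (- t) \<oplus>\<^bsub>image_algebra e j\<^esub> x = \<zero>\<^bsub>image_algebra e j\<^esub>" using assms by (simp add: image_algebra_simps)
      then show ?thesis using assms by (auto simp: image_algebra_simps)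
    qed
  qed (use assms in \<open>auto simp: image_algebra_simps ac_simps\<close>)
  show "comm_monoid (image_algebra e j)"
    by (rule comm_monoidI) (use assms in \<open>auto simp: image_algebra_simps ac_simps\<close>)
qed (use assms in \<open>auto simp: image_algebra_simps algebra_simps\<close>)

lemma image_algebra_algebra:
  assumes "inj e" "inj j" "cring (image_ring e S)"
  shows "Module.algebra (image_ring e S) (image_algebra e j)"
proof (rule algebraI[OF assms(3) image_algebra_cring[OF assms(1,2)]])
qed (use assms(1,2) in \<open>auto simp: image_algebra_simps image_ring_def algebra_simps\<close>)

lemma image_algebra_short_local:
  fixes j :: "'f :: field dual2 \<Rightarrow> 'x"
  assumes e: "inj e" and j: "inj j"
  shows "short_local (image_algebra e j) (j ` {x. body x = 0}) (j (Dual2 0 1 0)) (j (Dual2 0 0 1))"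
proof -
  let ?R = "image_algebra e j"
  note simps = image_algebra_simps[OF e j]
  interpret cring ?R by (rule image_algebra_cring[OF e j])
  have comb: "j r \<otimes>\<^bsub>?R\<^esub> j (Dual2 0 1 0) \<oplus>\<^bsub>?R\<^esub> j s \<otimes>\<^bsub>?R\<^esub> j (Dual2 0 0 1) = j (Dual2 0 (body r) (body s))" for r s
    unfolding simps by (simp add: dual2_defs)
  show ?thesis
  proof
    show "j ` {x. body x = 0} = {r \<otimes>\<^bsub>?R\<^esub> j (Dual2 0 1 0) \<oplus>\<^bsub>?R\<^esub> s \<otimes>\<^bsub>?R\<^esub> j (Dual2 0 0 1) | r s.
      r \<in> carrier ?R \<and> s \<in> carrier ?R}" (is "?A = ?B")
    proof
      show "?A \<subseteq> ?B"
      proof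
        fix y assume "y \<in> ?A"
        then obtain x where x: "y = j x" "body x = 0" by auto
        then have "y = j (Dual2 0 (body (Dual2 (eps1 x) 0 0)) (body (Dual2 (eps2 x) 0 0)))" by (cases x) simp
        also have "\<dots> = j (Dual2 (eps1 x) 0 0) \<otimes>\<^bsub>?R\<^esub> j (Dual2 0 1 0) \<oplus>\<^bsub>?R\<^esub>
          j (Dual2 (eps2 x) 0 0) \<otimes>\<^bsub>?R\<^esub> j (Dual2 0 0 1)" by (rule comb[symmetric])
        finally show "y \<in> ?B" unfolding simps(1) by blast
      qed
      show "?B \<subseteq> ?A" using comb by (auto simp: simps(1))
    qed
    show "j (Dual2 0 1 0) \<in> carrier ?R" "j (Dual2 0 0 1) \<in> carrier ?R" by (simp_all add: simps)
    show "j (Dual2 0 1 0) \<otimes>\<^bsub>?R\<^esub> j (Dual2 0 1 0) = \<zero>\<^bsub>?R\<^esub>" "j (Dual2 0 1 0) \<otimes>\<^bsub>?R\<^esub> j (Dual2 0 0 1) = \<zero>\<^bsub>?R\<^esub>"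
      "j (Dual2 0 0 1) \<otimes>\<^bsub>?R\<^esub> j (Dual2 0 0 1) = \<zero>\<^bsub>?R\<^esub>"
      unfolding simps by (simp_all add: dual2_defs)
    show "r \<in> ?A \<and> s \<in> ?A" if rs: "r \<in> carrier ?R" "s \<in> carrier ?R"
      "r \<otimes>\<^bsub>?R\<^esub> j (Dual2 0 1 0) \<oplus>\<^bsub>?R\<^esub> s \<otimes>\<^bsub>?R\<^esub> j (Dual2 0 0 1) = \<zero>\<^bsub>?R\<^esub>" for r s
    proof -
      obtain x y where xy: "r = j x" "s = j y" using rs by (auto simp: simps(1))
      then have "j (Dual2 0 (body x) (body y)) = j 0" using rs(3) comb simps(5) by metis
      then have "body x = 0" "body y = 0" using j by (auto simp: inj_eq dual2_defs)
      then show ?thesis using xy by auto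
    qed
    show "\<one>\<^bsub>?R\<^esub> \<notin> ?A" unfolding simps using j by (auto simp: inj_image_mem_iff dual2_defs)
    show "\<exists>y\<in>carrier ?R. x \<otimes>\<^bsub>?R\<^esub> y = \<one>\<^bsub>?R\<^esub>" if x: "x \<in> carrier ?R" "x \<notin> ?A" for x
    proof -
      obtain t where t: "x = j t" using x by (auto simp: simps(1))
      then have "body t \<noteq> 0" using x(2) by auto
      then obtain u where "t * u = 1" using dual2_unit by blast
      then have "x \<otimes>\<^bsub>?R\<^esub> j u = \<one>\<^bsub>?R\<^esub>" unfolding t simps by simp
      then show ?thesis by (auto simp: simps(1))
    qed
  qed
qed

subsection \<open>The subfield of constants\<close>

lemma map_poly_pderiv_add: "map_poly pderiv (f + g) = map_poly pderiv f + map_poly pderiv (g :: 'a :: idom poly poly)"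
  by (intro poly_eqI) (simp add: coeff_map_poly pderiv_add)

lemma map_poly_pderiv_mult:
  "map_poly pderiv (f * g) = f * map_poly pderiv g + g * map_poly pderiv (f :: 'a :: idom poly poly)"
proof (induction f)
  case (pCons a f)
  have sm: "map_poly pderiv (smult a g) = smult a (map_poly pderiv g) + smult (pderiv a) g"
    by (intro poly_eqI) (simp add: coeff_map_poly pderiv_mult mult.commute)
  have pc: "map_poly pderiv (pCons c h) = pCons (pderiv c) (map_poly pderiv h)" for c and h :: "'a poly poly"
    by (intro poly_eqI) (simp add: coeff_map_poly coeff_pCons split: nat.split)
  show ?case
    by (simp add: map_poly_pderiv_add sm pc pCons.IH algebra_simps)
qed simp

lemma map_poly_pderiv_1: "map_poly pderiv (1 :: 'a :: idom poly poly) = 0"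
  by (intro poly_eqI) (simp add: coeff_map_poly)

text \<open>The residue field is the algebraic closure of \<open>\<bbbF>\<^sub>2(s, t)\<close>. All that matters is that it is perfect,
  of characteristic \<open>2\<close>, countable, and contains the polynomial ring in two variables.\<close>

type_synonym big_field = "bit poly poly fract alg_closure"

text \<open>The inclusion of \<open>\<bbbF>\<^sub>2[s, t]\<close>, with \<open>s\<close> the inner and \<open>t\<close> the outer variable.\<close>

definition incl :: "bit poly poly \<Rightarrow> big_field"
  where "incl f = to_ac (Fract f 1)"

text \<open>The ring homomorphism that sends \<open>s\<close> to \<open>s + a\<close> and \<open>t\<close> to \<open>t + b\<close>, so that \<open>f\<close> goes to
  \<open>f + (df/ds) a + (df/dt) b\<close>.\<close>

definition deform :: "bit poly poly \<Rightarrow> big_field dual2"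
  where "deform f = Dual2 (incl f) (incl (map_poly pderiv f)) (incl (pderiv f))"

lemma incl_hom: "incl (f + g) = incl f + incl g" "incl (f * g) = incl f * incl g" "incl 0 = 0" "incl 1 = 1"
  "incl (- f) = - incl f"
  by (simp_all add: incl_def Zero_fract_def[symmetric] One_fract_def[symmetric]
      flip: to_ac_add to_ac_mult to_ac_minus)

lemma incl_eq_0: "incl f = 0 \<longleftrightarrow> f = 0"
  by (simp add: incl_def Zero_fract_def eq_fract)

lemma deform_hom: "deform (f + g) = deform f + deform g" "deform (f * g) = deform f * deform g"
  "deform 0 = 0" "deform 1 = 1" "deform (- f) = - deform f"
proof -
  show add: "deform (f + g) = deform f + deform g" for f g
    by (simp add: deform_def dual2_defs incl_hom map_poly_pderiv_add pderiv_add)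
  show "deform (f * g) = deform f * deform g"
    by (simp add: deform_def dual2_defs incl_hom map_poly_pderiv_mult pderiv_mult)
  show 0: "deform 0 = 0" by (simp add: deform_def dual2_defs incl_hom)
  show "deform 1 = 1" by (simp add: deform_def dual2_defs incl_hom map_poly_pderiv_1)
  have "deform f + deform (- f) = 0" using add[of f "- f"] 0 by simp
  then show "deform (- f) = - deform f" by (simp add: eq_neg_iff_add_eq_0 add.commute)
qed

text \<open>A copy of \<open>\<bbbF>\<^sub>2(s, t)\<close>, generated as a field by \<open>s + a\<close> and \<open>t + b\<close>.\<close>

definition constants :: "big_field dual2 set"
  where "constants = fractions (range deform)"

lemma constants_field:
  assumes "inj e"
  shows "field (image_ring e constants)"
  unfolding constants_def
proof (rule fractions_field[OF assms])
  show "\<exists>y. x * y = 1" if x: "x \<in> range deform" "x \<noteq> 0" for x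
  proof -
    obtain f where f: "x = deform f" using x by auto
    then have "f \<noteq> 0" using x deform_hom(3) by auto
    then show ?thesis using f dual2_unit[of x] by (simp add: deform_def incl_eq_0)
  qed
qed (auto simp flip: deform_hom)

lemma deform_constants: "deform f \<in> constants"
proof -
  have "deform 1 \<noteq> 0" unfolding deform_hom by simp
  moreover have "deform f * deform 1 \<in> range deform" by (simp flip: deform_hom)
  ultimately show ?thesis unfolding constants_def fractions_def by blast
qed

lemma big_field_two: "(1 :: big_field) + 1 = 0"
proof -
  have "(1 :: bit poly poly) + 1 = 0" by (simp add: one_pCons)
  then have "incl (1 + 1) = incl 0" by (rule arg_cong)
  then show ?thesis by (simp only: incl_hom)
qed

subsection \<open>Cardinality\<close>

lemma countable_poly: "countable (UNIV :: 'a :: zero set) \<Longrightarrow> countable (UNIV :: 'a poly set)"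
proof -
  assume "countable (UNIV :: 'a set)"
  then have "countable (lists (UNIV :: 'a set))" by (rule countable_lists)
  then have "countable (coeffs ` (UNIV :: 'a poly set))" by (rule countable_subset[rotated]) auto
  then show ?thesis by (rule countable_image_inj_on) (simp add: coeffs_eq_iff inj_on_def)
qed

lemma countable_fract:
  assumes "countable (UNIV :: 'a :: idom set)"
  shows "countable (UNIV :: 'a fract set)"
proof -
  have "countable ((\<lambda>(a, b). Fract a b) ` (UNIV \<times> UNIV :: ('a \<times> 'a) set))"
    by (intro countable_image countable_SIGMA assms)
  moreover have "q \<in> (\<lambda>(a, b). Fract a b) ` (UNIV \<times> UNIV)" for q :: "'a fract"
    by (cases q rule: Fract_cases) auto
  ultimately show ?thesis by (metis (no_types, lifting) UNIV_eq_I)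
qed

lemma countable_alg_closure:
  assumes "countable (UNIV :: 'a :: field set)"
  shows "countable (UNIV :: 'a alg_closure set)"
proof -
  have "countable {p :: 'a poly. p \<noteq> 0}" using countable_poly[OF assms] by (rule countable_subset[rotated]) simp
  then have "countable (\<Union>p\<in>{p :: 'a poly. p \<noteq> 0}. {x :: 'a alg_closure. poly (map_poly to_ac p) x = 0})"
  proof (rule countable_UN)
    fix p :: "'a poly" assume "p \<in> {p. p \<noteq> 0}"
    then have "map_poly to_ac p \<noteq> 0" by (auto simp: poly_eq_iff coeff_map_poly)
    then show "countable {x :: 'a alg_closure. poly (map_poly to_ac p) x = 0}"
      by (intro countable_finite poly_roots_finite)
  qed
  moreover have "x \<in> (\<Union>p\<in>{p :: 'a poly. p \<noteq> 0}. {x :: 'a alg_closure. poly (map_poly to_ac p) x = 0})" for x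
    by (rule alg_closure_algebraic[of x]) auto
  ultimately show ?thesis by (metis (no_types, lifting) UNIV_eq_I)
qed

lemma countable_dual2:
  assumes "countable (UNIV :: 'f set)"
  shows "countable (UNIV :: 'f dual2 set)"
proof -
  have "countable ((\<lambda>(x, y, z). Dual2 x y z) ` (UNIV \<times> UNIV \<times> UNIV :: ('f \<times> 'f \<times> 'f) set))"
    by (intro countable_image countable_SIGMA assms)
  moreover have "x \<in> (\<lambda>(x, y, z). Dual2 x y z) ` (UNIV \<times> UNIV \<times> UNIV)" for x :: "'f dual2"
    by (rule image_eqI[of _ _ "(body x, eps1 x, eps2 x)"]) simp_all
  ultimately show ?thesis by (metis (no_types, lifting) UNIV_eq_I)
qed

lemma countable_big_field_dual2: "countable (UNIV :: big_field dual2 set)"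
proof -
  have "UNIV = {0, 1 :: bit}" using bit.exhaust by auto
  then have "countable (UNIV :: bit set)" by (metis countable_finite finite.emptyI finite.insertI)
  then show ?thesis
    by (intro countable_dual2 countable_alg_closure countable_fract countable_poly)
qed

theorem mainTheorem2:
  shows "\<exists>(k :: real ring) (R :: (real, nat \<Rightarrow> real) module).
    field k \<and> Module.algebra k R \<and> local_ring R \<and>
    finitely_generated R (Der k R) \<and>
    Gdim R (Der k R) < \<infinity> \<and>
    CIdim R (Der k R) < \<infinity> \<and>
    \<not> gorenstein R \<and> \<not> complete_intersection R"
proof -
  \<comment> \<open>Everything is countable, so it fits into the prescribed carrier types.\<close>
  obtain h :: "big_field dual2 \<Rightarrow> nat" where h: "inj h" using countable_big_field_dual2 by (auto simp: countable_def)
  define e :: "big_field dual2 \<Rightarrow> real" where "e x = real (h x)" for x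
  define j :: "big_field dual2 \<Rightarrow> nat \<Rightarrow> real" where "j x = (\<lambda>_. e x)" for x
  have e: "inj e" using h by (auto simp: e_def inj_def)
  have j: "inj j" using e by (auto simp: j_def inj_def fun_eq_iff)
  define k where "k = image_ring e constants"
  define R where "R = image_algebra e j"
  have k: "field k" unfolding k_def by (rule constants_field[OF e])
  interpret k: field k by (rule k)
  interpret R: short_local R "j ` {x. body x = 0}" "j (Dual2 0 1 0)" "j (Dual2 0 0 1)"
    unfolding R_def by (rule image_algebra_short_local[OF e j])
  note simps = image_algebra_simps[OF e j, folded R_def]
  have alg: "Module.algebra k R"
    unfolding k_def R_def using k.is_cring by (intro image_algebra_algebra e j) (simp add: k_def)
  define s t where "s = deform [:[:0, 1:]:]" and "t = deform [:0, 1:]"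
  have st: "s = Dual2 (incl [:[:0, 1:]:]) 1 0" "t = Dual2 (incl [:0, 1:]) 0 1"
    by (simp_all add: s_def t_def deform_def map_poly_pCons pderiv_pCons incl_hom map_poly_pderiv_1 flip: one_pCons)
  have sqrt: "\<exists>y :: big_field. y * y = x" for x
    using nth_root_exists[of 2 x] by (auto simp: power2_eq_square)
  have two: "\<one>\<^bsub>R\<^esub> \<oplus>\<^bsub>R\<^esub> \<one>\<^bsub>R\<^esub> = \<zero>\<^bsub>R\<^esub>" unfolding simps using big_field_two by (simp add: dual2_defs)
  have st_one: "e s \<odot>\<^bsub>R\<^esub> \<one>\<^bsub>R\<^esub> = j s" "e t \<odot>\<^bsub>R\<^esub> \<one>\<^bsub>R\<^esub> = j t" unfolding simps by simp_all
  have Der: "trivial_mod (Der k R)" "module R (Der k R)"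
  proof -
    have prems: "cring R" "e s \<in> carrier k" "e t \<in> carrier k"
      using deform_constants by (auto simp: k_def image_ring_def s_def t_def intro: R.is_cring)
    have k_one: "c \<odot>\<^bsub>R\<^esub> \<one>\<^bsub>R\<^esub> \<in> carrier R" if "c \<in> carrier k" for c
      using that by (auto simp: k_def image_ring_def simps)
    have repr: "\<exists>p\<in>carrier R. \<exists>q\<in>carrier R. \<exists>w\<in>carrier R. \<exists>q'\<in>carrier R. \<exists>w'\<in>carrier R.
      r = p \<otimes>\<^bsub>R\<^esub> p \<oplus>\<^bsub>R\<^esub> (q \<otimes>\<^bsub>R\<^esub> q \<otimes>\<^bsub>R\<^esub> (e s \<odot>\<^bsub>R\<^esub> \<one>\<^bsub>R\<^esub> \<oplus>\<^bsub>R\<^esub> w \<otimes>\<^bsub>R\<^esub> w) \<oplus>\<^bsub>R\<^esub>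
        q' \<otimes>\<^bsub>R\<^esub> q' \<otimes>\<^bsub>R\<^esub> (e t \<odot>\<^bsub>R\<^esub> \<one>\<^bsub>R\<^esub> \<oplus>\<^bsub>R\<^esub> w' \<otimes>\<^bsub>R\<^esub> w'))" if r: "r \<in> carrier R" for r
    proof -
      obtain y where y: "r = j y" using r by (auto simp: simps(1))
      obtain x u v where "y = Dual2 x u v" by (cases y)
      then have x: "r = j (Dual2 x u v)" using y by simp
      obtain p where p: "p * p = x" using sqrt by blast
      obtain q where q: "q * q = u" using sqrt by blast
      obtain q' where q': "q' * q' = v" using sqrt by blast
      obtain w where w: "w * w = incl [:[:0, 1:]:]" using sqrt by blast
      obtain w' where w': "w' * w' = incl [:0, 1:]" using sqrt by blast
      \<comment> \<open>In characteristic \<open>2\<close> adding \<open>w\<^sup>2\<close> to \<open>s\<close> leaves \<open>a\<close>, and likewise \<open>w'\<^sup>2\<close> and \<open>t\<close>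
        leave \<open>b\<close>.\<close>
      have dbl: "y + y = 0" for y :: big_field
      proof -
        have "y + y = y * (1 + 1)" by (simp only: distrib_left mult_1_right)
        then show ?thesis by (simp only: big_field_two mult_zero_right)
      qed
      let ?d = "\<lambda>x. j (Dual2 x 0 0)"
      have "r = ?d p \<otimes>\<^bsub>R\<^esub> ?d p \<oplus>\<^bsub>R\<^esub> (?d q \<otimes>\<^bsub>R\<^esub> ?d q \<otimes>\<^bsub>R\<^esub> (e s \<odot>\<^bsub>R\<^esub> \<one>\<^bsub>R\<^esub> \<oplus>\<^bsub>R\<^esub> ?d w \<otimes>\<^bsub>R\<^esub> ?d w) \<oplus>\<^bsub>R\<^esub>
        ?d q' \<otimes>\<^bsub>R\<^esub> ?d q' \<otimes>\<^bsub>R\<^esub> (e t \<odot>\<^bsub>R\<^esub> \<one>\<^bsub>R\<^esub> \<oplus>\<^bsub>R\<^esub> ?d w' \<otimes>\<^bsub>R\<^esub> ?d w'))"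
        unfolding st_one x simps st by (simp add: dual2_defs p q q' w w' dbl)
      moreover have "?d y \<in> carrier R" for y by (simp add: simps(1))
      ultimately show ?thesis by blast
    qed
    show "trivial_mod (Der k R)" "module R (Der k R)"
      using Der_trivial[OF prems(1) two prems(2,3) k_one repr] by blast+
  qed
  have "finitely_generated R (Der k R)"
  proof -
    have "N = carrier (Der k R)" if "submodule N R (Der k R)" for N
    proof -
      have "N \<subseteq> carrier (Der k R)" "\<zero>\<^bsub>Der k R\<^esub> \<in> N"
        using that subgroup.subset subgroup.one_closed by (fastforce simp: submodule_def)+
      then show ?thesis using Der(1) by (auto simp: trivial_mod_def)
    qed
    then show ?thesis unfolding finitely_generated_def by (intro exI[of _ "{}"]) auto
  qed
  moreover have "Gdim R (Der k R) < \<infinity>" by (rule R.Gdim_zero[OF Der(2,1)])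
  moreover have "CIdim R (Der k R) < \<infinity>" using Der(1) by (simp add: CIdim_def)
  ultimately show ?thesis using k alg R.local R.not_gorenstein R.not_complete_intersection by blast
qed

end
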